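(* Let $H,A,a,\rho,\mu,\alpha,\beta,\gamma,\alpha_1$, the Hilbert space $\mathcal H$, the operator $\mathcal A$ and the semigroup $e^{\mathcal At}$ be as in the context, and assume that the kernel is of exponential type, $g(s)=e^{-\delta s}$ with $\delta>0$. Then $t^{-\frac1{2-2a}}$ is the optimal polynomial decay rate of the solutions to the system: there is $C>0$ such that $$\|e^{\mathcal At}X_0\|_{\mathcal H}\le C\,t^{-\frac1{2-2a}}\|X_0\|_{\mathcal D(\mathcal A)}\qquad\text{for all }X_0\in\mathcal D(\mathcal A),\ t\ge1,$$ where $\|\cdot\|_{\mathcal D(\mathcal A)}$ is the graph norm, and for no $\varepsilon>0$ does there exist a constant $C_\varepsilon>0$ such that $\|e^{\mathcal At}X_0\|_{\mathcal H}\le C_\varepsilon\,t^{-\frac1{2-2a}-\varepsilon}\|X_0\|_{\mathcal D(\mathcal A)}$ for all $X_0\in\mathcal D(\mathcal A)$ and $t\ge1$.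
   Context: Setting. $(H,\langle\cdot,\cdot\rangle,\|\cdot\|)$ is a complex Hilbert space and $A:\mathcal D(A)\to H$ is a strictly positive self-adjoint operator with compact resolvent, with eigenvalues $0<\xi_1<\xi_2<\cdots$, $\xi_k\to+\infty$, and eigenvectors $A\Psi_k=\xi_k\Psi_k$, where $\{\Psi_k\}_{k\in\mathbb N}$ is an orthonormal basis of $H$. Fractional powers are defined spectrally: $A^{\vartheta}f=\sum_k \xi_k^{\vartheta}\langle f,\Psi_k\rangle\Psi_k$ on $D(A^\vartheta)=\{f\in H:\sum_k\xi_k^{2\vartheta}|\langle f,\Psi_k\rangle|^2<\infty\}$ for $\vartheta\in[0,1]$; more generally, for $r\in\mathbb R$ one considers the scale of Hilbert spaces $D(A^{r/2})$ with inner product $\langle A^{r/2}\cdot,A^{r/2}\cdot\rangle$. Parameters: $a\in[0,1)$; $\rho,\mu,\alpha,\beta,\gamma>0$ with $\alpha_1:=\alpha-\gamma^2\beta>0$. For the kernel $g(s)=e^{-\delta s}$ one has $\zeta:=\int_0^\infty g(s)ds=1/\delta$. In this setting it is asserted (not imposed as a separate hypothesis), from the compactness of the embeddings $D(A^{r_1/2})\hookrightarrow D(A^{r_2/2})$ for $r_1>r_2$, that for $a\in[0,1)$ there is a constant $\kappa\in(0,\alpha_1)$ with $\alpha_1\|A^{1/2}u\|^2-\zeta\|A^{a/2}u\|^2>\kappa\|A^{1/2}u\|^2$ for all $0\neq u\in D(A^{1/2})$; by this, the space $\mathcal H$ below is a Hilbert space. The underlying system is $$\rho v_{tt}=-\alpha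 Av+\gamma\beta Ap+\int_0^\infty g(s)A^av(t-s)ds,\qquad \mu p_{tt}=-\beta Ap+\gamma\beta Av,\qquad t>0,$$ with $v(0)=v_0$, $v_t(0)=v_1$, $p(0)=p_0$, $p_t(0)=p_1$, $v(-s)=h(s)$ for $s>0$. With $\eta(t,s)=v(t)-v(t-s)$ it is rewritten as $X'(t)=\mathcal AX(t)$, $X(0)=X_0$, for $X=(v,v_t,p,p_t,\eta)$. $L^2_g(\mathbb R_+,D(A^{a/2}))$ is the space of functions $w$ with $w(s)\in D(A^{a/2})$ for $s\in\mathbb R_+$ and $\int_0^\infty g(s)\|A^{a/2}w(s)\|^2ds<\infty$. State space: $\mathcal H=(D(A^{1/2})\times H)^2\times L^2_g(\mathbb R_+,D(A^{a/2}))$ with inner product $$\langle(v,u,p,q,\eta),(\tilde v,\tilde u,\tilde p,\tilde q,\tilde\eta)\rangle_{\mathcal H}=\alpha_1\langle A^{1/2}v,A^{1/2}\tilde v\rangle-\zeta\langle A^{a/2}v,A^{a/2}\tilde v\rangle+\rho\langle u,\tilde u\rangle+\beta\langle\gamma A^{1/2}v-A^{1/2}p,\gamma A^{1/2}\tilde v-A^{1/2}\tilde p\rangle+\mu\langle q,\tilde q\rangle+\int_0^\infty g(s)\langle A^{a/2}\eta(s),A^{a/2}\tilde\eta(s)\rangle ds.$$ Operator: $$\mathcal A(v,u,p,q,\eta)=\Big(u,\ \tfrac1\rho\big(-\alpha Av+\gamma\beta Ap+\zeta A^av-\textstyle\int_0^\infty g(s)A^a\eta(s)ds\big),\ q,\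 \tfrac1\mu(-\beta Ap+\gamma\beta Av),\ u-\eta_s\Big)$$ with domain $$\mathcal D(\mathcal A)=\big(D(A)\times D(A^{1/2})\big)^2\times L^2_g(\mathbb R_+,D(A^{a/2})),$$ where the memory component is understood to satisfy $\eta(0)=0$ and $\eta_s\in L^2_g(\mathbb R_+,D(A^{a/2}))$. The operator $\mathcal A$ generates a $C_0$-semigroup of contractions $e^{\mathcal At}$ on $\mathcal H$.
   Formalization: The coercivity bound with κ is assumed (it fails if α₁ξ₁^{1-a} ≤ 1/δ, when the inner product is not positive definite); D(𝒜) also requires ∫gη ds ∈ D(A^a) so that 𝒜 maps into the state space; the semigroup is generated by the closure of 𝒜, which is not closed for a>0. *)

theory Defs
  imports "HOL-Analysis.Analysis"
begin

section \<open>Complex Hilbert spaces\<close>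

text \<open>The inner product is linear in its first argument; positive definiteness is contained in
  the norm axiom.\<close>

class complex_inner = real_normed_vector +
  fixes scaleC :: "complex \<Rightarrow> 'a \<Rightarrow> 'a" (infixr "*\<^sub>C" 75)
    and cinner :: "'a \<Rightarrow> 'a \<Rightarrow> complex"
  assumes scaleC_add_right: "c *\<^sub>C (x + y) = c *\<^sub>C x + c *\<^sub>C y"
    and scaleC_add_left: "(c + d) *\<^sub>C x = c *\<^sub>C x + d *\<^sub>C x"
    and scaleC_scaleC: "c *\<^sub>C d *\<^sub>C x = (c * d) *\<^sub>C x"
    and scaleC_of_real: "complex_of_real r *\<^sub>C x = r *\<^sub>R x"
    and cinner_commute: "cinner x y = cnj (cinner y x)"
    and cinner_add_left: "cinner (x + y) z = cinner x z + cinner y z"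
    and cinner_scaleC_left: "cinner (c *\<^sub>C x) y = c * cinner x y"
    and norm_eq_sqrt_cinner: "norm x = sqrt (Re (cinner x x))"

text \<open>Second countability is separability. It is forced by the existence of an orthonormal
  basis indexed by the natural numbers, and the Bochner integral asks for it.\<close>

class separable_chilbert_space = complex_inner + banach + second_countable_topology

section \<open>Unbounded operators\<close>

definition linear_operator :: "'h::complex_inner set \<Rightarrow> ('h \<Rightarrow> 'h) \<Rightarrow> bool" where
  "linear_operator D T \<longleftrightarrow> 0 \<in> D \<and>
     (\<forall>x\<in>D. \<forall>y\<in>D. x + y \<in> D \<and> T (x + y) = T x + T y) \<and>
     (\<forall>c. \<forall>x\<in>D. c *\<^sub>C x \<in> D \<and> T (c *\<^sub>C x) = c *\<^sub>C T x)"

text \<open>The last conjunct says that the graphs of the operator and of its adjoint agree.\<close>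

definition self_adjoint :: "'h::complex_inner set \<Rightarrow> ('h \<Rightarrow> 'h) \<Rightarrow> bool" where
  "self_adjoint D T \<longleftrightarrow> linear_operator D T \<and> closure D = UNIV \<and>
     (\<forall>f y. (f \<in> D \<and> T f = y) \<longleftrightarrow> (\<forall>x\<in>D. cinner (T x) f = cinner x y))"

definition strictly_positive :: "'h::complex_inner set \<Rightarrow> ('h \<Rightarrow> 'h) \<Rightarrow> bool" where
  "strictly_positive D T \<longleftrightarrow> (\<forall>f\<in>D. f \<noteq> 0 \<longrightarrow> Re (cinner (T f) f) > 0)"

definition compact_resolvent :: "'h::complex_inner set \<Rightarrow> ('h \<Rightarrow> 'h) \<Rightarrow> bool" where
  "compact_resolvent D T \<longleftrightarrow>
     (\<exists>z. bij_betw (\<lambda>f. z *\<^sub>C f - T f) D UNIV \<and>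
          (\<forall>B. bounded B \<longrightarrow> compact (closure (inv_into D (\<lambda>f. z *\<^sub>C f - T f) ` B))))"

definition orthonormal_basis :: "(nat \<Rightarrow> 'h::complex_inner) \<Rightarrow> bool" where
  "orthonormal_basis \<Psi> \<longleftrightarrow>
     (\<forall>i j. cinner (\<Psi> i) (\<Psi> j) = (if i = j then 1 else 0)) \<and>
     (\<forall>f. (\<lambda>k. cinner f (\<Psi> k) *\<^sub>C \<Psi> k) sums f)"

section \<open>The data of the system\<close>

text \<open>\<open>eigval\<close> and \<open>eigvec\<close> are the eigenvalues and eigenvectors of the operator \<open>opA\<close> with
  domain \<open>domA\<close>, both indexed from 0; the remaining fields are the parameters
  $a, \rho, \mu, \alpha, \beta, \gamma$ and the memory kernel $g$.\<close>

record 'h memory_system =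
  domA :: "'h set"
  opA :: "'h \<Rightarrow> 'h"
  eigval :: "nat \<Rightarrow> real"
  eigvec :: "nat \<Rightarrow> 'h"
  par_a :: real
  par_rho :: real
  par_mu :: real
  par_alpha :: real
  par_beta :: real
  par_gamma :: real
  kern :: "real \<Rightarrow> real"

definition alpha1 :: "'h memory_system \<Rightarrow> real" where
  "alpha1 P = par_alpha P - (par_gamma P)\<^sup>2 * par_beta P"

abbreviation Rplus :: "real measure" where
  "Rplus \<equiv> lebesgue_on {0<..}"

definition zeta :: "'h memory_system \<Rightarrow> real" where
  "zeta P = (LINT s|Rplus. kern P s)"

definition admissible :: "'h::separable_chilbert_space memory_system \<Rightarrow> bool" where
  "admissible P \<longleftrightarrow>
     self_adjoint (domA P) (opA P) \<and>
     strictly_positive (domA P) (opA P) \<and>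
     compact_resolvent (domA P) (opA P) \<and>
     0 < eigval P 0 \<and> strict_mono (eigval P) \<and> filterlim (eigval P) at_top sequentially \<and>
     orthonormal_basis (eigvec P) \<and>
     (\<forall>k. eigvec P k \<in> domA P \<and> opA P (eigvec P k) = eigval P k *\<^sub>R eigvec P k) \<and>
     0 \<le> par_a P \<and> par_a P < 1 \<and>
     0 < par_rho P \<and> 0 < par_mu P \<and> 0 < par_alpha P \<and> 0 < par_beta P \<and> 0 < par_gamma P \<and>
     0 < alpha1 P"

definition dom_pow :: "'h::separable_chilbert_space memory_system \<Rightarrow> real \<Rightarrow> 'h set" where
  "dom_pow P \<theta> =
     {f. summable (\<lambda>k. eigval P k powr (2 * \<theta>) * (cmod (cinner f (eigvec P k)))\<^sup>2)}"

definition op_pow :: "'h::separable_chilbert_space memory_system \<Rightarrow> real \<Rightarrow> 'h \<Rightarrow> 'h" where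
  "op_pow P \<theta> f =
     (\<Sum>k. (complex_of_real (eigval P k powr \<theta>) * cinner f (eigvec P k)) *\<^sub>C eigvec P k)"

section \<open>The state space\<close>

text \<open>Elements of $L^2_g(\mathbb{R}_+, D(A^{a/2}))$ are represented by functions, and functions
  that agree almost everywhere on $(0,\infty)$ are identified by \<open>state_eq\<close> below rather than by
  forming a quotient. As $H$ is separable, measurability into $H$ of a function with values in
  $D(A^{a/2})$ is the same as strong measurability into $D(A^{a/2})$.\<close>

definition mem_space :: "'h::separable_chilbert_space memory_system \<Rightarrow> (real \<Rightarrow> 'h) set" where
  "mem_space P =
     {w. w \<in> borel_measurable Rplus \<and>
         (AE s in Rplus. w s \<in> dom_pow P (par_a P / 2)) \<and>
         integrable Rplus (\<lambda>s. kern P s * (norm (op_pow P (par_a P / 2) (w s)))\<^sup>2)}"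

type_synonym 'h state = "'h \<times> 'h \<times> 'h \<times> 'h \<times> (real \<Rightarrow> 'h)"

definition state_space :: "'h::separable_chilbert_space memory_system \<Rightarrow> 'h state set" where
  "state_space P =
     {(v, u, p, q, \<eta>). v \<in> dom_pow P (1/2) \<and> p \<in> dom_pow P (1/2) \<and> \<eta> \<in> mem_space P}"

fun state_eq :: "'h state \<Rightarrow> 'h state \<Rightarrow> bool" where
  "state_eq (v, u, p, q, \<eta>) (v', u', p', q', \<eta>') \<longleftrightarrow>
     v = v' \<and> u = u' \<and> p = p' \<and> q = q' \<and> (AE s in Rplus. \<eta> s = \<eta>' s)"

fun state_add :: "'h::complex_inner state \<Rightarrow> 'h state \<Rightarrow> 'h state" where
  "state_add (v, u, p, q, \<eta>) (v', u', p', q', \<eta>') =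
     (v + v', u + u', p + p', q + q', (\<lambda>s. \<eta> s + \<eta>' s))"

fun state_scale :: "complex \<Rightarrow> 'h::complex_inner state \<Rightarrow> 'h state" where
  "state_scale c (v, u, p, q, \<eta>) = (c *\<^sub>C v, c *\<^sub>C u, c *\<^sub>C p, c *\<^sub>C q, (\<lambda>s. c *\<^sub>C \<eta> s))"

definition state_diff :: "'h::complex_inner state \<Rightarrow> 'h state \<Rightarrow> 'h state" where
  "state_diff X Y = state_add X (state_scale (-1) Y)"

fun state_inner ::
  "'h::separable_chilbert_space memory_system \<Rightarrow> 'h state \<Rightarrow> 'h state \<Rightarrow> complex" where
  "state_inner P (v, u, p, q, \<eta>) (v', u', p', q', \<eta>') =
     (let A_half = op_pow P (1/2); A_a2 = op_pow P (par_a P / 2) in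
        alpha1 P * cinner (A_half v) (A_half v')
      - zeta P * cinner (A_a2 v) (A_a2 v')
      + par_rho P * cinner u u'
      + par_beta P * cinner (par_gamma P *\<^sub>R A_half v - A_half p)
                            (par_gamma P *\<^sub>R A_half v' - A_half p')
      + par_mu P * cinner q q'
      + (LINT s|Rplus. kern P s * cinner (A_a2 (\<eta> s)) (A_a2 (\<eta>' s))))"

definition state_norm :: "'h::separable_chilbert_space memory_system \<Rightarrow> 'h state \<Rightarrow> real" where
  "state_norm P X = sqrt (Re (state_inner P X X))"

section \<open>The operator of the evolution equation\<close>

text \<open>\<open>has_mem_deriv P \<eta> w\<close> states that $\eta_s = w \in L^2_g(\mathbb{R}_+, D(A^{a/2}))$ and
  $\eta(0) = 0$: the absolutely continuous representative of $\eta$ is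
  $s \mapsto \int_0^s w(r)\,dr$.\<close>

definition has_mem_deriv ::
  "'h::separable_chilbert_space memory_system \<Rightarrow> (real \<Rightarrow> 'h) \<Rightarrow> (real \<Rightarrow> 'h) \<Rightarrow> bool" where
  "has_mem_deriv P \<eta> w \<longleftrightarrow> w \<in> mem_space P \<and>
     (AE s in Rplus. \<eta> s = (LINT r:{0<..s}|lebesgue. w r))"

text \<open>The derivative is unique up to equality almost everywhere.\<close>

definition mem_deriv ::
  "'h::separable_chilbert_space memory_system \<Rightarrow> (real \<Rightarrow> 'h) \<Rightarrow> real \<Rightarrow> 'h" where
  "mem_deriv P \<eta> = (SOME w. has_mem_deriv P \<eta> w)"

text \<open>For $\eta \in L^2_g(\mathbb{R}_+, D(A^{a/2}))$ the values $A^a \eta(s)$ lie in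
  $D(A^{-a/2})$, and in that space
  $\int_0^\infty g(s) A^a \eta(s)\,ds = A^a \int_0^\infty g(s)\,\eta(s)\,ds$, where the last
  integral belongs to $D(A^{a/2})$. The sum in the second component of the operator therefore
  belongs to $H$ (for $v, p \in D(A)$) if and only if $\int_0^\infty g(s)\,\eta(s)\,ds$ belongs
  to $D(A^a)$. This last condition is made explicit in the domain; it is void for $a = 0$.\<close>

definition mem_mean :: "'h::separable_chilbert_space memory_system \<Rightarrow> (real \<Rightarrow> 'h) \<Rightarrow> 'h" where
  "mem_mean P \<eta> = (LINT s|Rplus. kern P s *\<^sub>R \<eta> s)"

definition evol_dom :: "'h::separable_chilbert_space memory_system \<Rightarrow> 'h state set" where
  "evol_dom P =
     {(v, u, p, q, \<eta>).
        v \<in> domA P \<and> u \<in> dom_pow P (1/2) \<and> p \<in> domA P \<and> q \<in> dom_pow P (1/2) \<and>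
        \<eta> \<in> mem_space P \<and> (\<exists>w. has_mem_deriv P \<eta> w) \<and>
        mem_mean P \<eta> \<in> dom_pow P (par_a P)}"

fun evol_op :: "'h::separable_chilbert_space memory_system \<Rightarrow> 'h state \<Rightarrow> 'h state" where
  "evol_op P (v, u, p, q, \<eta>) =
     (u,
      (1 / par_rho P) *\<^sub>R
        (- (par_alpha P *\<^sub>R opA P v) + (par_gamma P * par_beta P) *\<^sub>R opA P p
         + zeta P *\<^sub>R op_pow P (par_a P) v - op_pow P (par_a P) (mem_mean P \<eta>)),
      q,
      (1 / par_mu P) *\<^sub>R
        (- (par_beta P *\<^sub>R opA P p) + (par_gamma P * par_beta P) *\<^sub>R opA P v),
      (\<lambda>s. u - mem_deriv P \<eta> s))"

definition graph_norm :: "'h::separable_chilbert_space memory_system \<Rightarrow> 'h state \<Rightarrow> real" where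
  "graph_norm P X = state_norm P X + state_norm P (evol_op P X)"

section \<open>Semigroups on the state space\<close>

definition contraction_semigroup ::
  "'h::separable_chilbert_space memory_system \<Rightarrow> (real \<Rightarrow> 'h state \<Rightarrow> 'h state) \<Rightarrow> bool" where
  "contraction_semigroup P S \<longleftrightarrow>
     (\<forall>t\<ge>0. \<forall>X\<in>state_space P. S t X \<in> state_space P) \<and>
     (\<forall>t\<ge>0. \<forall>X\<in>state_space P. \<forall>Y\<in>state_space P. \<forall>c.
        state_eq (S t (state_add (state_scale c X) Y)) (state_add (state_scale c (S t X)) (S t Y))) \<and>
     (\<forall>X\<in>state_space P. state_eq (S 0 X) X) \<and>
     (\<forall>s\<ge>0. \<forall>t\<ge>0. \<forall>X\<in>state_space P. state_eq (S (s + t) X) (S s (S t X))) \<and>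
     (\<forall>X\<in>state_space P. ((\<lambda>t. state_norm P (state_diff (S t X) X)) \<longlongrightarrow> 0) (at_right 0)) \<and>
     (\<forall>t\<ge>0. \<forall>X\<in>state_space P. state_norm P (S t X) \<le> state_norm P X)"

definition generator_graph ::
  "'h::separable_chilbert_space memory_system \<Rightarrow> (real \<Rightarrow> 'h state \<Rightarrow> 'h state)
     \<Rightarrow> 'h state \<Rightarrow> 'h state \<Rightarrow> bool" where
  "generator_graph P S X Y \<longleftrightarrow> X \<in> state_space P \<and> Y \<in> state_space P \<and>
     ((\<lambda>h. state_norm P
         (state_diff (state_scale (complex_of_real (1/h)) (state_diff (S h X) X)) Y))
       \<longlongrightarrow> 0) (at_right 0)"

definition evol_op_closure ::
  "'h::separable_chilbert_space memory_system \<Rightarrow> 'h state \<Rightarrow> 'h state \<Rightarrow> bool" where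
  "evol_op_closure P X Y \<longleftrightarrow> X \<in> state_space P \<and> Y \<in> state_space P \<and>
     (\<exists>Z. (\<forall>n. Z n \<in> evol_dom P) \<and>
          (\<lambda>n. state_norm P (state_diff (Z n) X)) \<longlonglongrightarrow> 0 \<and>
          (\<lambda>n. state_norm P (state_diff (evol_op P (Z n)) Y)) \<longlonglongrightarrow> 0)"

text \<open>The operator generates the semigroup through its closure. The closure is needed: for
  $a > 0$ the requirements $v \in D(A)$ and $\int_0^\infty g(s)\,\eta(s)\,ds \in D(A^a)$ hold
  separately on \<open>evol_dom\<close>, whereas the domain of a generator only controls the combination of
  $v$ and $\eta$ in the second component, so that \<open>evol_op\<close> is not closed. For $a = 0$ it is
  closed already.\<close>

definition generates_contraction_semigroup ::
  "'h::separable_chilbert_space memory_system \<Rightarrow> (real \<Rightarrow> 'h state \<Rightarrow> 'h state) \<Rightarrow> bool" where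
  "generates_contraction_semigroup P S \<longleftrightarrow> contraction_semigroup P S \<and>
     (\<forall>X Y. generator_graph P S X Y \<longleftrightarrow> evol_op_closure P X Y)"

end

theory Submission
  imports Defs
begin

text \<open>For the exponential kernel the coefficients of $v, v_t, p, p_t$ and of the mean
  $\int_0^\infty g\eta$ along one eigenvector of $A$ satisfy a closed five-dimensional linear
  system. With $\sigma = \xi^{a-1}$, a Lyapunov function shows that its energy decays like
  $e^{-c\sigma t}$, uniformly in the eigenvalue $\xi$. The time derivative of a solution solves the
  same system and controls $\xi^{1/2}$ times the solution, up to the coefficient
  $w = \int_0^\infty g(s) v(t-s) ds$, which coercivity forces to decay at a uniform exponential
  rate. As $\xi^{-1} = \sigma^{1/(1-a)}$, this gives the rate $t^{-1/(1-a)}$ for the mechanical part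
  $R$ of the squared norm of the state. The squared norm $E$ itself satisfies
  $E' = -\delta E + \delta R$, so the memory follows. Conversely, in a mode with $v = p = 0$,
  $p_t = 0$ and $\eta = 0$ initially, the dissipation stays of order $\sigma$ for times of order
  $\sigma^{-1}$, and no better rate is possible.\<close>

section \<open>Complex inner product spaces\<close>

text \<open>The modes do not see the whole memory: along one eigenvector \<eta> is still a function
  of s, and only its mean obeys a closed equation, because g' = - \<delta> g turns the mean of
  \<eta>_s into \<delta> times the mean of \<eta>. The sum of the modal energies is therefore
  dominated by the full energy without dominating it. This is enough for optimality, whereas the
  upper bound has to return to the exact energy identity of the full state. A second obstacle is
  that the generator is only the closure of \<open>evol_op\<close>: an orbit that starts in
  \<open>evol_dom\<close> is known to stay in the domain of the closure, and \<open>evol_op\<close>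
  is never evaluated along it. The modal equations are identities between bounded functionals and
  the dissipation law is one between continuous forms, and both pass to the limits that define the
  closure.\<close>

lemma scaleC_one [simp]: "1 *\<^sub>C (x::'a::complex_inner) = x"
  using scaleC_of_real[of 1 x] by simp

lemma scaleC_zero_left [simp]: "0 *\<^sub>C (x::'a::complex_inner) = 0"
  using scaleC_of_real[of 0 x] by simp

lemma scaleC_minus1: "(-1) *\<^sub>C (x::'a::complex_inner) = - x"
  using scaleC_of_real[of "-1" x] by simp

lemma scaleC_zero_right [simp]: "c *\<^sub>C (0::'a::complex_inner) = 0"
  using scaleC_scaleC[of c 0 "0::'a"] by simp

lemma scaleR_eq_scaleC: "r *\<^sub>R (x::'a::complex_inner) = complex_of_real r *\<^sub>C x"
  by (simp add: scaleC_of_real)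

lemma cinner_zero_left [simp]: "cinner 0 (y::'a::complex_inner) = 0"
  using cinner_scaleC_left[of 0 0 y] by simp

lemma cinner_scaleR_left: "cinner (r *\<^sub>R x) (y::'a::complex_inner) = of_real r * cinner x y"
  by (simp add: scaleR_eq_scaleC cinner_scaleC_left)

lemma cinner_minus_left: "cinner (- x) (y::'a::complex_inner) = - cinner x y"
  using cinner_scaleR_left[of "-1" x y] by simp

lemma cinner_diff_left: "cinner (x - z) (y::'a::complex_inner) = cinner x y - cinner z y"
  using cinner_add_left[of x "-z" y] by (simp add: cinner_minus_left)

lemma cinner_zero_right [simp]: "cinner (x::'a::complex_inner) 0 = 0"
  using cinner_commute[of x 0] by simp

lemma cinner_add_right: "cinner (x::'a::complex_inner) (y + z) = cinner x y + cinner x z"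
  by (metis cinner_add_left cinner_commute complex_cnj_add)

lemma cinner_scaleC_right: "cinner (x::'a::complex_inner) (c *\<^sub>C y) = cnj c * cinner x y"
  by (metis cinner_scaleC_left cinner_commute complex_cnj_mult)

lemma cinner_scaleR_right: "cinner (x::'a::complex_inner) (r *\<^sub>R y) = of_real r * cinner x y"
  by (simp add: scaleR_eq_scaleC cinner_scaleC_right)

lemma cinner_minus_right: "cinner (x::'a::complex_inner) (- y) = - cinner x y"
  using cinner_scaleR_right[of x "-1" y] by simp

lemma cinner_diff_right: "cinner (x::'a::complex_inner) (y - z) = cinner x y - cinner x z"
  using cinner_add_right[of x y "-z"] by (simp add: cinner_minus_right)

lemmas cinner_simps = cinner_add_left cinner_add_right cinner_diff_left cinner_diff_right
  cinner_minus_left cinner_minus_right cinner_scaleC_left cinner_scaleC_right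
  cinner_scaleR_left cinner_scaleR_right

lemma Re_cinner_self: "Re (cinner x x) = (norm (x::'a::complex_inner))\<^sup>2"
proof -
  have "sqrt (Re (cinner x x)) \<ge> 0" using norm_eq_sqrt_cinner[of x] norm_ge_zero[of x] by simp
  then have "Re (cinner x x) \<ge> 0" by simp
  then show ?thesis using norm_eq_sqrt_cinner[of x] by simp
qed

lemma cinner_self: "cinner x x = of_real ((norm (x::'a::complex_inner))\<^sup>2)"
proof (rule complex_eqI)
  show "Im (cinner x x) = Im (complex_of_real ((norm x)\<^sup>2))"
    using cinner_commute[of x x] by (simp add: complex_eq_iff)
qed (simp add: Re_cinner_self)

lemma norm_scaleC: "norm (c *\<^sub>C (x::'a::complex_inner)) = cmod c * norm x"
proof -
  have "(norm (c *\<^sub>C x))\<^sup>2 = (cmod c * norm x)\<^sup>2"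
  proof -
    have "cinner (c *\<^sub>C x) (c *\<^sub>C x) = (c * cnj c) * cinner x x"
      by (simp add: cinner_scaleC_left cinner_scaleC_right)
    also have "\<dots> = of_real ((cmod c)\<^sup>2 * (norm x)\<^sup>2)"
      by (simp add: cinner_self complex_norm_square[symmetric])
    finally show ?thesis
      by (simp add: Re_cinner_self[symmetric] power_mult_distrib)
  qed
  then show ?thesis by (simp add: power2_eq_iff_nonneg)
qed

lemma Re_cinner_commute: "Re (cinner x y) = Re (cinner y (x::'a::complex_inner))"
  by (subst cinner_commute) simp

lemma norm_add_cinner:
  "(norm (x + y))\<^sup>2 = (norm x)\<^sup>2 + 2 * Re (cinner x y) + (norm (y::'a::complex_inner))\<^sup>2"
  unfolding Re_cinner_self[symmetric] by (simp add: cinner_simps Re_cinner_commute[of y x])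

lemma norm_diff_cinner:
  "(norm (x - y))\<^sup>2 = (norm x)\<^sup>2 - 2 * Re (cinner x y) + (norm (y::'a::complex_inner))\<^sup>2"
  unfolding Re_cinner_self[symmetric] by (simp add: cinner_simps Re_cinner_commute[of y x])

text \<open>Expand the square of \<open>x - t y\<close> with \<open>t = \<langle>x,y\<rangle>/\<parallel>y\<parallel>\<^sup>2\<close>.\<close>

lemma cinner_Cauchy_Schwarz: "cmod (cinner x y) \<le> norm x * norm (y::'a::complex_inner)"
proof (cases "y = 0")
  case False
  define t where "t = cinner x y / of_real ((norm y)\<^sup>2)"
  have ny: "(norm y)\<^sup>2 > 0" using False by simp
  have "0 \<le> (norm (x - t *\<^sub>C y))\<^sup>2" by simp
  also have "\<dots> = (norm x)\<^sup>2 - 2 * Re (cnj t * cinner x y) + (cmod t)\<^sup>2 * (norm y)\<^sup>2"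
    by (simp add: norm_diff_cinner cinner_scaleC_right norm_scaleC power_mult_distrib)
  also have "cnj t * cinner x y = of_real ((cmod (cinner x y))\<^sup>2 / (norm y)\<^sup>2)"
    by (simp add: t_def complex_norm_square[symmetric] mult.commute of_real_power)
  also have "(cmod t)\<^sup>2 * (norm y)\<^sup>2 = (cmod (cinner x y))\<^sup>2 / (norm y)\<^sup>2"
    using ny by (simp add: t_def norm_divide power_divide norm_power power2_eq_square[of "(norm y)\<^sup>2"] field_simps)
  finally have "(cmod (cinner x y))\<^sup>2 \<le> (norm x)\<^sup>2 * (norm y)\<^sup>2"
    using ny by (simp add: field_simps)
  then show ?thesis by (metis abs_le_square_iff abs_norm_cancel abs_mult power_mult_distrib)
qed simp

lemma bounded_linear_cinner_left: "bounded_linear (\<lambda>x. cinner x (y::'a::complex_inner))"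
  by (rule bounded_linear_intro[where K = "norm y"])
     (simp_all add: cinner_add_left cinner_scaleR_left scaleR_conv_of_real cinner_Cauchy_Schwarz)

lemma bounded_linear_cinner_right: "bounded_linear (\<lambda>y. cinner (x::'a::complex_inner) y)"
  by (rule bounded_linear_intro[where K = "norm x"])
     (simp_all add: cinner_add_right cinner_scaleR_right scaleR_conv_of_real
        cinner_Cauchy_Schwarz mult.commute[of _ "norm x"])

lemma bounded_bilinear_cinner: "bounded_bilinear (cinner :: 'a::complex_inner \<Rightarrow> 'a \<Rightarrow> complex)"
  by standard (auto simp: cinner_simps scaleR_conv_of_real intro!: exI[of _ 1] cinner_Cauchy_Schwarz)

lemma borel_measurable_cinner [measurable (raw)]:
  fixes f g :: "'x \<Rightarrow> 'a::{complex_inner, second_countable_topology}"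
  assumes "f \<in> borel_measurable M" "g \<in> borel_measurable M"
  shows "(\<lambda>x. cinner (f x) (g x)) \<in> borel_measurable M"
  by (rule borel_measurable_continuous_Pair[OF assms])
     (intro bounded_bilinear.continuous_on[OF bounded_bilinear_cinner] continuous_intros)

lemma bounded_linear_scaleC_right: "bounded_linear (\<lambda>x. c *\<^sub>C (x::'a::complex_inner))"
  by (rule bounded_linear_intro[where K = "cmod c"])
     (simp_all add: scaleC_add_right scaleR_eq_scaleC scaleC_scaleC norm_scaleC mult.commute)

lemma bounded_linear_scaleC_left: "bounded_linear (\<lambda>c. c *\<^sub>C (x::'a::complex_inner))"
  by (rule bounded_linear_intro[where K = "norm x"])
     (simp_all add: scaleC_add_left scaleR_eq_scaleC scaleC_scaleC norm_scaleC scaleR_conv_of_real)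

section \<open>Orthonormal bases\<close>

locale hilbert_basis =
  fixes \<Psi> :: "nat \<Rightarrow> 'h::separable_chilbert_space"
  assumes basis: "orthonormal_basis \<Psi>"
begin

abbreviation cf :: "nat \<Rightarrow> 'h \<Rightarrow> complex" where
  "cf k f \<equiv> cinner f (\<Psi> k)"

lemma orthonormal: "cinner (\<Psi> i) (\<Psi> j) = (if i = j then 1 else 0)"
  using basis by (simp add: orthonormal_basis_def)

lemma norm_basis [simp]: "norm (\<Psi> i) = 1"
  using norm_eq_sqrt_cinner[of "\<Psi> i"] by (simp add: orthonormal)

lemma expansion: "(\<lambda>k. cf k f *\<^sub>C \<Psi> k) sums f"
  using basis by (simp add: orthonormal_basis_def)

lemma eq_from_cf: "(\<And>k. cf k f = cf k g) \<Longrightarrow> f = g"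
  using expansion[of f] expansion[of g] by (metis (no_types, lifting) sums_cong sums_unique2)

lemma parseval: "(\<lambda>k. cf k f * cnj (cf k g)) sums cinner f g"
proof -
  have "(\<lambda>k. cinner (cf k f *\<^sub>C \<Psi> k) g) sums cinner f g"
    by (rule bounded_linear.sums[OF bounded_linear_cinner_left expansion])
  then show ?thesis by (simp add: cinner_scaleC_left cinner_commute[symmetric])
qed

lemma parseval_norm: "(\<lambda>k. (cmod (cf k f))\<^sup>2) sums (norm f)\<^sup>2"
  using sums_Re[OF parseval[of f f]]
  by (simp add: Re_cinner_self complex_norm_square[symmetric] flip: of_real_power)

lemma cinner_sum_left: "cinner (\<Sum>i\<in>I. F i) y = (\<Sum>i\<in>I. cinner (F i) (y::'h))"
  using bounded_linear.linear[OF bounded_linear_cinner_left] by (rule linear_sum)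

text \<open>By orthogonality the squared norm of a finite block of the series is the sum of the
  squared moduli, so the two Cauchy criteria coincide and completeness supplies the limit. It gives
  a meaning to the infinite sum in \<open>op_pow\<close>.\<close>

lemma riesz_fischer:
  assumes "summable (\<lambda>k. (cmod (a k))\<^sup>2)"
  shows "summable (\<lambda>k. a k *\<^sub>C \<Psi> k)" and "cf j (\<Sum>k. a k *\<^sub>C \<Psi> k) = a j"
proof -
  have fin: "(norm (\<Sum>k\<in>I. a k *\<^sub>C \<Psi> k))\<^sup>2 = (\<Sum>k\<in>I. (cmod (a k))\<^sup>2)" if "finite I" for I
    using that
  proof (induction rule: finite_induct)
    case (insert i I)
    have "cinner (\<Sum>k\<in>I. a k *\<^sub>C \<Psi> k) (a i *\<^sub>C \<Psi> i) = (\<Sum>k\<in>I. cinner (a k *\<^sub>C \<Psi> k) (a i *\<^sub>C \<Psi> i))"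
      by (rule cinner_sum_left)
    also have "\<dots> = 0"
      by (rule sum.neutral) (use insert in \<open>auto simp: cinner_simps orthonormal\<close>)
    finally show ?case
      using insert by (simp add: norm_add_cinner norm_scaleC Re_cinner_commute[of "a i *\<^sub>C \<Psi> i"])
  qed simp
  show S: "summable (\<lambda>k. a k *\<^sub>C \<Psi> k)"
    unfolding summable_Cauchy
  proof (intro allI impI)
    fix e :: real assume "e > 0"
    then obtain N where N: "\<And>m n. m \<ge> N \<Longrightarrow> norm (\<Sum>k=m..<n. (cmod (a k))\<^sup>2) < e\<^sup>2"
      using assms unfolding summable_Cauchy by (meson zero_less_power)
    show "\<exists>N. \<forall>m\<ge>N. \<forall>n. norm (\<Sum>k=m..<n. a k *\<^sub>C \<Psi> k) < e"
    proof (intro exI[of _ N] allI impI)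
      fix m n assume "m \<ge> N"
      then have "(norm (\<Sum>k=m..<n. a k *\<^sub>C \<Psi> k))\<^sup>2 < e\<^sup>2"
        using N[of m n] fin[of "{m..<n}"] by simp
      then show "norm (\<Sum>k=m..<n. a k *\<^sub>C \<Psi> k) < e"
        using \<open>e > 0\<close> by (simp add: power_less_imp_less_base)
    qed
  qed
  have "(\<lambda>k. cf j (a k *\<^sub>C \<Psi> k)) sums cf j (\<Sum>k. a k *\<^sub>C \<Psi> k)"
    by (rule bounded_linear.sums[OF bounded_linear_cinner_left summable_sums[OF S]])
  moreover have "(\<lambda>k. cf j (a k *\<^sub>C \<Psi> k)) = (\<lambda>k. if k = j then a j else 0)"
    by (auto simp: cinner_simps orthonormal)
  ultimately show "cf j (\<Sum>k. a k *\<^sub>C \<Psi> k) = a j"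
    using sums_single[of j "\<lambda>_. a j"] sums_unique2 by fastforce
qed

end

section \<open>Differential inequalities\<close>

text \<open>Semigroup orbits live on the half line, hence derivatives within \<open>{0..}\<close>;
  at the interior points of the interval they are ordinary ones, and continuity takes care of a left
  end at 0.\<close>

lemma nonincreasing_from_deriv:
  fixes f :: "real \<Rightarrow> real"
  assumes d: "\<And>t. t \<ge> 0 \<Longrightarrow> (f has_real_derivative f' t) (at t within {0..})"
    and ab: "0 \<le> a" "a \<le> b"
    and le: "\<And>t. a < t \<Longrightarrow> t < b \<Longrightarrow> f' t \<le> 0"
  shows "f b \<le> f a"
proof (cases "a = b")
  case False
  have cont: "continuous_on {a..b} f"
    by (rule continuous_on_subset[of "{0..}"])
       (use d ab in \<open>auto intro!: DERIV_continuous_on\<close>)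
  show ?thesis
  proof (rule DERIV_nonpos_imp_decreasing_open[of a b f])
    fix x assume x: "a < x" "x < b"
    have "(f has_real_derivative f' x) (at x within {0<..})"
      by (rule DERIV_subset[OF d]) (use x ab in auto)
    then have "(f has_real_derivative f' x) (at x)"
      using x ab by (subst (asm) at_within_open) auto
    then show "\<exists>y. (f has_real_derivative y) (at x) \<and> y \<le> 0" using le[OF x] by auto
  qed (use False ab cont in auto)
qed simp

text \<open>Forcing at a rate slower than half the damping rate: the slower exponential survives,
  with a constant independent of l.\<close>

lemma gronwall_exp:
  fixes J :: "real \<Rightarrow> real"
  assumes d: "\<And>t. t \<ge> 0 \<Longrightarrow> (J has_real_derivative J' t) (at t within {0..})"
    and le: "\<And>t. t \<ge> 0 \<Longrightarrow> J' t \<le> - \<nu> * J t + F * exp (- l * t)"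
    and \<nu>: "\<nu> > 0" "l \<le> \<nu> / 2" "F \<ge> 0" and t: "t \<ge> 0"
  shows "J t \<le> exp (- \<nu> * t) * J 0 + 2 * F / \<nu> * exp (- l * t)"
proof -
  \<comment> \<open>The integrating factor e^(\<nu> t), minus a function whose derivative dominates
    the forcing: \<nu> - l \<ge> \<nu>/2 makes 2F/\<nu> times \<nu> - l at least F.\<close>
  define H where "H = (\<lambda>t. exp (\<nu> * t) * J t - 2 * F / \<nu> * exp ((\<nu> - l) * t))"
  define H' where "H' = (\<lambda>t. exp (\<nu> * t) * (J' t + \<nu> * J t) - 2 * F / \<nu> * (\<nu> - l) * exp ((\<nu> - l) * t))"
  have "H t \<le> H 0"
  proof (rule nonincreasing_from_deriv[where f = H and f' = H'])
    fix t :: real assume t: "t \<ge> 0"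
    show "(H has_real_derivative H' t) (at t within {0..})"
      unfolding H_def H'_def using d[OF t] \<nu> by (auto intro!: derivative_eq_intros simp: field_simps)
  next
    fix s :: real assume s: "0 < s" "s < t"
    have "exp (\<nu> * s) * (J' s + \<nu> * J s) \<le> exp (\<nu> * s) * (F * exp (- l * s))"
      using le[of s] s by (intro mult_left_mono) auto
    also have "\<dots> = F * exp ((\<nu> - l) * s)"
      by (simp add: algebra_simps flip: exp_add)
    also have "\<dots> \<le> 2 * F / \<nu> * (\<nu> - l) * exp ((\<nu> - l) * s)"
    proof -
      have "F * 1 \<le> F * (2 / \<nu> * (\<nu> - l))"
        using \<nu> by (intro mult_left_mono) (auto simp: field_simps)
      then show ?thesis by (intro mult_right_mono) (auto simp: algebra_simps)
    qed
    finally show "H' s \<le> 0" by (simp add: H'_def)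
  qed (use t in auto)
  also have "H 0 \<le> J 0" using \<nu> by (simp add: H_def)
  finally have "exp (\<nu> * t) * J t \<le> J 0 + 2 * F / \<nu> * exp ((\<nu> - l) * t)"
    by (simp add: H_def)
  then have "exp (- \<nu> * t) * (exp (\<nu> * t) * J t) \<le> exp (- \<nu> * t) * (J 0 + 2 * F / \<nu> * exp ((\<nu> - l) * t))"
    by (intro mult_left_mono) auto
  moreover have "exp (- \<nu> * t) * (exp (\<nu> * t) * J t) = J t"
    by (simp add: mult.assoc[symmetric] flip: exp_add)
  moreover have "exp (- \<nu> * t) * exp ((\<nu> - l) * t) = exp (- l * t)"
    by (simp add: algebra_simps flip: exp_add)
  moreover have "exp (\<nu> * t) * exp (- (\<nu> * t)) = 1"
    by (simp flip: exp_add)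
  ultimately show ?thesis by (simp add: algebra_simps)
qed

section \<open>One mode of the system\<close>

lemma young: "x * y \<le> e * x\<^sup>2 + y\<^sup>2 / (4 * e)" if "e > 0" for x y e :: real
proof -
  have "0 \<le> (2 * e * x - y)\<^sup>2 / (4 * e)" using that by simp
  also have "\<dots> = e * x\<^sup>2 - x * y + y\<^sup>2 / (4 * e)"
    using that by (simp add: power2_eq_square field_simps)
  finally show ?thesis by simp
qed

text \<open>The coefficient a may vary with the mode while its bound A does not, which keeps the
  constants uniform. Below, e goes to the quantity to be absorbed, and the price is paid by one that
  is controlled at an earlier stage.\<close>

lemma young_abs: "a * x * y \<le> e * x\<^sup>2 + A\<^sup>2 / (4 * e) * y\<^sup>2"
  if "e > 0" "\<bar>a\<bar> \<le> A" for a x y e A :: real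
proof -
  have "a * x * y \<le> e * x\<^sup>2 + (a * y)\<^sup>2 / (4 * e)" using young[OF that(1), of x "a * y"] by (simp add: mult_ac)
  also have "(a * y)\<^sup>2 \<le> A\<^sup>2 * y\<^sup>2"
    unfolding power_mult_distrib using that by (intro mult_right_mono) (auto simp: abs_le_square_iff[symmetric])
  finally show ?thesis using that by (simp add: divide_right_mono)
qed

text \<open>The coefficients of an eigenmode, with \<open>m\<close> the coefficient of the mean
  $\int_0^\infty g\eta$; for the exponential kernel they satisfy a closed system. Here \<open>b\<close>
  stands for $\xi^a$ and \<open>S\<close> for a bound of $\xi^{a-1}$.\<close>

locale mode_params =
  fixes \<rho> \<mu> \<alpha> \<beta> \<gamma> \<delta> \<kappa> \<xi>0 S :: real
  assumes pos: "\<rho> > 0" "\<mu> > 0" "\<alpha> > 0" "\<beta> > 0" "\<gamma> > 0" "\<delta> > 0" "\<kappa> > 0" "\<xi>0 > 0" "S > 0"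
begin

text \<open>All that the estimates know of an eigenvalue, which makes their constants uniform over
  the modes. The last conjunct is coercivity tested on one eigenvector.\<close>

definition mode_ok :: "real \<Rightarrow> real \<Rightarrow> bool" where
  "mode_ok \<xi> b \<longleftrightarrow> \<xi>0 \<le> \<xi> \<and> 0 < b \<and> b \<le> S * \<xi> \<and> \<kappa> * \<xi> \<le> (\<alpha> - \<gamma>\<^sup>2 * \<beta>) * \<xi> - b / \<delta>"

text \<open>The energy of the state space along one mode, with the memory term at its least value
  for a given mean m: among all \<eta> with mean m the constant \<delta> m minimises the integral of
  g \<eta>^2, and the minimum is \<delta> m^2.\<close>

definition energy :: "real \<Rightarrow> real \<Rightarrow> real \<Rightarrow> real \<Rightarrow> real \<Rightarrow> real \<Rightarrow> real \<Rightarrow> real" where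
  "energy \<xi> b v u p q m =
     (\<alpha> - b / (\<delta> * \<xi>) - \<gamma>\<^sup>2 * \<beta>) * \<xi> * v\<^sup>2 + \<rho> * u\<^sup>2 + \<beta> * \<xi> * (p - \<gamma> * v)\<^sup>2 + \<mu> * q\<^sup>2 + \<delta> * b * m\<^sup>2"

section \<open>The Lyapunov functional of one mode\<close>

definition Phi where
  "Phi K2 K3 K4 \<theta> v u p q m =
     - K4 * (m * u) + K3 * (u * (\<theta> * v - \<gamma> * \<beta> * p))
     - K2 * ((\<theta> * v - \<gamma> * \<beta> * p) * (\<theta> * u - \<gamma> * \<beta> * q)) + (\<rho> * u * v + \<mu> * q * p)"

text \<open>The derivative of \<open>Phi\<close> along the modal system, written with the two
  forces: z drives v through \<rho> u' = - \<xi> z - b m, and x drives p through \<mu> q' = -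
  \<beta> \<xi> x. Its four lines belong to the four multipliers. Naming it separately makes the
  estimate pure algebra.\<close>

definition dPhi where
  "dPhi K2 K3 K4 \<xi> b \<theta> v u p q m =
    (let z = \<theta> * v - \<gamma> * \<beta> * p; x = p - \<gamma> * v in
     K4 * (- u\<^sup>2 / \<delta> + \<delta> * m * u + \<xi> * m * z / \<rho> + b * m\<^sup>2 / \<rho>)
   + K3 * (- \<xi> * z\<^sup>2 / \<rho> - b * m * z / \<rho> + \<theta> * u\<^sup>2 - \<gamma> * \<beta> * u * q)
   + K2 * (- (\<theta> * u - \<gamma> * \<beta> * q)\<^sup>2 + \<theta> * \<xi> * z\<^sup>2 / \<rho> + \<theta> * b * m * z / \<rho> - \<gamma> * \<beta>\<^sup>2 * \<xi> * z * x / \<mu>)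
   + (\<rho> * u\<^sup>2 + \<mu> * q\<^sup>2 - (\<theta> - \<gamma>\<^sup>2 * \<beta>) * \<xi> * v\<^sup>2 - \<beta> * \<xi> * x\<^sup>2 - b * m * v))"

lemma mode_okD:
  assumes "mode_ok \<xi> b"
  defines "\<theta> \<equiv> \<alpha> - b / (\<delta> * \<xi>)"
  shows "\<xi> > 0" "\<xi> \<ge> \<xi>0" "b > 0" "b \<le> S * \<xi>" "\<theta> \<le> \<alpha>" "\<kappa> + \<gamma>\<^sup>2 * \<beta> \<le> \<theta>" "0 < \<theta>" "\<kappa> \<le> \<alpha>"
proof -
  show *: "\<xi> > 0" "\<xi> \<ge> \<xi>0" "b > 0" "b \<le> S * \<xi>" using assms pos by (auto simp: mode_ok_def)
  show 1: "\<theta> \<le> \<alpha>" using * pos by (simp add: \<theta>_def)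
  have "\<kappa> * \<xi> \<le> (\<theta> - \<gamma>\<^sup>2 * \<beta>) * \<xi>"
  proof -
    have "(\<theta> - \<gamma>\<^sup>2 * \<beta>) * \<xi> = (\<alpha> - \<gamma>\<^sup>2 * \<beta>) * \<xi> - b / \<delta>"
      using * pos by (simp add: \<theta>_def left_diff_distrib)
    then show ?thesis using assms(1) by (simp add: mode_ok_def)
  qed
  then show 2: "\<kappa> + \<gamma>\<^sup>2 * \<beta> \<le> \<theta>" using * by simp
  have "\<gamma>\<^sup>2 * \<beta> > 0" using pos by simp
  then show "0 < \<theta>" "\<kappa> \<le> \<alpha>" using 1 2 pos by linarith+
qed

text \<open>The damping controls \<open>m\<close>, then \<open>u\<close> through $-mu$, then \<open>z\<close> through $uz$, then \<open>q\<close> through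
  $-z\dot z$, and finally everything through equipartition.\<close>

lemma dPhi_le:
  obtains K2 K3 K4 C1 where "K2 > 0" "K3 > 0" "K4 > 0" "C1 > 0"
    "\<And>\<xi> b v u p q m. mode_ok \<xi> b \<Longrightarrow>
       dPhi K2 K3 K4 \<xi> b (\<alpha> - b / (\<delta> * \<xi>)) v u p q m
         \<le> - (\<kappa> / 2 * \<xi> * v\<^sup>2 + u\<^sup>2 + \<beta> / 2 * \<xi> * (p - \<gamma> * v)\<^sup>2 + \<mu> / 2 * q\<^sup>2) + C1 * \<xi> * m\<^sup>2"
proof -
  \<comment> \<open>The weights are fixed against the order of the chain. K2 makes the q-term - 2
    \<mu> q^2; K3 balances all z^2 so produced (8/(\<gamma>^2 \<beta>) from \<open>t11\<close>,
    \<alpha> K2/\<rho> from \<open>t10\<close>, 3 from \<open>t2\<close>, \<open>t4\<close> and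
    \<open>t5\<close>); K4 collects the u^2 from \<open>t1\<close>, \<open>t7\<close>,
    \<open>t8\<close>, \<open>t9\<close> and equipartition, with one u^2 to spare; C1 is the total
    price in m^2.\<close>
  define K2 where "K2 = 4 * \<mu> / (\<gamma>\<^sup>2 * \<beta>\<^sup>2)"
  define K3 where "K3 = \<rho> * (8 / (\<gamma>\<^sup>2 * \<beta>) + \<alpha> * K2 / \<rho> + 3)"
  define K4 where "K4 = \<delta> * (K2 * \<alpha>\<^sup>2 + K3 * \<alpha> + (K3 * \<gamma> * \<beta>)\<^sup>2 / (2 * \<mu>) + \<rho> + 2)"
  define C1 where "C1 = (K4 * \<delta>)\<^sup>2 / (4 * \<xi>0) + (K4 / \<rho>)\<^sup>2 / 4 + K4 * S / \<rho> + (K3 * S / \<rho>)\<^sup>2 / 4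
     + (K2 * \<alpha> * S / \<rho>)\<^sup>2 / 4 + S\<^sup>2 / (2 * \<kappa>)"
  have K: "K2 > 0" "K3 > 0" "K4 > 0"
  proof -
    show "K2 > 0" using pos by (simp add: K2_def)
    then show "K3 > 0" using pos unfolding K3_def by (intro mult_pos_pos add_pos_pos divide_pos_pos) auto
    then show "K4 > 0" using pos \<open>K2 > 0\<close> unfolding K4_def
      by (intro mult_pos_pos add_nonneg_pos add_nonneg_nonneg) auto
  qed
  have C1: "C1 > 0"
    unfolding C1_def using pos K
    by (intro add_nonneg_pos add_nonneg_nonneg) auto
  show thesis
  proof (rule that[OF K C1])
    fix \<xi> b v u p q m :: real
    assume ok: "mode_ok \<xi> b"
    define \<theta> where "\<theta> = \<alpha> - b / (\<delta> * \<xi>)"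
    note o = mode_okD[OF ok, folded \<theta>_def]
    define z where "z = \<theta> * v - \<gamma> * \<beta> * p"
    define x where "x = p - \<gamma> * v"
    have t1: "K4 * (\<delta> * m * u) \<le> u\<^sup>2 + (K4 * \<delta>)\<^sup>2 / (4 * \<xi>0) * \<xi> * m\<^sup>2"
    proof -
      have "K4 * (\<delta> * m * u) \<le> u\<^sup>2 + (K4 * \<delta>)\<^sup>2 / 4 * m\<^sup>2"
        using young_abs[of 1 "K4 * \<delta>" "K4 * \<delta>" u m] K pos by (simp add: mult_ac)
      also have "(K4 * \<delta>)\<^sup>2 / 4 * m\<^sup>2 = (K4 * \<delta>)\<^sup>2 / (4 * \<xi>0) * m\<^sup>2 * \<xi>0" using pos by simp
      also have "\<dots> \<le> (K4 * \<delta>)\<^sup>2 / (4 * \<xi>0) * m\<^sup>2 * \<xi>"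
        using pos o by (intro mult_left_mono) auto
      finally show ?thesis by (simp add: mult_ac)
    qed
    have t2: "K4 * (\<xi> * m * z / \<rho>) \<le> \<xi> * z\<^sup>2 + (K4 / \<rho>)\<^sup>2 / 4 * \<xi> * m\<^sup>2"
    proof -
      have "K4 / \<rho> * z * m \<le> 1 * z\<^sup>2 + (K4 / \<rho>)\<^sup>2 / (4 * 1) * m\<^sup>2"
        using K pos by (intro young_abs) auto
      from mult_left_mono[OF this, of \<xi>] show ?thesis using o by (simp add: algebra_simps)
    qed
    \<comment> \<open>A factor b is worth at most S \<xi>, so each product of b m with another
      variable is absorbed at the price of \<xi> m^2.\<close>
    have bz: "r * b * m * y \<le> e * \<xi> * y\<^sup>2 + (c * S)\<^sup>2 / (4 * e) * \<xi> * m\<^sup>2"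
      if "\<bar>r\<bar> \<le> c" "e > 0" for r c e y
    proof -
      have "\<bar>r * b / \<xi>\<bar> \<le> c * S"
      proof -
        have "\<bar>r\<bar> * b \<le> c * (S * \<xi>)" using that o by (intro mult_mono) auto
        then show ?thesis using o by (simp add: abs_mult field_simps)
      qed
      then have "r * b / \<xi> * y * m \<le> e * y\<^sup>2 + (c * S)\<^sup>2 / (4 * e) * m\<^sup>2"
        using that by (intro young_abs) auto
      from mult_left_mono[OF this, of \<xi>] show ?thesis using o by (simp add: algebra_simps)
    qed
    have t3: "K4 * (b * m\<^sup>2 / \<rho>) \<le> K4 * S / \<rho> * \<xi> * m\<^sup>2"
      using mult_right_mono[OF o(4), of "K4 * m\<^sup>2 / \<rho>"] K pos by (simp add: mult_ac)
    have t4: "- (K3 * (b * m * z / \<rho>)) \<le> \<xi> * z\<^sup>2 + (K3 * S / \<rho>)\<^sup>2 / 4 * \<xi> * m\<^sup>2"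
      using bz[of "- (K3 / \<rho>)" "K3 / \<rho>" 1 z] K pos by simp
    have t5: "K2 * (\<theta> * b * m * z / \<rho>) \<le> \<xi> * z\<^sup>2 + (K2 * \<alpha> * S / \<rho>)\<^sup>2 / 4 * \<xi> * m\<^sup>2"
      using bz[of "K2 * \<theta> / \<rho>" "K2 * \<alpha> / \<rho>" 1 z] K pos o
      by (simp add: mult_ac divide_right_mono mult_right_mono abs_mult)
    have t6: "- (b * m * v) \<le> \<kappa> / 2 * \<xi> * v\<^sup>2 + S\<^sup>2 / (2 * \<kappa>) * \<xi> * m\<^sup>2"
      using bz[of "-1" 1 "\<kappa> / 2" v] pos by simp
    have t7: "- (K3 * (\<gamma> * \<beta> * u * q)) \<le> \<mu> / 2 * q\<^sup>2 + (K3 * \<gamma> * \<beta>)\<^sup>2 / (2 * \<mu>) * u\<^sup>2"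
      using young_abs[of "\<mu> / 2" "- (K3 * \<gamma> * \<beta>)" "K3 * \<gamma> * \<beta>" q u] K pos by (simp add: mult_ac)
    have t8: "K3 * (\<theta> * u\<^sup>2) \<le> K3 * \<alpha> * u\<^sup>2"
      using K o by (simp add: mult_right_mono mult.assoc)
    have t9: "K2 * (- (\<theta> * u - \<gamma> * \<beta> * q)\<^sup>2) \<le> - 2 * \<mu> * q\<^sup>2 + K2 * \<alpha>\<^sup>2 * u\<^sup>2"
    proof -
      \<comment> \<open>Half of the q-part of the square survives; the u-part is left to K4.\<close>
      have "- (A - B)\<^sup>2 \<le> - B\<^sup>2 / 2 + A\<^sup>2" for A B :: real
        using zero_le_power2[of "A - B / 2"] by (simp add: power2_eq_square algebra_simps)
      from this[of "\<theta> * u" "\<gamma> * \<beta> * q"]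
      have "- (\<theta> * u - \<gamma> * \<beta> * q)\<^sup>2 \<le> - (\<gamma> * \<beta>)\<^sup>2 * q\<^sup>2 / 2 + \<theta>\<^sup>2 * u\<^sup>2"
        by (simp add: power_mult_distrib)
      also have "\<theta>\<^sup>2 * u\<^sup>2 \<le> \<alpha>\<^sup>2 * u\<^sup>2" using o by (intro mult_right_mono power_mono) auto
      finally have "K2 * (- (\<theta> * u - \<gamma> * \<beta> * q)\<^sup>2) \<le> K2 * (- (\<gamma> * \<beta>)\<^sup>2 * q\<^sup>2 / 2 + \<alpha>\<^sup>2 * u\<^sup>2)"
        using K by (intro mult_left_mono) auto
      also have "\<dots> = - 2 * \<mu> * q\<^sup>2 + K2 * \<alpha>\<^sup>2 * u\<^sup>2"
        using pos by (simp add: K2_def field_simps)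
      finally show ?thesis .
    qed
    have t10: "K2 * (\<theta> * \<xi> * z\<^sup>2 / \<rho>) \<le> \<alpha> * K2 / \<rho> * \<xi> * z\<^sup>2"
      using mult_right_mono[OF o(5), of "K2 * \<xi> * z\<^sup>2 / \<rho>"] K pos o by (simp add: mult_ac)
    \<comment> \<open>With K2 inserted the coefficient of \<xi> x z is 4/\<gamma>; half of the
      equipartition term \<beta> \<xi> x^2 absorbs it.\<close>
    have t11: "- (K2 * (\<gamma> * \<beta>\<^sup>2 * \<xi> * z * x / \<mu>)) \<le> \<beta> / 2 * \<xi> * x\<^sup>2 + 8 / (\<gamma>\<^sup>2 * \<beta>) * \<xi> * z\<^sup>2"
    proof -
      have "- (4 / \<gamma>) * x * z \<le> \<beta> / 2 * x\<^sup>2 + (4 / \<gamma>)\<^sup>2 / (4 * (\<beta> / 2)) * z\<^sup>2"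
        using pos by (intro young_abs) auto
      from mult_left_mono[OF this, of \<xi>] o
      have "\<xi> * (- (4 / \<gamma>) * x * z) \<le> \<xi> * (\<beta> / 2 * x\<^sup>2 + (4 / \<gamma>)\<^sup>2 / (4 * (\<beta> / 2)) * z\<^sup>2)"
        by simp
      also have "\<dots> = \<beta> / 2 * \<xi> * x\<^sup>2 + 8 / (\<gamma>\<^sup>2 * \<beta>) * \<xi> * z\<^sup>2"
        using pos by (simp add: field_simps)
      also have "\<xi> * (- (4 / \<gamma>) * x * z) = - (K2 * (\<gamma> * \<beta>\<^sup>2 * \<xi> * z * x / \<mu>))"
        using pos by (simp add: K2_def field_simps power2_eq_square)
      finally show ?thesis .
    qed
    have t12: "- ((\<theta> - \<gamma>\<^sup>2 * \<beta>) * \<xi> * v\<^sup>2) \<le> - (\<kappa> * \<xi> * v\<^sup>2)"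
    proof -
      have "\<kappa> * (\<xi> * v\<^sup>2) \<le> (\<theta> - \<gamma>\<^sup>2 * \<beta>) * (\<xi> * v\<^sup>2)" using o by (intro mult_right_mono) auto
      then show ?thesis by (simp add: mult.assoc)
    qed
    have t13: "K4 * (- u\<^sup>2 / \<delta>) = - ((K2 * \<alpha>\<^sup>2 + K3 * \<alpha> + (K3 * \<gamma> * \<beta>)\<^sup>2 / (2 * \<mu>) + \<rho> + 2) * u\<^sup>2)"
      using pos by (simp add: K4_def)
    have t14: "K3 * (- \<xi> * z\<^sup>2 / \<rho>) = - (8 / (\<gamma>\<^sup>2 * \<beta>) + \<alpha> * K2 / \<rho> + 3) * \<xi> * z\<^sup>2"
      using pos by (simp add: K3_def field_simps)
    have "dPhi K2 K3 K4 \<xi> b \<theta> v u p q m =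
        K4 * (- u\<^sup>2 / \<delta>) + K4 * (\<delta> * m * u) + K4 * (\<xi> * m * z / \<rho>) + K4 * (b * m\<^sup>2 / \<rho>)
      + K3 * (- \<xi> * z\<^sup>2 / \<rho>) + - (K3 * (b * m * z / \<rho>)) + K3 * (\<theta> * u\<^sup>2) + - (K3 * (\<gamma> * \<beta> * u * q))
      + K2 * (- (\<theta> * u - \<gamma> * \<beta> * q)\<^sup>2) + K2 * (\<theta> * \<xi> * z\<^sup>2 / \<rho>) + K2 * (\<theta> * b * m * z / \<rho>)
      + - (K2 * (\<gamma> * \<beta>\<^sup>2 * \<xi> * z * x / \<mu>))
      + \<rho> * u\<^sup>2 + \<mu> * q\<^sup>2 + - ((\<theta> - \<gamma>\<^sup>2 * \<beta>) * \<xi> * v\<^sup>2) - \<beta> * \<xi> * x\<^sup>2 + - (b * m * v)"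
      unfolding dPhi_def Let_def z_def[symmetric] x_def[symmetric] ring_distribs by simp
    also have "\<dots> \<le> - (\<kappa> / 2 * \<xi> * v\<^sup>2 + u\<^sup>2 + \<beta> / 2 * \<xi> * x\<^sup>2 + \<mu> / 2 * q\<^sup>2) + C1 * \<xi> * m\<^sup>2"
      using t1 t2 t3 t4 t5 t6 t7 t8 t9 t10 t11 t12 t13 t14
      unfolding C1_def ring_distribs by (simp add: algebra_simps)
    finally show "dPhi K2 K3 K4 \<xi> b (\<alpha> - b / (\<delta> * \<xi>)) v u p q m
         \<le> - (\<kappa> / 2 * \<xi> * v\<^sup>2 + u\<^sup>2 + \<beta> / 2 * \<xi> * (p - \<gamma> * v)\<^sup>2 + \<mu> / 2 * q\<^sup>2) + C1 * \<xi> * m\<^sup>2"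
      by (simp add: \<theta>_def x_def)
  qed
qed

section \<open>The modal equations and derivatives along their solutions\<close>

definition fu :: "real \<Rightarrow> real \<Rightarrow> real \<Rightarrow> real \<Rightarrow> real \<Rightarrow> real" where
  "fu \<xi> b v p m = (- (\<alpha> * \<xi> * v) + \<gamma> * \<beta> * \<xi> * p + b / \<delta> * v - b * m) / \<rho>"

definition fq :: "real \<Rightarrow> real \<Rightarrow> real \<Rightarrow> real" where
  "fq \<xi> v p = (- (\<beta> * \<xi> * p) + \<gamma> * \<beta> * \<xi> * v) / \<mu>"

text \<open>The mean of u - \<eta>_s: the constant u has mean u/\<delta>, and integration by parts
  gives the mean of \<eta>_s as \<delta> m.\<close>

definition fm :: "real \<Rightarrow> real \<Rightarrow> real" where
  "fm u m = u / \<delta> - \<delta> * m"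

definition mode_sol ::
  "real \<Rightarrow> real \<Rightarrow> (real \<Rightarrow> real) \<Rightarrow> (real \<Rightarrow> real) \<Rightarrow> (real \<Rightarrow> real) \<Rightarrow> (real \<Rightarrow> real) \<Rightarrow> (real \<Rightarrow> real) \<Rightarrow> bool"
where
  "mode_sol \<xi> b v u p q m \<longleftrightarrow> (\<forall>t\<ge>0.
     (v has_real_derivative u t) (at t within {0..}) \<and>
     (u has_real_derivative fu \<xi> b (v t) (p t) (m t)) (at t within {0..}) \<and>
     (p has_real_derivative q t) (at t within {0..}) \<and>
     (q has_real_derivative fq \<xi> (v t) (p t)) (at t within {0..}) \<and>
     (m has_real_derivative fm (u t) (m t)) (at t within {0..}))"

lemma mode_solD:
  assumes "mode_sol \<xi> b v u p q m" "t \<ge> 0"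
  shows "(v has_real_derivative u t) (at t within {0..})"
     "(u has_real_derivative fu \<xi> b (v t) (p t) (m t)) (at t within {0..})"
     "(p has_real_derivative q t) (at t within {0..})"
     "(q has_real_derivative fq \<xi> (v t) (p t)) (at t within {0..})"
     "(m has_real_derivative fm (u t) (m t)) (at t within {0..})"
  using assms by (auto simp: mode_sol_def)

text \<open>The equations are linear with constant coefficients, so differentiation commutes with
  them. This is the source of the factor 1/\<xi> in \<open>mode_decay\<close>.\<close>

lemma mode_sol_deriv:
  assumes "mode_sol \<xi> b v u p q m"
  shows "mode_sol \<xi> b u (\<lambda>t. fu \<xi> b (v t) (p t) (m t)) q (\<lambda>t. fq \<xi> (v t) (p t)) (\<lambda>t. fm (u t) (m t))"
  unfolding mode_sol_def
proof (intro allI impI conjI)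
  fix t :: real assume t: "t \<ge> 0"
  note d = mode_solD[OF assms t]
  show "((\<lambda>t. fu \<xi> b (v t) (p t) (m t)) has_real_derivative fu \<xi> b (u t) (q t) (fm (u t) (m t))) (at t within {0..})"
    unfolding fu_def[of \<xi> b "v _"] by (rule derivative_eq_intros d refl)+ (use pos in \<open>auto simp: fu_def field_simps\<close>)
  show "((\<lambda>t. fq \<xi> (v t) (p t)) has_real_derivative fq \<xi> (u t) (q t)) (at t within {0..})"
    unfolding fq_def[of \<xi> "v _"] by (rule derivative_eq_intros d refl)+ (use pos in \<open>auto simp: fq_def field_simps\<close>)
  show "((\<lambda>t. fm (u t) (m t)) has_real_derivative fm (fu \<xi> b (v t) (p t) (m t)) (fm (u t) (m t))) (at t within {0..})"
  proof -
    have "((\<lambda>t. u t / \<delta> - \<delta> * m t) has_real_derivative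
        fu \<xi> b (v t) (p t) (m t) / \<delta> - \<delta> * fm (u t) (m t)) (at t within {0..})"
      by (rule DERIV_diff[OF DERIV_cdivide[OF d(2)] DERIV_cmult[OF d(5)]])
    then show ?thesis by (simp add: fm_def)
  qed
qed (use mode_solD[OF assms] in auto)

lemma fu_eq: "\<xi> > 0 \<Longrightarrow> fu \<xi> b v p m = (- \<xi> * ((\<alpha> - b / (\<delta> * \<xi>)) * v - \<gamma> * \<beta> * p) - b * m) / \<rho>"
  by (simp add: fu_def algebra_simps)

lemma fq_eq: "fq \<xi> v p = - (\<beta> * \<xi> * (p - \<gamma> * v)) / \<mu>"
  by (simp add: fq_def algebra_simps)

text \<open>All exchange terms cancel in pairs, also - b m in the equation of u against u/\<delta>
  in that of m; the term - \<delta> m in the latter is the only loss.\<close>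

lemma energy_deriv:
  assumes "mode_sol \<xi> b v u p q m" "t \<ge> 0" "\<xi> > 0"
  shows "((\<lambda>t. energy \<xi> b (v t) (u t) (p t) (q t) (m t)) has_real_derivative
           - 2 * \<delta>\<^sup>2 * b * (m t)\<^sup>2) (at t within {0..})"
proof -
  note d = mode_solD[OF assms(1,2)]
  define \<theta> where "\<theta> = \<alpha> - b / (\<delta> * \<xi>)"
  have "((\<lambda>t. energy \<xi> b (v t) (u t) (p t) (q t) (m t)) has_real_derivative
     (\<theta> - \<gamma>\<^sup>2 * \<beta>) * \<xi> * (2 * v t * u t) + 2 * u t * (\<rho> * fu \<xi> b (v t) (p t) (m t))
     + \<beta> * \<xi> * (2 * (p t - \<gamma> * v t) * (q t - \<gamma> * u t)) + 2 * q t * (\<mu> * fq \<xi> (v t) (p t))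
     + 2 * b * m t * (\<delta> * fm (u t) (m t))) (at t within {0..})"
    unfolding energy_def \<theta>_def[symmetric]
    by (rule derivative_eq_intros d refl)+ (simp add: algebra_simps)
  moreover have "\<rho> * fu \<xi> b (v t) (p t) (m t) = - \<xi> * (\<theta> * v t - \<gamma> * \<beta> * p t) - b * m t"
    using pos assms by (simp add: fu_eq \<theta>_def)
  moreover have "\<mu> * fq \<xi> (v t) (p t) = - (\<beta> * \<xi> * (p t - \<gamma> * v t))"
    using pos by (simp add: fq_eq)
  moreover have "\<delta> * fm (u t) (m t) = u t - \<delta>\<^sup>2 * m t"
    using pos by (simp add: fm_def field_simps power2_eq_square)
  ultimately show ?thesis
    by (simp only:) (simp add: algebra_simps power2_eq_square)
qed

lemma Phi_deriv:
  assumes "mode_sol \<xi> b v u p q m" "t \<ge> 0" "\<xi> > 0"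
  defines "\<theta> \<equiv> \<alpha> - b / (\<delta> * \<xi>)"
  shows "((\<lambda>t. Phi K2 K3 K4 \<theta> (v t) (u t) (p t) (q t) (m t)) has_real_derivative
           dPhi K2 K3 K4 \<xi> b \<theta> (v t) (u t) (p t) (q t) (m t)) (at t within {0..})"
proof -
  note d = mode_solD[OF assms(1,2)]
  define z where "z = \<theta> * v t - \<gamma> * \<beta> * p t"
  define x where "x = p t - \<gamma> * v t"
  define U where "U = fu \<xi> b (v t) (p t) (m t)"
  define Q where "Q = fq \<xi> (v t) (p t)"
  have U: "\<rho> * U = - \<xi> * z - b * m t"
    using pos assms by (simp add: fu_eq \<theta>_def U_def z_def)
  have Q: "\<mu> * Q = - (\<beta> * \<xi> * x)"
    using pos by (simp add: fq_eq Q_def x_def)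
  have U': "U = - \<xi> * z / \<rho> - b * m t / \<rho>" and Q': "Q = - (\<beta> * \<xi> * x / \<mu>)"
    using U Q pos by (auto simp: field_simps)
  have "((\<lambda>t. Phi K2 K3 K4 \<theta> (v t) (u t) (p t) (q t) (m t)) has_real_derivative
     - K4 * (fm (u t) (m t) * u t + m t * U) + K3 * (U * z + u t * (\<theta> * u t - \<gamma> * \<beta> * q t))
     - K2 * ((\<theta> * u t - \<gamma> * \<beta> * q t) * (\<theta> * u t - \<gamma> * \<beta> * q t) + z * (\<theta> * U - \<gamma> * \<beta> * Q))
     + ((\<rho> * U) * v t + \<rho> * u t * u t + (\<mu> * Q) * p t + \<mu> * q t * q t)) (at t within {0..})"
    unfolding Phi_def U_def Q_def z_def
    by (rule derivative_eq_intros d refl)+ (simp add: algebra_simps)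
  also have "- K4 * (fm (u t) (m t) * u t + m t * U) + K3 * (U * z + u t * (\<theta> * u t - \<gamma> * \<beta> * q t))
     - K2 * ((\<theta> * u t - \<gamma> * \<beta> * q t) * (\<theta> * u t - \<gamma> * \<beta> * q t) + z * (\<theta> * U - \<gamma> * \<beta> * Q))
     + ((\<rho> * U) * v t + \<rho> * u t * u t + (\<mu> * Q) * p t + \<mu> * q t * q t)
     = dPhi K2 K3 K4 \<xi> b \<theta> (v t) (u t) (p t) (q t) (m t)"
  proof -
    have 1: "- (fm (u t) (m t) * u t + m t * U) = - (u t)\<^sup>2 / \<delta> + \<delta> * m t * u t + \<xi> * m t * z / \<rho> + b * (m t)\<^sup>2 / \<rho>"
      unfolding U' fm_def by (simp add: algebra_simps power2_eq_square)
    have 2: "U * z + u t * (\<theta> * u t - \<gamma> * \<beta> * q t)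
      = - \<xi> * z\<^sup>2 / \<rho> - b * m t * z / \<rho> + \<theta> * (u t)\<^sup>2 - \<gamma> * \<beta> * u t * q t"
      unfolding U' by (simp add: algebra_simps power2_eq_square)
    have 3: "- ((\<theta> * u t - \<gamma> * \<beta> * q t) * (\<theta> * u t - \<gamma> * \<beta> * q t) + z * (\<theta> * U - \<gamma> * \<beta> * Q))
      = - (\<theta> * u t - \<gamma> * \<beta> * q t)\<^sup>2 + \<theta> * \<xi> * z\<^sup>2 / \<rho> + \<theta> * b * m t * z / \<rho> - \<gamma> * \<beta>\<^sup>2 * \<xi> * z * x / \<mu>"
      unfolding U' Q' by (simp add: algebra_simps power2_eq_square)
    have 4: "(\<rho> * U) * v t + \<rho> * u t * u t + (\<mu> * Q) * p t + \<mu> * q t * q t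
      = \<rho> * (u t)\<^sup>2 + \<mu> * (q t)\<^sup>2 - (\<theta> - \<gamma>\<^sup>2 * \<beta>) * \<xi> * (v t)\<^sup>2 - \<beta> * \<xi> * x\<^sup>2 - b * m t * v t"
      unfolding U Q z_def x_def by (simp add: algebra_simps power2_eq_square)
    show ?thesis
      unfolding dPhi_def Let_def z_def[symmetric] x_def[symmetric]
      unfolding 1[symmetric] 2[symmetric] 3[symmetric] 4[symmetric] by (simp add: algebra_simps)
  qed
  finally show ?thesis .
qed

section \<open>Equivalent norms on one mode, and decay of the modal energy\<close>

definition base :: "real \<Rightarrow> real \<Rightarrow> real \<Rightarrow> real \<Rightarrow> real \<Rightarrow> real \<Rightarrow> real \<Rightarrow> real" where
  "base \<xi> b v u p q m = \<xi> * v\<^sup>2 + u\<^sup>2 + \<xi> * (p - \<gamma> * v)\<^sup>2 + q\<^sup>2 + b * m\<^sup>2"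

text \<open>\<open>base\<close> is \<open>energy\<close> without its parameters, so the two compare
  termwise; only the v-term needs an argument, coercivity bounding its coefficient below by
  \<kappa>.\<close>

lemma base_le_energy:
  obtains C where "C > 0" "\<And>\<xi> b v u p q m. mode_ok \<xi> b \<Longrightarrow> base \<xi> b v u p q m \<le> C * energy \<xi> b v u p q m"
proof -
  define C where "C = 1 / \<kappa> + 1 / \<rho> + 1 / \<beta> + 1 / \<mu> + 1 / \<delta>"
  have C: "C > 0" "1 \<le> C * \<kappa>" "1 \<le> C * \<rho>" "1 \<le> C * \<beta>" "1 \<le> C * \<mu>" "1 \<le> C * \<delta>"
    unfolding C_def using pos by (auto simp: field_simps intro!: add_pos_pos add_nonneg_nonneg)
  have up: "w \<le> C * (r * w)" if "1 \<le> C * r" "w \<ge> 0" for r w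
    using mult_right_mono[OF that] by (simp add: mult_ac)
  show thesis
  proof (rule that[OF C(1)])
    fix \<xi> b v u p q m :: real assume ok: "mode_ok \<xi> b"
    note o = mode_okD[OF ok]
    have "\<xi> * v\<^sup>2 \<le> C * (\<kappa> * (\<xi> * v\<^sup>2))" using o by (intro up C) auto
    also have "\<dots> \<le> C * ((\<alpha> - b / (\<delta> * \<xi>) - \<gamma>\<^sup>2 * \<beta>) * (\<xi> * v\<^sup>2))"
      using o C by (intro mult_left_mono mult_right_mono) auto
    finally have 1: "\<xi> * v\<^sup>2 \<le> \<dots>" .
    have 2: "u\<^sup>2 \<le> C * (\<rho> * u\<^sup>2)" "\<xi> * (p - \<gamma> * v)\<^sup>2 \<le> C * (\<beta> * (\<xi> * (p - \<gamma> * v)\<^sup>2))"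
      "q\<^sup>2 \<le> C * (\<mu> * q\<^sup>2)" "b * m\<^sup>2 \<le> C * (\<delta> * (b * m\<^sup>2))"
      using o by (auto intro!: up C)
    show "base \<xi> b v u p q m \<le> C * energy \<xi> b v u p q m"
      unfolding base_def energy_def using 1 2 by (simp add: distrib_left mult.assoc)
  qed
qed

lemma energy_le_base:
  obtains C where "C > 0" "\<And>\<xi> b v u p q m. mode_ok \<xi> b \<Longrightarrow> energy \<xi> b v u p q m \<le> C * base \<xi> b v u p q m"
proof -
  define C where "C = \<alpha> + \<rho> + \<beta> + \<mu> + \<delta>"
  have C: "C > 0" "\<alpha> \<le> C" "\<rho> \<le> C" "\<beta> \<le> C" "\<mu> \<le> C" "\<delta> \<le> C"
    unfolding C_def using pos by auto
  show thesis
  proof (rule that[OF C(1)])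
    fix \<xi> b v u p q m :: real assume ok: "mode_ok \<xi> b"
    note o = mode_okD[OF ok]
    have "\<gamma>\<^sup>2 * \<beta> > 0" using pos by simp
    then have "\<alpha> - b / (\<delta> * \<xi>) - \<gamma>\<^sup>2 * \<beta> \<le> C" using o C by linarith
    then have 1: "(\<alpha> - b / (\<delta> * \<xi>) - \<gamma>\<^sup>2 * \<beta>) * (\<xi> * v\<^sup>2) \<le> C * (\<xi> * v\<^sup>2)"
      using o by (intro mult_right_mono) auto
    have 2: "\<rho> * u\<^sup>2 \<le> C * u\<^sup>2" "\<beta> * (\<xi> * (p - \<gamma> * v)\<^sup>2) \<le> C * (\<xi> * (p - \<gamma> * v)\<^sup>2)"
      "\<mu> * q\<^sup>2 \<le> C * q\<^sup>2" "\<delta> * (b * m\<^sup>2) \<le> C * (b * m\<^sup>2)"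
      using o by (auto intro!: mult_right_mono C)
    show "energy \<xi> b v u p q m \<le> C * base \<xi> b v u p q m"
      unfolding base_def energy_def using 1 2 by (simp add: distrib_left mult.assoc)
  qed
qed

lemma base_nonneg: "mode_ok \<xi> b \<Longrightarrow> base \<xi> b v u p q m \<ge> 0"
  using mode_okD[of \<xi> b] by (auto simp: base_def)

text \<open>The mean is present in the energy with the weight b only, so m u by itself is not
  controlled uniformly; the factor b/\<xi> repairs this, since (b m/\<xi>)^2 = (b/\<xi>) (1/\<xi>) b
  m^2. For the remaining products b/\<xi> \<le> S and \<xi> \<ge> \<xi>0 suffice.\<close>

lemma Phi_bound:
  assumes "K2 > 0" "K3 > 0" "K4 > 0"
  obtains C where "C > 0" "\<And>\<xi> b v u p q m. mode_ok \<xi> b \<Longrightarrow>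
     \<bar>b / \<xi> * Phi K2 K3 K4 (\<alpha> - b / (\<delta> * \<xi>)) v u p q m\<bar> \<le> C * base \<xi> b v u p q m"
proof -
  \<comment> \<open>A is the constant in z^2 \<le> A (v^2 + x^2), obtained from p = x + \<gamma> v;
    c bounds unweighted squares by \<open>base\<close> through \<xi> \<ge> \<xi>0.\<close>
  define A where "A = 2 * \<alpha>\<^sup>2 + 4 * (\<gamma> * \<beta>)\<^sup>2 * (1 + \<gamma>\<^sup>2)"
  define c where "c = 1 / \<xi>0 + 1"
  define C where "C = K4 * (S / \<xi>0 + 1) + K3 * S * (A * c + 1) + K2 * S * (A * c + A) + S * (\<rho> * (c + 1) + \<mu> * (2 * (1 + \<gamma>\<^sup>2) * c + 1))"
  have A: "A > 0" and c: "c > 0"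
    using pos by (auto simp: A_def c_def intro!: add_pos_nonneg)
  have C: "C > 0" unfolding C_def using pos assms A c
    by (intro add_pos_pos mult_pos_pos) auto
  show thesis
  proof (rule that[OF C])
    fix \<xi> b v u p q m :: real assume ok: "mode_ok \<xi> b"
    define \<theta> where "\<theta> = \<alpha> - b / (\<delta> * \<xi>)"
    note o = mode_okD[OF ok, folded \<theta>_def]
    define B where "B = base \<xi> b v u p q m"
    define x where "x = p - \<gamma> * v"
    define z where "z = \<theta> * v - \<gamma> * \<beta> * p"
    define y where "y = \<theta> * u - \<gamma> * \<beta> * q"
    define s where "s = b / \<xi>"
    have s: "0 < s" "s \<le> S" using o by (auto simp: s_def field_simps)
    have B0: "B \<ge> 0" using base_nonneg[OF ok] by (simp add: B_def)
    have xi: "w \<le> c * B" if "\<xi> * w \<le> B" "w \<ge> 0" for w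
    proof -
      have "\<xi>0 * w \<le> \<xi> * w" using o that by (intro mult_right_mono) auto
      then have "w \<le> 1 / \<xi>0 * B" using that pos by (simp add: field_simps)
      also have "\<dots> \<le> c * B" using B0 by (intro mult_right_mono) (auto simp: c_def)
      finally show ?thesis .
    qed
    have nn: "\<xi> * v\<^sup>2 \<ge> 0" "\<xi> * x\<^sup>2 \<ge> 0" "b * m\<^sup>2 \<ge> 0" using o by auto
    have u: "u\<^sup>2 \<le> B" and q: "q\<^sup>2 \<le> B" and bm: "b * m\<^sup>2 \<le> B"
      and xv: "\<xi> * (v\<^sup>2 + x\<^sup>2) \<le> B"
      using nn unfolding B_def base_def x_def[symmetric]
      by (smt (verit) zero_le_power2 distrib_left)+
    have vx: "v\<^sup>2 + x\<^sup>2 \<le> c * B" by (rule xi[OF xv]) auto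
    have sq: "(r + w)\<^sup>2 \<le> 2 * r\<^sup>2 + 2 * w\<^sup>2" for r w :: real
      using zero_le_power2[of "r - w"] by (simp add: power2_eq_square algebra_simps)
    have sq': "(r - w)\<^sup>2 \<le> 2 * r\<^sup>2 + 2 * w\<^sup>2" for r w :: real
      using sq[of r "-w"] by simp
    have th: "\<theta>\<^sup>2 * w\<^sup>2 \<le> \<alpha>\<^sup>2 * w\<^sup>2" for w using o by (intro mult_right_mono power_mono) auto
    have p: "p\<^sup>2 \<le> 2 * (1 + \<gamma>\<^sup>2) * (v\<^sup>2 + x\<^sup>2)"
    proof -
      have "p = x + \<gamma> * v" by (simp add: x_def)
      then have "p\<^sup>2 \<le> 2 * x\<^sup>2 + 2 * (\<gamma>\<^sup>2 * v\<^sup>2)" using sq[of x "\<gamma> * v"] by (simp add: power_mult_distrib)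
      also have "\<dots> \<le> 2 * (1 + \<gamma>\<^sup>2) * (v\<^sup>2 + x\<^sup>2)" by (simp add: algebra_simps)
      finally show ?thesis .
    qed
    have z: "z\<^sup>2 \<le> A * (c * B)"
    proof -
      have "z\<^sup>2 \<le> 2 * (\<theta> * v)\<^sup>2 + 2 * (\<gamma> * \<beta> * p)\<^sup>2" unfolding z_def by (rule sq')
      also have "\<dots> \<le> 2 * (\<alpha>\<^sup>2 * v\<^sup>2) + 2 * ((\<gamma> * \<beta>)\<^sup>2 * p\<^sup>2)"
        using th[of v] by (simp add: power_mult_distrib)
      also have "\<dots> \<le> 2 * (\<alpha>\<^sup>2 * (v\<^sup>2 + x\<^sup>2)) + 2 * ((\<gamma> * \<beta>)\<^sup>2 * (2 * (1 + \<gamma>\<^sup>2) * (v\<^sup>2 + x\<^sup>2)))"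
        using p by (intro add_mono mult_left_mono) auto
      also have "\<dots> = A * (v\<^sup>2 + x\<^sup>2)" by (simp add: A_def algebra_simps)
      also have "\<dots> \<le> A * (c * B)" using vx A by (intro mult_left_mono) auto
      finally show ?thesis .
    qed
    have y: "y\<^sup>2 \<le> A * B"
    proof -
      have "y\<^sup>2 \<le> 2 * (\<theta> * u)\<^sup>2 + 2 * (\<gamma> * \<beta> * q)\<^sup>2" unfolding y_def by (rule sq')
      also have "\<dots> \<le> 2 * (\<alpha>\<^sup>2 * u\<^sup>2) + 2 * ((\<gamma> * \<beta>)\<^sup>2 * q\<^sup>2)"
        using th[of u] by (simp add: power_mult_distrib)
      also have "\<dots> \<le> 2 * (\<alpha>\<^sup>2 * B) + 2 * ((\<gamma> * \<beta>)\<^sup>2 * B)"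
        using u q by (intro add_mono mult_left_mono) auto
      also have "\<dots> \<le> A * B"
        using B0 by (simp add: A_def algebra_simps)
      finally show ?thesis .
    qed
    have am: "\<bar>r * w\<bar> \<le> r\<^sup>2 + w\<^sup>2" for r w :: real
      by (rule order_trans[OF _ sum_squares_bound[of "\<bar>r\<bar>" "\<bar>w\<bar>", simplified, THEN order_trans[rotated]]])
        (auto simp: abs_mult)
    have mu: "s * \<bar>m * u\<bar> \<le> (S / \<xi>0 + 1) * B"
    proof -
      have "s * \<bar>m * u\<bar> = \<bar>(s * m) * u\<bar>" using s by (simp add: abs_mult)
      also have "\<dots> \<le> (s * m)\<^sup>2 + u\<^sup>2" by (rule am)
      also have "(s * m)\<^sup>2 = s * (1 / \<xi>) * (b * m\<^sup>2)" by (simp add: s_def power2_eq_square)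
      also have "\<dots> \<le> S * (1 / \<xi>0) * B"
        using s o bm pos nn by (intro mult_mono divide_left_mono) auto
      finally show ?thesis using u by (simp add: algebra_simps)
    qed
    have sS: "s * \<bar>w\<bar> \<le> S * r" if "\<bar>w\<bar> \<le> r" for w r
      using s that by (intro mult_mono) auto
    have uz: "\<bar>u * z\<bar> \<le> (A * c + 1) * B"
      using am[of u z] u z by (simp add: algebra_simps)
    have zy: "\<bar>z * y\<bar> \<le> (A * c + A) * B"
      using am[of z y] z y by (simp add: algebra_simps)
    have uv: "\<bar>u * v\<bar> \<le> (c + 1) * B"
    proof -
      have "v\<^sup>2 \<le> c * B" using vx zero_le_power2[of x] by linarith
      then show ?thesis using am[of u v] u by (simp add: algebra_simps)
    qed
    have qp: "\<bar>q * p\<bar> \<le> (2 * (1 + \<gamma>\<^sup>2) * c + 1) * B"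
    proof -
      have "2 * (1 + \<gamma>\<^sup>2) * (v\<^sup>2 + x\<^sup>2) \<le> 2 * (1 + \<gamma>\<^sup>2) * (c * B)"
        using vx by (intro mult_left_mono) auto
      then show ?thesis using am[of q p] q p by (simp add: algebra_simps)
    qed
    have "\<bar>s * Phi K2 K3 K4 \<theta> v u p q m\<bar> \<le> K4 * (s * \<bar>m * u\<bar>) + K3 * (s * \<bar>u * z\<bar>) + K2 * (s * \<bar>z * y\<bar>)
       + (\<rho> * (s * \<bar>u * v\<bar>) + \<mu> * (s * \<bar>q * p\<bar>))"
    proof -
      have "s * Phi K2 K3 K4 \<theta> v u p q m = - (K4 * (s * (m * u))) + K3 * (s * (u * z)) - K2 * (s * (z * y))
       + (\<rho> * (s * (u * v)) + \<mu> * (s * (q * p)))"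
        unfolding Phi_def z_def y_def by (simp add: algebra_simps)
      moreover have "\<bar>K4 * (s * (m * u))\<bar> = K4 * (s * \<bar>m * u\<bar>)" "\<bar>K3 * (s * (u * z))\<bar> = K3 * (s * \<bar>u * z\<bar>)"
        "\<bar>K2 * (s * (z * y))\<bar> = K2 * (s * \<bar>z * y\<bar>)" "\<bar>\<rho> * (s * (u * v))\<bar> = \<rho> * (s * \<bar>u * v\<bar>)"
        "\<bar>\<mu> * (s * (q * p))\<bar> = \<mu> * (s * \<bar>q * p\<bar>)"
        using assms pos s by (simp_all add: abs_mult)
      moreover have "\<bar>- r1 + r2 - r3 + (r4 + r5)\<bar> \<le> \<bar>r1\<bar> + \<bar>r2\<bar> + \<bar>r3\<bar> + (\<bar>r4\<bar> + \<bar>r5\<bar>)" for r1 r2 r3 r4 r5 :: real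
        by arith
      ultimately show ?thesis by metis
    qed
    also have "\<dots> \<le> K4 * ((S / \<xi>0 + 1) * B) + K3 * (S * ((A * c + 1) * B)) + K2 * (S * ((A * c + A) * B))
       + (\<rho> * (S * ((c + 1) * B)) + \<mu> * (S * ((2 * (1 + \<gamma>\<^sup>2) * c + 1) * B)))"
      using assms pos by (intro add_mono mult_left_mono mu sS uz zy uv qp) auto
    also have "\<dots> = C * B" unfolding C_def by (simp add: algebra_simps)
    finally show "\<bar>b / \<xi> * Phi K2 K3 K4 (\<alpha> - b / (\<delta> * \<xi>)) v u p q m\<bar> \<le> C * base \<xi> b v u p q m"
      by (simp add: s_def \<theta>_def B_def)
  qed
qed

text \<open>The multiplier estimate costs \<xi> m^2 and the dissipation offers b m^2, so
  \<open>Phi\<close> may enter the Lyapunov function only with a factor of order b/\<xi>. The gain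
  it produces carries the same factor, and this is where the rate comes from.\<close>

lemma energy_decay:
  obtains c where "c > 0" "\<And>\<xi> b v u p q m t. mode_ok \<xi> b \<Longrightarrow> mode_sol \<xi> b v u p q m \<Longrightarrow> t \<ge> 0 \<Longrightarrow>
     energy \<xi> b (v t) (u t) (p t) (q t) (m t)
       \<le> 3 * exp (- c * (b / \<xi>) * t) * energy \<xi> b (v 0) (u 0) (p 0) (q 0) (m 0)"
proof -
  obtain K2 K3 K4 C1 where K: "K2 > 0" "K3 > 0" "K4 > 0" "C1 > 0" and
    dP: "\<And>\<xi> b v u p q m. mode_ok \<xi> b \<Longrightarrow>
       dPhi K2 K3 K4 \<xi> b (\<alpha> - b / (\<delta> * \<xi>)) v u p q m
         \<le> - (\<kappa> / 2 * \<xi> * v\<^sup>2 + u\<^sup>2 + \<beta> / 2 * \<xi> * (p - \<gamma> * v)\<^sup>2 + \<mu> / 2 * q\<^sup>2) + C1 * \<xi> * m\<^sup>2"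
    using dPhi_le by blast
  obtain C2 where C2: "C2 > 0" and P: "\<And>\<xi> b v u p q m. mode_ok \<xi> b \<Longrightarrow>
     \<bar>b / \<xi> * Phi K2 K3 K4 (\<alpha> - b / (\<delta> * \<xi>)) v u p q m\<bar> \<le> C2 * base \<xi> b v u p q m"
    using Phi_bound[OF K(1-3)] by blast
  obtain C3 where C3: "C3 > 0" and BE: "\<And>\<xi> b v u p q m. mode_ok \<xi> b \<Longrightarrow>
     base \<xi> b v u p q m \<le> C3 * energy \<xi> b v u p q m" using base_le_energy by blast
  obtain C4 where C4: "C4 > 0" and EB: "\<And>\<xi> b v u p q m. mode_ok \<xi> b \<Longrightarrow>
     energy \<xi> b v u p q m \<le> C4 * base \<xi> b v u p q m" using energy_le_base by blast
  \<comment> \<open>The first bound lets half of the dissipation 2 \<delta>^2 b m^2 pay for C1 \<xi>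
    m^2; the second keeps the corrected energy between 1/2 and 3/2 of the energy.\<close>
  define \<epsilon> where "\<epsilon> = min (\<delta>\<^sup>2 / C1) (1 / (2 * C2 * C3))"
  have \<epsilon>: "\<epsilon> > 0" "\<epsilon> * C1 \<le> \<delta>\<^sup>2" "\<epsilon> * (C2 * C3) \<le> 1 / 2"
  proof -
    show "\<epsilon> > 0" using pos K C2 C3 by (simp add: \<epsilon>_def)
    have "\<epsilon> \<le> \<delta>\<^sup>2 / C1" "\<epsilon> \<le> 1 / (2 * C2 * C3)" by (auto simp: \<epsilon>_def)
    then show "\<epsilon> * C1 \<le> \<delta>\<^sup>2" "\<epsilon> * (C2 * C3) \<le> 1 / 2" using K C2 C3 by (auto simp: field_simps)
  qed
  \<comment> \<open>The least coefficient gained among the squares in \<open>base\<close>. The bound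
    \<delta>^2/S is for the summand b m^2, which the other half of the dissipation supplies.\<close>
  define g where "g = min (\<delta>\<^sup>2 / S) (\<epsilon> * min (\<kappa> / 2) (min 1 (min (\<beta> / 2) (\<mu> / 2))))"
  have g0: "g > 0" using pos \<epsilon> by (simp add: g_def)
  have g: "g * S \<le> \<delta>\<^sup>2" "g \<le> \<epsilon> * (\<kappa> / 2)" "g \<le> \<epsilon>" "g \<le> \<epsilon> * (\<beta> / 2)" "g \<le> \<epsilon> * (\<mu> / 2)"
  proof -
    have "g \<le> \<delta>\<^sup>2 / S" by (auto simp: g_def)
    then show "g * S \<le> \<delta>\<^sup>2" using pos by (auto simp: field_simps)
    have 1: "g \<le> \<epsilon> * min (\<kappa> / 2) (min 1 (min (\<beta> / 2) (\<mu> / 2)))" by (simp add: g_def)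
    have "min (\<kappa> / 2) (min 1 (min (\<beta> / 2) (\<mu> / 2))) \<le> w \<Longrightarrow> g \<le> \<epsilon> * w" for w
      using order_trans[OF 1 mult_left_mono] \<epsilon> by (meson less_imp_le)
    from this[of "\<kappa> / 2"] this[of 1] this[of "\<beta> / 2"] this[of "\<mu> / 2"]
    show "g \<le> \<epsilon> * (\<kappa> / 2)" "g \<le> \<epsilon>" "g \<le> \<epsilon> * (\<beta> / 2)" "g \<le> \<epsilon> * (\<mu> / 2)" by auto
  qed
  define c where "c = g / (2 * C4)"
  have c: "c > 0" using g0 C4 by (simp add: c_def)
  show thesis
  proof (rule that[OF c])
    fix \<xi> b t :: real and v u p q m :: "real \<Rightarrow> real"
    assume ok: "mode_ok \<xi> b" and sol: "mode_sol \<xi> b v u p q m" and t: "t \<ge> 0"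
    note o = mode_okD[OF ok]
    define s where "s = b / \<xi>"
    have s: "0 < s" "s \<le> S" "s * \<xi> = b" using o by (auto simp: s_def field_simps)
    define E where "E = (\<lambda>t. energy \<xi> b (v t) (u t) (p t) (q t) (m t))"
    define B where "B = (\<lambda>t. base \<xi> b (v t) (u t) (p t) (q t) (m t))"
    define F where "F = (\<lambda>t. Phi K2 K3 K4 (\<alpha> - b / (\<delta> * \<xi>)) (v t) (u t) (p t) (q t) (m t))"
    define F' where "F' = (\<lambda>t. dPhi K2 K3 K4 \<xi> b (\<alpha> - b / (\<delta> * \<xi>)) (v t) (u t) (p t) (q t) (m t))"
    define L where "L = (\<lambda>t. E t + \<epsilon> * (s * F t))"
    have E0: "0 \<le> E r" for r
    proof -
      have "0 \<le> C3 * E r" using base_nonneg[OF ok] BE[OF ok] unfolding E_def by (rule order_trans)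
      then show ?thesis using C3 by (simp add: zero_le_mult_iff)
    qed
    have LE: "\<bar>L r - E r\<bar> \<le> E r / 2" for r
    proof -
      have "\<bar>s * F r\<bar> \<le> C2 * B r" using P[OF ok] by (simp add: s_def F_def B_def)
      also have "\<dots> \<le> C2 * (C3 * E r)" using BE[OF ok] C2 by (simp add: B_def E_def)
      finally have "\<epsilon> * \<bar>s * F r\<bar> \<le> \<epsilon> * (C2 * (C3 * E r))" using \<epsilon> by (intro mult_left_mono) auto
      also have "\<dots> \<le> 1 / 2 * E r" using mult_right_mono[OF \<epsilon>(3) E0[of r]] by (simp add: mult_ac)
      finally show ?thesis using \<epsilon> by (simp add: L_def abs_mult)
    qed
    have dL: "(L has_real_derivative - 2 * \<delta>\<^sup>2 * b * (m r)\<^sup>2 + \<epsilon> * (s * F' r)) (at r within {0..})" if "r \<ge> 0" for r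
      unfolding L_def E_def F_def F'_def
      by (rule derivative_eq_intros energy_deriv[OF sol that o(1)] Phi_deriv[OF sol that o(1)] refl)+ simp
    have "L t \<le> exp (- (c * s) * t) * L 0 + 2 * 0 / (c * s) * exp (- 0 * t)"
    proof (rule gronwall_exp[OF dL])
      fix r :: real assume r: "r \<ge> 0"
      have "s * F' r \<le> s * (- (\<kappa> / 2 * \<xi> * (v r)\<^sup>2 + (u r)\<^sup>2 + \<beta> / 2 * \<xi> * (p r - \<gamma> * v r)\<^sup>2 + \<mu> / 2 * (q r)\<^sup>2) + C1 * \<xi> * (m r)\<^sup>2)"
        unfolding F'_def using s by (intro mult_left_mono dP[OF ok]) auto
      also have "\<dots> = - s * (\<kappa> / 2 * (\<xi> * (v r)\<^sup>2) + (u r)\<^sup>2 + \<beta> / 2 * (\<xi> * (p r - \<gamma> * v r)\<^sup>2) + \<mu> / 2 * (q r)\<^sup>2) + C1 * (b * (m r)\<^sup>2)"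
        unfolding s(3)[symmetric] by (simp add: algebra_simps)
      finally have "\<epsilon> * (s * F' r) \<le> \<epsilon> * (- s * (\<kappa> / 2 * (\<xi> * (v r)\<^sup>2) + (u r)\<^sup>2 + \<beta> / 2 * (\<xi> * (p r - \<gamma> * v r)\<^sup>2) + \<mu> / 2 * (q r)\<^sup>2) + C1 * (b * (m r)\<^sup>2))"
        using \<epsilon> by (intro mult_left_mono) auto
      also have "\<dots> = - s * (\<epsilon> * (\<kappa> / 2) * (\<xi> * (v r)\<^sup>2) + \<epsilon> * (u r)\<^sup>2 + \<epsilon> * (\<beta> / 2) * (\<xi> * (p r - \<gamma> * v r)\<^sup>2) + \<epsilon> * (\<mu> / 2) * (q r)\<^sup>2) + (\<epsilon> * C1) * (b * (m r)\<^sup>2)"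
        by (simp add: algebra_simps)
      also have "\<dots> \<le> - s * (g * (\<xi> * (v r)\<^sup>2) + g * (u r)\<^sup>2 + g * (\<xi> * (p r - \<gamma> * v r)\<^sup>2) + g * (q r)\<^sup>2) + \<delta>\<^sup>2 * (b * (m r)\<^sup>2)"
        using s o \<epsilon> by (intro add_mono mult_left_mono_neg mult_right_mono g) auto
      also have "\<dots> = - s * g * B r + s * g * (b * (m r)\<^sup>2) + \<delta>\<^sup>2 * (b * (m r)\<^sup>2)"
        unfolding B_def base_def by (simp add: algebra_simps)
      also have "s * g * (b * (m r)\<^sup>2) \<le> \<delta>\<^sup>2 * (b * (m r)\<^sup>2)"
      proof (rule mult_right_mono)
        have "s * g \<le> S * g" using s g0 by (intro mult_right_mono) auto
        then show "s * g \<le> \<delta>\<^sup>2" using g by (simp add: mult_ac)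
      qed (use o in auto)
      finally have "- 2 * \<delta>\<^sup>2 * b * (m r)\<^sup>2 + \<epsilon> * (s * F' r) \<le> - s * g * B r" by (simp add: algebra_simps)
      also have "\<dots> \<le> - (c * s) * L r"
      proof -
        have "L r \<le> 2 * E r" using LE[of r] E0[of r] by linarith
        also have "\<dots> \<le> 2 * (C4 * B r)" using EB[OF ok] by (simp add: E_def B_def)
        finally have "(c * s) * L r \<le> (c * s) * (2 * (C4 * B r))" using c s by (intro mult_left_mono) auto
        also have "\<dots> = s * g * B r" using C4 by (simp add: c_def)
        finally show ?thesis by simp
      qed
      finally show "- 2 * \<delta>\<^sup>2 * b * (m r)\<^sup>2 + \<epsilon> * (s * F' r) \<le> - (c * s) * L r + 0 * exp (- 0 * r)" by simp
    qed (use c s t in auto)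
    then have "L t \<le> exp (- (c * s) * t) * L 0" by simp
    also have "\<dots> \<le> exp (- (c * s) * t) * (3 / 2 * E 0)"
            using abs_le_D1[OF LE[of 0]] by (intro mult_left_mono) auto
    \<comment> \<open>The factor 3 is 2 times 3/2: E \<le> 2 L at time t and L \<le> 3/2 E at time
      0.\<close>
    finally have "E t \<le> 3 * exp (- (c * s) * t) * E 0" 
      using abs_le_D2[OF LE[of t]] by (simp add: algebra_simps)
    then show "energy \<xi> b (v t) (u t) (p t) (q t) (m t)
       \<le> 3 * exp (- c * (b / \<xi>) * t) * energy \<xi> b (v 0) (u 0) (p 0) (q 0) (m 0)"
      by (simp add: E_def s_def)
  qed
qed

section \<open>Decay of one mode measured by the data and their time derivative\<close>

definition mode_norm :: "real \<Rightarrow> real \<Rightarrow> real \<Rightarrow> real \<Rightarrow> real \<Rightarrow> real \<Rightarrow> real \<Rightarrow> real" where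
  "mode_norm \<xi> b v u p q m = \<xi> * v\<^sup>2 + u\<^sup>2 + \<xi> * p\<^sup>2 + q\<^sup>2 + b * m\<^sup>2"

lemma sum_square_le: "(r + w)\<^sup>2 \<le> 2 * r\<^sup>2 + 2 * w\<^sup>2" for r w :: real
  using zero_le_power2[of "r - w"] by (simp add: power2_eq_square algebra_simps)

lemma mode_norm_le_base:
  assumes "\<xi> > 0" "b > 0"
  shows "mode_norm \<xi> b v u p q m \<le> (2 + 2 * \<gamma>\<^sup>2) * base \<xi> b v u p q m"
proof -
  have "\<xi> * p\<^sup>2 \<le> \<xi> * (2 * (p - \<gamma> * v)\<^sup>2 + 2 * (\<gamma> * v)\<^sup>2)"
    using sum_square_le[of "p - \<gamma> * v" "\<gamma> * v"] assms by (intro mult_left_mono) auto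
  also have "\<dots> = 2 * (\<xi> * (p - \<gamma> * v)\<^sup>2) + 2 * \<gamma>\<^sup>2 * (\<xi> * v\<^sup>2)"
    by (simp add: power_mult_distrib algebra_simps)
  finally have "mode_norm \<xi> b v u p q m \<le> (1 + 2 * \<gamma>\<^sup>2) * (\<xi> * v\<^sup>2) + u\<^sup>2 + 2 * (\<xi> * (p - \<gamma> * v)\<^sup>2) + q\<^sup>2 + b * m\<^sup>2"
    by (simp add: mode_norm_def algebra_simps)
  also have "\<dots> \<le> (2 + 2 * \<gamma>\<^sup>2) * (\<xi> * v\<^sup>2) + (2 + 2 * \<gamma>\<^sup>2) * u\<^sup>2 + (2 + 2 * \<gamma>\<^sup>2) * (\<xi> * (p - \<gamma> * v)\<^sup>2)
     + (2 + 2 * \<gamma>\<^sup>2) * q\<^sup>2 + (2 + 2 * \<gamma>\<^sup>2) * (b * m\<^sup>2)"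
  proof -
    have 1: "w \<le> (2 + 2 * \<gamma>\<^sup>2) * w" if "w \<ge> 0" for w
      using that by (simp add: algebra_simps)
    show ?thesis using assms
      by (intro add_mono 1 mult_right_mono) auto
  qed
  also have "\<dots> = (2 + 2 * \<gamma>\<^sup>2) * base \<xi> b v u p q m"
    by (simp add: base_def algebra_simps)
  finally show ?thesis .
qed

lemma base_le_mode_norm:
  assumes "\<xi> > 0" "b > 0"
  shows "base \<xi> b v u p q m \<le> (2 + 2 * \<gamma>\<^sup>2) * mode_norm \<xi> b v u p q m"
proof -
  have "\<xi> * (p - \<gamma> * v)\<^sup>2 \<le> \<xi> * (2 * p\<^sup>2 + 2 * (\<gamma> * v)\<^sup>2)"
    using sum_square_le[of p "- (\<gamma> * v)"] assms by (intro mult_left_mono) auto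
  also have "\<dots> = 2 * (\<xi> * p\<^sup>2) + 2 * \<gamma>\<^sup>2 * (\<xi> * v\<^sup>2)"
    by (simp add: power_mult_distrib algebra_simps)
  finally have "base \<xi> b v u p q m \<le> (1 + 2 * \<gamma>\<^sup>2) * (\<xi> * v\<^sup>2) + u\<^sup>2 + 2 * (\<xi> * p\<^sup>2) + q\<^sup>2 + b * m\<^sup>2"
    by (simp add: base_def algebra_simps)
  also have "\<dots> \<le> (2 + 2 * \<gamma>\<^sup>2) * (\<xi> * v\<^sup>2) + (2 + 2 * \<gamma>\<^sup>2) * u\<^sup>2 + (2 + 2 * \<gamma>\<^sup>2) * (\<xi> * p\<^sup>2)
     + (2 + 2 * \<gamma>\<^sup>2) * q\<^sup>2 + (2 + 2 * \<gamma>\<^sup>2) * (b * m\<^sup>2)"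
  proof -
    have 1: "w \<le> (2 + 2 * \<gamma>\<^sup>2) * w" if "w \<ge> 0" for w
      using that by (simp add: algebra_simps)
    show ?thesis using assms
      by (intro add_mono 1 mult_right_mono) auto
  qed
  also have "\<dots> = (2 + 2 * \<gamma>\<^sup>2) * mode_norm \<xi> b v u p q m"
    by (simp add: mode_norm_def algebra_simps)
  finally show ?thesis .
qed

text \<open>The derivative of a solution is again a solution, and its energy controls all components up
  to $w = v/\delta - m$, which relaxes at a uniform exponential rate by coercivity.\<close>

lemma mode_decay:
  obtains c C where "c > 0" "C > 0"
    "\<And>\<xi> b v u p q m t. mode_ok \<xi> b \<Longrightarrow> mode_sol \<xi> b v u p q m \<Longrightarrow> t \<ge> 0 \<Longrightarrow>
     \<xi> * (v t)\<^sup>2 + (u t)\<^sup>2 + \<xi> * (p t)\<^sup>2 + (q t)\<^sup>2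
       \<le> C * (exp (- c * t) * mode_norm \<xi> b (v 0) (u 0) (p 0) (q 0) (m 0)
          + exp (- c * (b / \<xi>) * t) / \<xi> *
            mode_norm \<xi> b (u 0) (fu \<xi> b (v 0) (p 0) (m 0)) (q 0) (fq \<xi> (v 0) (p 0)) (fm (u 0) (m 0)))"
proof -
  obtain c1 where c1: "c1 > 0" and decay: "\<And>\<xi> b v u p q m t. mode_ok \<xi> b \<Longrightarrow> mode_sol \<xi> b v u p q m \<Longrightarrow> t \<ge> 0 \<Longrightarrow>
     energy \<xi> b (v t) (u t) (p t) (q t) (m t)
       \<le> 3 * exp (- c1 * (b / \<xi>) * t) * energy \<xi> b (v 0) (u 0) (p 0) (q 0) (m 0)"
    using energy_decay by blast
  obtain C3 where C3: "C3 > 0" and BE: "\<And>\<xi> b v u p q m. mode_ok \<xi> b \<Longrightarrow>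
     base \<xi> b v u p q m \<le> C3 * energy \<xi> b v u p q m" using base_le_energy by blast
  obtain C4 where C4: "C4 > 0" and EB: "\<And>\<xi> b v u p q m. mode_ok \<xi> b \<Longrightarrow>
     energy \<xi> b v u p q m \<le> C4 * base \<xi> b v u p q m" using energy_le_base by blast
  define G where "G = 2 + 2 * \<gamma>\<^sup>2"
  have G: "G > 0" unfolding G_def using pos by (intro add_pos_pos) auto
  \<comment> \<open>The loss from \<open>mode_norm\<close> through \<open>base\<close> to
    \<open>energy\<close> at time 0, across the factor 3, and back again at time t.\<close>
  define D where "D = G * C3 * 3 * C4 * G"
  have D: "D > 0" using G C3 C4 by (simp add: D_def)
  define \<alpha>1 where "\<alpha>1 = \<alpha> - \<gamma>\<^sup>2 * \<beta>"
  \<comment> \<open>Coercivity \<kappa> + s/\<delta> \<le> \<alpha>1 bounds the relaxation rate of w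
    from below: \<delta> - s/\<alpha>1 \<ge> \<delta> \<kappa>/\<alpha>1. The denominator is
    enlarged because \<alpha>1 > 0 is derived only once a mode is given.\<close>
  define \<nu> where "\<nu> = \<delta> * \<kappa> / (\<bar>\<alpha>1\<bar> + 1)"
  have \<nu>: "\<nu> > 0" using pos unfolding \<nu>_def by (intro divide_pos_pos mult_pos_pos) auto
  \<comment> \<open>The bound \<nu>/(2S) makes the rate c b/\<xi> at most \<nu>/2, as
    \<open>gronwall_exp\<close> requires for the slow forcing of w.\<close>
  define c where "c = min c1 (min \<nu> (\<nu> / (2 * S)))"
  have c: "c > 0" "c \<le> c1" "c \<le> \<nu>" "c * S \<le> \<nu> / 2"
  proof -
    show "c > 0" "c \<le> c1" "c \<le> \<nu>" using c1 \<nu> pos by (auto simp: c_def)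
    have "c \<le> \<nu> / (2 * S)" by (simp add: c_def)
    then show "c * S \<le> \<nu> / 2" using pos by (simp add: field_simps)
  qed
  define A where "A = (2 * \<rho>\<^sup>2 + 2 * (\<gamma> * \<mu>)\<^sup>2) / \<alpha>1\<^sup>2"
  define A2 where "A2 = (\<mu> / \<beta>)\<^sup>2"
  define F where "F = A * D / \<nu>"
  define C where "C = (1 + 2 * \<gamma>\<^sup>2) * (2 * (S / \<alpha>1\<^sup>2) * (2 / \<delta>\<^sup>2 * S + 2) + 2 * (S\<^sup>2 / \<alpha>1\<^sup>2) * (2 * F / \<nu>) + 2 * (A * D)) + 2 * (A2 * D) + D"
  have A: "A \<ge> 0" "A2 \<ge> 0" "F \<ge> 0" using D \<nu> by (auto simp: A_def A2_def F_def)
  have C: "C > 0" unfolding C_def using A D pos \<nu>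
    by (intro add_nonneg_pos add_nonneg_nonneg mult_nonneg_nonneg) auto
  show thesis
  proof (rule that[OF c(1) C])
    fix \<xi> b t :: real and v u p q m :: "real \<Rightarrow> real"
    assume ok: "mode_ok \<xi> b" and sol: "mode_sol \<xi> b v u p q m" and t: "t \<ge> 0"
    note o = mode_okD[OF ok]
    define s where "s = b / \<xi>"
    have s: "0 < s" "s \<le> S" "s * \<xi> = b" using o by (auto simp: s_def field_simps)
    have \<alpha>1: "\<kappa> + s / \<delta> \<le> \<alpha>1" "\<alpha>1 > 0"
    proof -
      have "b / (\<delta> * \<xi>) = s / \<delta>" using o pos by (simp add: s_def)
      then show "\<kappa> + s / \<delta> \<le> \<alpha>1" using o by (simp add: \<alpha>1_def)
      moreover have "s / \<delta> > 0" using s pos by simp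
      ultimately show "\<alpha>1 > 0" using pos by linarith
    qed
    define U where "U = (\<lambda>t. fu \<xi> b (v t) (p t) (m t))"
    define Q where "Q = (\<lambda>t. fq \<xi> (v t) (p t))"
    define M where "M = (\<lambda>t. fm (u t) (m t))"
    define e0 where "e0 = mode_norm \<xi> b (v 0) (u 0) (p 0) (q 0) (m 0)"
    define y0 where "y0 = mode_norm \<xi> b (u 0) (U 0) (q 0) (Q 0) (M 0)"
    have y0: "y0 \<ge> 0" "e0 \<ge> 0" using o by (auto simp: y0_def e0_def mode_norm_def)
    have sol': "mode_sol \<xi> b u U q Q M" unfolding U_def Q_def M_def by (rule mode_sol_deriv[OF sol])
    define Y where "Y = (\<lambda>r. D * exp (- (c * s) * r) * y0)"
    have Y: "\<xi> * (u r)\<^sup>2 + (U r)\<^sup>2 + \<xi> * (q r)\<^sup>2 + (Q r)\<^sup>2 \<le> Y r" if r: "r \<ge> 0" for r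
    proof -
      have "\<xi> * (u r)\<^sup>2 + (U r)\<^sup>2 + \<xi> * (q r)\<^sup>2 + (Q r)\<^sup>2 \<le> mode_norm \<xi> b (u r) (U r) (q r) (Q r) (M r)"
        using o by (simp add: mode_norm_def)
      also have "\<dots> \<le> G * base \<xi> b (u r) (U r) (q r) (Q r) (M r)"
        unfolding G_def by (rule mode_norm_le_base) (use o in auto)
      also have "\<dots> \<le> G * (C3 * energy \<xi> b (u r) (U r) (q r) (Q r) (M r))"
        using G by (intro mult_left_mono BE ok) auto
      also have "\<dots> \<le> G * (C3 * (3 * exp (- c1 * (b / \<xi>) * r) * energy \<xi> b (u 0) (U 0) (q 0) (Q 0) (M 0)))"
        using G C3 by (intro mult_left_mono decay ok sol' r) auto
      also have "\<dots> \<le> G * (C3 * (3 * exp (- c1 * (b / \<xi>) * r) * (C4 * base \<xi> b (u 0) (U 0) (q 0) (Q 0) (M 0))))"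
        using G C3 by (intro mult_left_mono EB ok) auto
      also have "\<dots> \<le> G * (C3 * (3 * exp (- c1 * (b / \<xi>) * r) * (C4 * (G * y0))))"
        unfolding y0_def G_def using G C3 C4 o by (intro mult_left_mono base_le_mode_norm) (auto simp: G_def)
      also have "\<dots> = exp (- c1 * (b / \<xi>) * r) * (D * y0)" by (simp add: D_def mult_ac)
      also have "\<dots> \<le> exp (- (c * s) * r) * (D * y0)"
      proof (rule mult_right_mono)
        have "c * s * r \<le> c1 * s * r" using c s r by (intro mult_right_mono) auto
        then show "exp (- c1 * (b / \<xi>) * r) \<le> exp (- (c * s) * r)" by (simp add: s_def)
      qed (use D y0 in auto)
      finally show ?thesis by (simp add: Y_def mult_ac)
    qed
    have Y0: "Y r \<ge> 0" for r using D y0 by (simp add: Y_def)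
    define w where "w = (\<lambda>r. v r / \<delta> - m r)"
    \<comment> \<open>The first equation of motion read as a static one: \<alpha>1 \<xi> v - b w = -
      \<rho> v_tt - \<gamma> \<mu> p_tt. Up to the share s/\<alpha>1 of w, v thus gains a factor
      1/\<xi> over the differentiated solution.\<close>
    define f where "f = (\<lambda>r. v r - s / \<alpha>1 * w r)"
    have x: "p r - \<gamma> * v r = - (\<mu> / \<beta>) * Q r / \<xi>" for r
      using o pos by (simp add: Q_def fq_eq)
    have f: "f r = (- \<rho> * U r - \<gamma> * \<mu> * Q r) / (\<alpha>1 * \<xi>)" for r
    proof -
      have "\<rho> * U r = - (\<alpha> * \<xi> * v r) + \<gamma> * \<beta> * \<xi> * p r + b / \<delta> * v r - b * m r"
        using pos by (simp add: U_def fu_def)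
      also have "\<dots> = - (\<alpha>1 * \<xi> * v r) + \<gamma> * (\<beta> * \<xi> * (p r - \<gamma> * v r)) + b * w r"
        by (simp add: \<alpha>1_def w_def algebra_simps power2_eq_square)
      also have "\<beta> * \<xi> * (p r - \<gamma> * v r) = - \<mu> * Q r"
        using pos o by (simp add: x)
      finally have "\<alpha>1 * \<xi> * v r - b * w r = - \<rho> * U r - \<gamma> * \<mu> * Q r" by simp
      moreover have "f r = (\<alpha>1 * \<xi> * v r - b * w r) / (\<alpha>1 * \<xi>)"
        using \<alpha>1 o by (simp add: f_def s_def field_simps)
      ultimately show ?thesis by simp
    qed
    have f2: "(f r)\<^sup>2 \<le> A * Y r / \<xi>\<^sup>2" if "r \<ge> 0" for r
    proof -
      have nn: "\<xi> * (u r)\<^sup>2 \<ge> 0" "\<xi> * (q r)\<^sup>2 \<ge> 0" using o by auto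
      have UQ: "(U r)\<^sup>2 \<le> Y r" "(Q r)\<^sup>2 \<le> Y r"
        using Y[OF that] nn zero_le_power2[of "U r"] zero_le_power2[of "Q r"] by linarith+
      have "(- \<rho> * U r - \<gamma> * \<mu> * Q r)\<^sup>2 \<le> 2 * (\<rho>\<^sup>2 * (U r)\<^sup>2) + 2 * ((\<gamma> * \<mu>)\<^sup>2 * (Q r)\<^sup>2)"
        using sum_square_le[of "- \<rho> * U r" "- \<gamma> * \<mu> * Q r"] by (simp add: power_mult_distrib mult.assoc)
      also have "\<dots> \<le> 2 * (\<rho>\<^sup>2 * Y r) + 2 * ((\<gamma> * \<mu>)\<^sup>2 * Y r)"
        using UQ by (intro add_mono mult_left_mono) auto
      finally have "(- \<rho> * U r - \<gamma> * \<mu> * Q r)\<^sup>2 \<le> (2 * \<rho>\<^sup>2 + 2 * (\<gamma> * \<mu>)\<^sup>2) * Y r"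
        by (simp add: algebra_simps)
      then have "(- \<rho> * U r - \<gamma> * \<mu> * Q r)\<^sup>2 / (\<alpha>1 * \<xi>)\<^sup>2 \<le> (2 * \<rho>\<^sup>2 + 2 * (\<gamma> * \<mu>)\<^sup>2) * Y r / (\<alpha>1 * \<xi>)\<^sup>2"
        by (intro divide_right_mono) auto
      then show ?thesis by (simp add: f power_divide A_def power_mult_distrib)
    qed
    have dw: "(w has_real_derivative v r - \<delta> * w r) (at r within {0..})" if "r \<ge> 0" for r
    proof -
      have "(w has_real_derivative u r / \<delta> - fm (u r) (m r)) (at r within {0..})"
        unfolding w_def by (intro DERIV_diff DERIV_cdivide mode_solD[OF sol that])
      also have "u r / \<delta> - fm (u r) (m r) = v r - \<delta> * w r"
        using pos by (simp add: fm_def w_def field_simps)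
      finally show ?thesis .
    qed
    have w: "(w r)\<^sup>2 \<le> exp (- \<nu> * r) * (w 0)\<^sup>2 + 2 * (F * y0 / \<xi>\<^sup>2) / \<nu> * exp (- (c * s) * r)" if "r \<ge> 0" for r
    proof (rule gronwall_exp[where J = "\<lambda>r. (w r)\<^sup>2" and J' = "\<lambda>r. 2 * w r * (v r - \<delta> * w r)"])
      fix r :: real assume r: "r \<ge> 0"
      show "((\<lambda>r. (w r)\<^sup>2) has_real_derivative 2 * w r * (v r - \<delta> * w r)) (at r within {0..})"
        using dw[OF r] by (auto intro!: derivative_eq_intros simp: power2_eq_square)
      \<comment> \<open>Eliminating v leaves w' = - (\<delta> - s/\<alpha>1) w + f, a damped
        equation with a uniform rate and a forcing of size 1/\<xi>.\<close>
      have "v r - \<delta> * w r = f r - (\<delta> - s / \<alpha>1) * w r" by (simp add: f_def algebra_simps)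
      then have eq: "2 * w r * (v r - \<delta> * w r) = 2 * (w r * f r) - 2 * (\<delta> - s / \<alpha>1) * (w r)\<^sup>2"
        by (simp add: algebra_simps power2_eq_square)
      have f_le: "w r * f r \<le> (\<delta> - s / \<alpha>1) / 2 * (w r)\<^sup>2 + (f r)\<^sup>2 / (4 * ((\<delta> - s / \<alpha>1) / 2))"
      proof (rule young)
        have "s / \<delta> < \<alpha>1" using \<alpha>1 pos by linarith
        then have "s / \<alpha>1 < \<delta>" using pos \<alpha>1 by (simp add: field_simps)
        then show "0 < (\<delta> - s / \<alpha>1) / 2" by simp
      qed
      have 1: "2 * w r * (v r - \<delta> * w r) \<le> - (\<delta> - s / \<alpha>1) * (w r)\<^sup>2 + (f r)\<^sup>2 / (\<delta> - s / \<alpha>1)"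
      proof -
        have "2 * (d / 2 * W + F / (4 * (d / 2))) - 2 * d * W = - d * W + F / d" for d W F :: real
          by (simp add: field_simps)
        note id = this[of "\<delta> - s / \<alpha>1" "(w r)\<^sup>2" "(f r)\<^sup>2"]
        have "r1 = 2 * r2 - r3 \<Longrightarrow> r2 \<le> r4 \<Longrightarrow> 2 * r4 - r3 = r5 \<Longrightarrow> r1 \<le> r5" for r1 r2 r3 r4 r5 :: real
          by linarith
        from this[OF eq f_le id] show ?thesis .
      qed
      have 2: "\<nu> \<le> \<delta> - s / \<alpha>1"
      proof -
        have "\<nu> \<le> \<delta> * \<kappa> / \<alpha>1" unfolding \<nu>_def using \<alpha>1 pos by (intro divide_left_mono) auto
        also have "\<dots> \<le> \<delta> * (\<alpha>1 - s / \<delta>) / \<alpha>1"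
          using \<alpha>1 pos by (intro divide_right_mono mult_left_mono) auto
        also have "\<dots> = \<delta> - s / \<alpha>1" using \<alpha>1 pos by (simp add: field_simps)
        finally show ?thesis .
      qed
      have "- (\<delta> - s / \<alpha>1) * (w r)\<^sup>2 \<le> - \<nu> * (w r)\<^sup>2" using 2 by (intro mult_right_mono) auto
      moreover have "(f r)\<^sup>2 / (\<delta> - s / \<alpha>1) \<le> (A * Y r / \<xi>\<^sup>2) / \<nu>"
        using f2[OF r] 2 \<nu> A(1) Y0[of r] by (intro frac_le) auto
      moreover have "(A * Y r / \<xi>\<^sup>2) / \<nu> = F * y0 / \<xi>\<^sup>2 * exp (- (c * s) * r)"
        by (simp add: F_def Y_def mult_ac)
      ultimately show "2 * w r * (v r - \<delta> * w r) \<le> - \<nu> * (w r)\<^sup>2 + F * y0 / \<xi>\<^sup>2 * exp (- (c * s) * r)"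
        using 1 by linarith
    next
      have "c * s \<le> c * S" using s c by (intro mult_left_mono) auto
      then show "c * s \<le> \<nu> / 2" using c by linarith
    qed (use \<nu> A y0 that in auto)
    have w0: "b * (w 0)\<^sup>2 \<le> (2 / \<delta>\<^sup>2 * S + 2) * e0"
    proof -
      have "b * (w 0)\<^sup>2 \<le> b * (2 * (v 0 / \<delta>)\<^sup>2 + 2 * (m 0)\<^sup>2)"
        unfolding w_def using o sum_square_le[of "v 0 / \<delta>" "- m 0"] by (intro mult_left_mono) auto
      also have "\<dots> = 2 / \<delta>\<^sup>2 * (b * (v 0)\<^sup>2) + 2 * (b * (m 0)\<^sup>2)"
        by (simp add: power_divide algebra_simps)
      also have "\<dots> \<le> 2 / \<delta>\<^sup>2 * (S * \<xi> * (v 0)\<^sup>2) + 2 * (b * (m 0)\<^sup>2)"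
        using o by (intro add_mono mult_left_mono mult_right_mono) auto
      also have "\<dots> = (2 / \<delta>\<^sup>2 * S) * (\<xi> * (v 0)\<^sup>2) + 2 * (b * (m 0)\<^sup>2)" by simp
      also have "\<dots> \<le> (2 / \<delta>\<^sup>2 * S) * e0 + 2 * e0"
      proof -
        have nn: "\<xi> * (v 0)\<^sup>2 \<ge> 0" "\<xi> * (p 0)\<^sup>2 \<ge> 0" "b * (m 0)\<^sup>2 \<ge> 0" using o by auto
        then have "\<xi> * (v 0)\<^sup>2 \<le> e0" "b * (m 0)\<^sup>2 \<le> e0"
          unfolding e0_def mode_norm_def using zero_le_power2[of "u 0"] zero_le_power2[of "q 0"] by linarith+
        then show ?thesis using pos by (intro add_mono mult_left_mono) auto
      qed
      finally show ?thesis by (simp add: algebra_simps)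
    qed
    define X where "X = exp (- c * t) * e0"
    define Z where "Z = exp (- (c * s) * t) / \<xi> * y0"
    have XZ: "X \<ge> 0" "Z \<ge> 0" using y0 o by (auto simp: X_def Z_def)
    have YZ: "Y t = D * (\<xi> * Z)" using o by (simp add: Y_def Z_def)
    have v: "\<xi> * (v t)\<^sup>2 \<le> (2 * (S / \<alpha>1\<^sup>2) * (2 / \<delta>\<^sup>2 * S + 2)) * X + (2 * (S\<^sup>2 / \<alpha>1\<^sup>2) * (2 * F / \<nu>) + 2 * (A * D)) * Z"
    proof -
      have "b * (w t)\<^sup>2 \<le> b * (exp (- \<nu> * t) * (w 0)\<^sup>2 + 2 * (F * y0 / \<xi>\<^sup>2) / \<nu> * exp (- (c * s) * t))"
        using o w[OF t] by (intro mult_left_mono) auto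
      also have "\<dots> = exp (- \<nu> * t) * (b * (w 0)\<^sup>2) + s * (2 * F / \<nu> * Z)"
        using o by (simp add: Z_def s_def field_simps power2_eq_square)
      also have "\<dots> \<le> exp (- c * t) * ((2 / \<delta>\<^sup>2 * S + 2) * e0) + S * (2 * F / \<nu> * Z)"
      proof (rule add_mono)
        have "c * t \<le> \<nu> * t" using c t by (intro mult_right_mono) auto
        then show "exp (- \<nu> * t) * (b * (w 0)\<^sup>2) \<le> exp (- c * t) * ((2 / \<delta>\<^sup>2 * S + 2) * e0)"
          using o by (intro mult_mono[OF _ w0]) auto
        show "s * (2 * F / \<nu> * Z) \<le> S * (2 * F / \<nu> * Z)"
          using s A XZ \<nu> by (intro mult_right_mono) auto
      qed
      also have "\<dots> = (2 / \<delta>\<^sup>2 * S + 2) * X + S * (2 * F / \<nu> * Z)" by (simp add: X_def)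
      finally have bw: "b * (w t)\<^sup>2 \<le> (2 / \<delta>\<^sup>2 * S + 2) * X + S * (2 * F / \<nu> * Z)" .
      have "\<xi> * (f t)\<^sup>2 \<le> \<xi> * (A * Y t / \<xi>\<^sup>2)" using f2[OF t] o by (intro mult_left_mono) auto
      also have "\<dots> = A * D * Z" using o by (simp add: YZ power2_eq_square)
      finally have xf: "\<xi> * (f t)\<^sup>2 \<le> A * D * Z" .
      \<comment> \<open>Here v is split into (s/\<alpha>1) w + f; one factor s \<xi> = b turns \<xi>
        (s w)^2 into s b w^2, whose weight b is the one that the initial data control.\<close>
      have "\<xi> * (v t)\<^sup>2 \<le> \<xi> * (2 * (s / \<alpha>1 * w t)\<^sup>2 + 2 * (f t)\<^sup>2)"
        using sum_square_le[of "s / \<alpha>1 * w t" "f t"] o by (intro mult_left_mono) (auto simp: f_def)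
      also have "\<dots> = 2 * (s / \<alpha>1\<^sup>2) * (b * (w t)\<^sup>2) + 2 * (\<xi> * (f t)\<^sup>2)"
        unfolding s(3)[symmetric] by (simp add: power_mult_distrib power_divide power2_eq_square algebra_simps)
      also have "\<dots> \<le> 2 * (s / \<alpha>1\<^sup>2) * ((2 / \<delta>\<^sup>2 * S + 2) * X + S * (2 * F / \<nu> * Z)) + 2 * (A * D * Z)"
        using s by (intro add_mono mult_left_mono bw xf) auto
      also have "\<dots> \<le> 2 * (S / \<alpha>1\<^sup>2) * ((2 / \<delta>\<^sup>2 * S + 2) * X + S * (2 * F / \<nu> * Z)) + 2 * (A * D * Z)"
        using s XZ A \<nu> pos by (intro add_mono mult_right_mono mult_left_mono divide_right_mono add_nonneg_nonneg mult_nonneg_nonneg) auto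
      also have "\<dots> = (2 * (S / \<alpha>1\<^sup>2) * (2 / \<delta>\<^sup>2 * S + 2)) * X + (2 * (S\<^sup>2 / \<alpha>1\<^sup>2) * (2 * F / \<nu>) + 2 * (A * D)) * Z"
        by (simp add: algebra_simps power2_eq_square)
      finally show ?thesis .
    qed
    have nnU: "(U t)\<^sup>2 \<ge> 0" "\<xi> * (u t)\<^sup>2 \<ge> 0" "\<xi> * (q t)\<^sup>2 \<ge> 0" "(Q t)\<^sup>2 \<ge> 0" using o by auto
    have uq: "(u t)\<^sup>2 + (q t)\<^sup>2 \<le> D * Z"
    proof -
      have "\<xi> * ((u t)\<^sup>2 + (q t)\<^sup>2) \<le> \<xi> * (D * Z)"
        using Y[OF t] nnU mult.left_commute[of \<xi> D Z] unfolding YZ distrib_left by linarith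
      then show ?thesis using o by simp
    qed
    have p: "\<xi> * (p t)\<^sup>2 \<le> 2 * (A2 * D) * Z + 2 * \<gamma>\<^sup>2 * (\<xi> * (v t)\<^sup>2)"
    proof -
      have "\<xi> * (p t)\<^sup>2 \<le> \<xi> * (2 * (p t - \<gamma> * v t)\<^sup>2 + 2 * (\<gamma> * v t)\<^sup>2)"
        using sum_square_le[of "p t - \<gamma> * v t" "\<gamma> * v t"] o by (intro mult_left_mono) auto
      also have "\<dots> = 2 * (\<xi> * (p t - \<gamma> * v t)\<^sup>2) + 2 * \<gamma>\<^sup>2 * (\<xi> * (v t)\<^sup>2)"
        by (simp add: algebra_simps power_mult_distrib)
      also have "\<xi> * (p t - \<gamma> * v t)\<^sup>2 = A2 * (Q t)\<^sup>2 / \<xi>"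
        using o by (simp add: x A2_def power_divide power_mult_distrib power2_eq_square mult_ac)
      also have "\<dots> \<le> A2 * (D * (\<xi> * Z)) / \<xi>"
      proof -
        have "(Q t)\<^sup>2 \<le> D * (\<xi> * Z)" using Y[OF t] nnU unfolding YZ by linarith
        then show ?thesis using o A by (intro divide_right_mono mult_left_mono) auto
      qed
      also have "\<dots> = A2 * D * Z" using o by simp
      finally show ?thesis by simp
    qed
    have "\<xi> * (v t)\<^sup>2 + (u t)\<^sup>2 + \<xi> * (p t)\<^sup>2 + (q t)\<^sup>2 \<le> (1 + 2 * \<gamma>\<^sup>2) * (\<xi> * (v t)\<^sup>2) + (2 * (A2 * D) + D) * Z"
      using uq p by (simp add: algebra_simps)
    also have "\<dots> \<le> (1 + 2 * \<gamma>\<^sup>2) * ((2 * (S / \<alpha>1\<^sup>2) * (2 / \<delta>\<^sup>2 * S + 2)) * X + (2 * (S\<^sup>2 / \<alpha>1\<^sup>2) * (2 * F / \<nu>) + 2 * (A * D)) * Z) + (2 * (A2 * D) + D) * Z"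
      by (rule add_right_mono, rule mult_left_mono[OF v]) simp
    also have "\<dots> \<le> C * X + C * Z"
    proof -
      define C5 where "C5 = 2 * (S / \<alpha>1\<^sup>2) * (2 / \<delta>\<^sup>2 * S + 2)"
      define C6 where "C6 = 2 * (S\<^sup>2 / \<alpha>1\<^sup>2) * (2 * F / \<nu>) + 2 * (A * D)"
      define C7 where "C7 = 2 * (A2 * D) + D"
      have "0 \<le> A2 * D" "0 \<le> A * D" using A D by auto
      then have nn: "C5 \<ge> 0" "C6 \<ge> 0" "C7 \<ge> 0" using pos A \<nu> D
        by (auto simp: C5_def C6_def C7_def intro!: add_nonneg_nonneg)
      have Ceq: "C = (1 + 2 * \<gamma>\<^sup>2) * (C5 + C6) + C7"
        unfolding C_def C5_def C6_def C7_def by (simp add: algebra_simps)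
      have "(1 + 2 * \<gamma>\<^sup>2) * C5 * X \<le> C * X"
        unfolding Ceq using nn XZ by (intro mult_right_mono) (auto simp: algebra_simps)
      moreover have "((1 + 2 * \<gamma>\<^sup>2) * C6 + C7) * Z \<le> C * Z"
        unfolding Ceq using nn XZ by (intro mult_right_mono) (auto simp: algebra_simps)
      ultimately show ?thesis unfolding C5_def[symmetric] C6_def[symmetric] C7_def[symmetric]
        by (simp add: algebra_simps)
    qed
    finally show "\<xi> * (v t)\<^sup>2 + (u t)\<^sup>2 + \<xi> * (p t)\<^sup>2 + (q t)\<^sup>2
       \<le> C * (exp (- c * t) * mode_norm \<xi> b (v 0) (u 0) (p 0) (q 0) (m 0)
          + exp (- c * (b / \<xi>) * t) / \<xi> *
            mode_norm \<xi> b (u 0) (fu \<xi> b (v 0) (p 0) (m 0)) (q 0) (fq \<xi> (v 0) (p 0)) (fm (u 0) (m 0)))"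
      by (simp add: X_def Z_def e0_def y0_def s_def U_def Q_def M_def algebra_simps)
  qed
qed

text \<open>Starting from \<open>w = 0\<close>, both \<open>v\<close> and \<open>w\<close> are of size $\xi^{-1/2}$, hence so is \<open>m\<close>, and the
  dissipation is of size $b/\xi$.\<close>

lemma mode_lower:
  obtains C where "C > 0"
    "\<And>\<xi> b v u p q m t. mode_ok \<xi> b \<Longrightarrow> mode_sol \<xi> b v u p q m \<Longrightarrow> t \<ge> 0 \<Longrightarrow>
     v 0 = 0 \<Longrightarrow> u 0 = 1 \<Longrightarrow> p 0 = 0 \<Longrightarrow> q 0 = 0 \<Longrightarrow> m 0 = 0 \<Longrightarrow>
     \<rho> - C * (b / \<xi>) * t \<le> energy \<xi> b (v t) (u t) (p t) (q t) (m t)"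
proof -
  \<comment> \<open>\<open>A / \<xi>\<close> bounds m^2 through m = v/\<delta> - w: the first
    summand comes from \<kappa> \<xi> v^2 \<le> \<rho>, the initial energy, the second from what
    \<open>gronwall_exp\<close> with l = 0 makes of this for w.\<close>
  define A where "A = 2 / \<delta>\<^sup>2 * (\<rho> / \<kappa>) + 2 * (2 * (\<rho> / (\<kappa> * \<delta>)) / \<delta>)"
  define C where "C = 2 * \<delta>\<^sup>2 * A"
  have "A > 0" unfolding A_def using pos by (intro add_pos_pos mult_pos_pos divide_pos_pos) auto
  then have C: "C > 0" unfolding C_def using pos by simp
  show thesis
  proof (rule that[OF C])
    fix \<xi> b t :: real and v u p q m :: "real \<Rightarrow> real"
    assume ok: "mode_ok \<xi> b" and sol: "mode_sol \<xi> b v u p q m" and t: "t \<ge> 0"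
      and init: "v 0 = 0" "u 0 = 1" "p 0 = 0" "q 0 = 0" "m 0 = 0"
    note o = mode_okD[OF ok]
    define E where "E = (\<lambda>t. energy \<xi> b (v t) (u t) (p t) (q t) (m t))"
    have dE: "(E has_real_derivative - 2 * \<delta>\<^sup>2 * b * (m r)\<^sup>2) (at r within {0..})" if "r \<ge> 0" for r
      unfolding E_def by (rule energy_deriv[OF sol that o(1)])
    have E0: "E 0 = \<rho>" by (simp add: E_def energy_def init)
    have v: "(v r)\<^sup>2 \<le> \<rho> / \<kappa> / \<xi>" if "r \<ge> 0" for r
    proof -
      have "E r \<le> E 0"
        by (rule nonincreasing_from_deriv[where f = E, OF dE]) (use that o in auto)
      moreover have "\<kappa> * \<xi> * (v r)\<^sup>2 \<le> E r"
      proof -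
        have "\<kappa> * (\<xi> * (v r)\<^sup>2) \<le> (\<alpha> - b / (\<delta> * \<xi>) - \<gamma>\<^sup>2 * \<beta>) * (\<xi> * (v r)\<^sup>2)"
          using o by (intro mult_right_mono) auto
        moreover have "0 \<le> \<rho> * (u r)\<^sup>2 + \<beta> * \<xi> * (p r - \<gamma> * v r)\<^sup>2 + \<mu> * (q r)\<^sup>2 + \<delta> * b * (m r)\<^sup>2"
          using o pos by (intro add_nonneg_nonneg) auto
        ultimately show ?thesis unfolding E_def energy_def by (simp add: mult.assoc)
      qed
      ultimately show ?thesis using pos o E0 by (simp add: field_simps)
    qed
    define w where "w = (\<lambda>r. v r / \<delta> - m r)"
    have dw: "(w has_real_derivative v r - \<delta> * w r) (at r within {0..})" if "r \<ge> 0" for r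
    proof -
      have "(w has_real_derivative u r / \<delta> - fm (u r) (m r)) (at r within {0..})"
        unfolding w_def by (intro DERIV_diff DERIV_cdivide mode_solD[OF sol that])
      also have "u r / \<delta> - fm (u r) (m r) = v r - \<delta> * w r"
        using pos by (simp add: fm_def w_def field_simps)
      finally show ?thesis .
    qed
    have w: "(w r)\<^sup>2 \<le> exp (- \<delta> * r) * (w 0)\<^sup>2 + 2 * (\<rho> / \<kappa> / \<xi> / \<delta>) / \<delta> * exp (- 0 * r)" if "r \<ge> 0" for r
    proof (rule gronwall_exp[where J = "\<lambda>r. (w r)\<^sup>2" and J' = "\<lambda>r. 2 * w r * (v r - \<delta> * w r)"])
      fix r :: real assume r: "r \<ge> 0"
      show "((\<lambda>r. (w r)\<^sup>2) has_real_derivative 2 * w r * (v r - \<delta> * w r)) (at r within {0..})"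
        using dw[OF r] by (auto intro!: derivative_eq_intros simp: power2_eq_square)
      have "w r * v r \<le> \<delta> / 2 * (w r)\<^sup>2 + (v r)\<^sup>2 / (4 * (\<delta> / 2))"
        using pos by (intro young) auto
      moreover have "(v r)\<^sup>2 / \<delta> \<le> \<rho> / \<kappa> / \<xi> / \<delta>" using v[OF r] pos by (intro divide_right_mono) auto
      ultimately show "2 * w r * (v r - \<delta> * w r) \<le> - \<delta> * (w r)\<^sup>2 + \<rho> / \<kappa> / \<xi> / \<delta> * exp (- 0 * r)"
        by (simp add: algebra_simps power2_eq_square)
    qed (use pos o that in auto)
    have m: "(m r)\<^sup>2 \<le> A / \<xi>" if "r \<ge> 0" for r
    proof -
      have "(m r)\<^sup>2 \<le> 2 * (v r / \<delta>)\<^sup>2 + 2 * (w r)\<^sup>2"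
        using sum_square_le[of "v r / \<delta>" "- w r"] by (simp add: w_def power2_commute)
      also have "\<dots> = 2 / \<delta>\<^sup>2 * (v r)\<^sup>2 + 2 * (w r)\<^sup>2" by (simp add: power_divide)
      also have "\<dots> \<le> 2 / \<delta>\<^sup>2 * (\<rho> / \<kappa> / \<xi>) + 2 * (2 * (\<rho> / \<kappa> / \<xi> / \<delta>) / \<delta>)"
        using v[OF that] w[OF that] by (intro add_mono mult_left_mono) (auto simp: w_def init)
      also have "\<dots> = A / \<xi>" by (simp add: A_def add_divide_distrib mult_ac)
      finally show ?thesis .
    qed
    \<comment> \<open>The loss rate 2 \<delta>^2 b m^2 is at most C b/\<xi>, so E + C (b/\<xi>) t
      does not decrease.\<close>
    define H where "H = (\<lambda>r. - E r - C * (b / \<xi>) * r)"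
    have "H t \<le> H 0"
    proof (rule nonincreasing_from_deriv[where f = H and f' = "\<lambda>r. - (- 2 * \<delta>\<^sup>2 * b * (m r)\<^sup>2) - C * (b / \<xi>)"])
      fix r :: real assume "r \<ge> 0"
      from dE[OF this] show "(H has_real_derivative - (- 2 * \<delta>\<^sup>2 * b * (m r)\<^sup>2) - C * (b / \<xi>)) (at r within {0..})"
        unfolding H_def using o by (auto intro!: derivative_eq_intros)
    next
      fix r assume "0 < r" "r < t"
      then have "2 * \<delta>\<^sup>2 * b * (m r)\<^sup>2 \<le> 2 * \<delta>\<^sup>2 * b * (A / \<xi>)" using m[of r] o by (intro mult_left_mono) auto
      then show "- (- 2 * \<delta>\<^sup>2 * b * (m r)\<^sup>2) - C * (b / \<xi>) \<le> 0" by (simp add: C_def mult_ac)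
    qed (use t in auto)
    then show "\<rho> - C * (b / \<xi>) * t \<le> energy \<xi> b (v t) (u t) (p t) (q t) (m t)"
      using E0 by (simp add: H_def E_def)
  qed
qed

end

section \<open>Integrals with an exponential weight\<close>

text \<open>A cover by Borel sets of finite measure serves the completed measure too. Fubini on the
  half line rests on it, as \<open>Rplus\<close> is built on the completion.\<close>

lemma sigma_finite_lebesgue: "sigma_finite_measure (lebesgue :: 'a::euclidean_space measure)"
proof
  obtain A :: "'a set set" where A: "countable A" "A \<subseteq> sets lborel" "\<Union> A = space lborel"
      "\<forall>a\<in>A. emeasure lborel a \<noteq> \<infinity>"
    using lborel.sigma_finite_countable by auto
  have sb: "a \<in> sets lborel" if "a \<in> A" for a using A that by auto
  show "\<exists>A. countable A \<and> A \<subseteq> sets lebesgue \<and> \<Union> A = space lebesgue \<and>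
      (\<forall>a\<in>A. emeasure lebesgue (a :: 'a set) \<noteq> \<infinity>)"
  proof (intro exI[of _ A] conjI ballI)
    show "A \<subseteq> sets lebesgue" using sb by (auto intro: sets_completionI_sets)
    show "emeasure lebesgue a \<noteq> \<infinity>" if "a \<in> A" for a
      using A that sb[OF that] by (simp add: emeasure_completion main_part)
  qed (use A in auto)
qed

lemma sigma_finite_lebesgue_on: "A \<in> sets lebesgue \<Longrightarrow> sigma_finite_measure (lebesgue_on (A :: 'a::euclidean_space set))"
  by (rule sigma_finite_measure_restrict_space[OF sigma_finite_lebesgue])

lemma id_measurable_lebesgue_on [measurable]: "(\<lambda>x::real. x) \<in> borel_measurable (lebesgue_on A)"
  by (rule measurable_restrict_space1) (simp add: measurable_completion)

interpretation Rplus: sigma_finite_measure Rplus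
  by (rule sigma_finite_lebesgue_on) auto

interpretation Rplus2: pair_sigma_finite Rplus Rplus ..

lemma AE_Rplus_pos: "AE s in Rplus. s > 0"
  by (rule AE_I2) (simp add: space_restrict_space)

lemma exp_tail_integral:
  fixes \<delta> r :: real
  assumes "\<delta> > 0" "r > 0"
  shows "integrable Rplus (\<lambda>s. indicator {r..} s * exp (- \<delta> * s))"
    and "(LINT s|Rplus. indicator {r..} s * exp (- \<delta> * s)) = exp (- \<delta> * r) / \<delta>"
proof -
  have I: "((\<lambda>x. exp (- \<delta> * x)) has_integral exp (- \<delta> * r) / \<delta>) {r..}"
    by (rule has_integral_exp_minus_to_infinity[OF assms(1)])
  then have A: "(\<lambda>x. exp (- \<delta> * x)) absolutely_integrable_on {r..}"
    by (intro nonnegative_absolutely_integrable_1) (auto simp: integrable_on_def)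
  have eq: "(\<lambda>s. indicator {0<..} s *\<^sub>R (indicator {r..} s * exp (- \<delta> * s))) = (\<lambda>s. indicator {r..} s *\<^sub>R exp (- \<delta> * s))"
    using assms by (auto simp: indicator_def fun_eq_iff)
  have side: "{0::real<..} \<inter> space lebesgue \<in> sets lebesgue" by simp
  show "integrable Rplus (\<lambda>s. indicator {r..} s * exp (- \<delta> * s))"
    using A unfolding set_integrable_def integrable_restrict_space[OF side] eq .
  have "(LINT s|Rplus. indicator {r..} s * exp (- \<delta> * s)) = (LINT s|lebesgue. indicator {r..} s *\<^sub>R exp (- \<delta> * s))"
    unfolding integral_restrict_space[OF side] eq ..
  also have "\<dots> = exp (- \<delta> * r) / \<delta>"
    using set_lebesgue_integral_eq_integral(2)[OF A] I
    by (simp add: set_lebesgue_integral_def integral_unique)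
  finally show "(LINT s|Rplus. indicator {r..} s * exp (- \<delta> * s)) = exp (- \<delta> * r) / \<delta>" .
qed

lemma exp_integral:
  fixes \<delta> :: real
  assumes "\<delta> > 0"
  shows "integrable Rplus (\<lambda>s. exp (- \<delta> * s))" and "(LINT s|Rplus. exp (- \<delta> * s)) = 1 / \<delta>"
proof -
  have I: "((\<lambda>x. exp (- \<delta> * x)) has_integral exp (- \<delta> * 0) / \<delta>) {0..}"
    by (rule has_integral_exp_minus_to_infinity[OF assms(1)])
  then have I: "((\<lambda>x. exp (- \<delta> * x)) has_integral 1 / \<delta>) {0<..}"
    by (subst (asm) has_integral_spike_set_eq[OF negligible_subset[OF negligible_sing[of 0]] empty_imp_negligible, of "{0..}" "{0<..}"])
       auto
  then have A: "(\<lambda>x. exp (- \<delta> * x)) absolutely_integrable_on {0<..}"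
    by (intro nonnegative_absolutely_integrable_1) (auto simp: integrable_on_def)
  show "integrable Rplus (\<lambda>s. exp (- \<delta> * s))"
    using A unfolding set_integrable_def by (subst integrable_restrict_space) auto
  have "(LINT s|Rplus. exp (- \<delta> * s)) = (LINT s|lebesgue. indicator {0<..} s *\<^sub>R exp (- \<delta> * s))"
    by (subst integral_restrict_space) auto
  also have "\<dots> = 1 / \<delta>"
    using set_lebesgue_integral_eq_integral(2)[OF A] I
    by (simp add: set_lebesgue_integral_def integral_unique)
  finally show "(LINT s|Rplus. exp (- \<delta> * s)) = 1 / \<delta>" .
qed

text \<open>Exchanging the integrals leaves the tail integral e^(-\<delta> r)/\<delta> of the
  weight. This is integration by parts for g' = - \<delta> g against a primitive that vanishes at 0,
  in a form without a boundary term at infinity.\<close>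

lemma exp_weight_Fubini:
  fixes f :: "real \<Rightarrow> 'b::{banach, second_countable_topology}"
  assumes \<delta>: "\<delta> > 0" and f [measurable]: "f \<in> borel_measurable Rplus"
    and int: "integrable Rplus (\<lambda>s. exp (- \<delta> * s) *\<^sub>R f s)"
  shows "(LINT s|Rplus. exp (- \<delta> * s) *\<^sub>R (LINT r|Rplus. indicator {..s} r *\<^sub>R f r))
       = (1 / \<delta>) *\<^sub>R (LINT s|Rplus. exp (- \<delta> * s) *\<^sub>R f s)"
proof -
  define h where "h = (\<lambda>r s. (indicator {..s} r * exp (- \<delta> * s)) *\<^sub>R f r)"
  \<comment> \<open>Rewritten as a comparison of the two coordinates, the triangle is visibly
    measurable in the product space.\<close>
  have "(\<lambda>(r::real, s). indicator {..s} r :: real) = (\<lambda>x. if fst x \<le> snd x then 1 else 0)"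
    by (auto simp: indicator_def fun_eq_iff)
  then have [measurable]: "(\<lambda>(r, s). indicator {..s} r :: real) \<in> borel_measurable (Rplus \<Otimes>\<^sub>M Rplus)"
    by simp
  have hm: "case_prod h \<in> borel_measurable (Rplus \<Otimes>\<^sub>M Rplus)"
    unfolding h_def by measurable
  have ind: "indicator {..s} r = (indicator {r..} s :: real)" for r s :: real
    by (auto simp: indicator_def)
  \<comment> \<open>Integrating the norms over s first gives back the weighted integrability of
    f.\<close>
  have Ih: "integrable (Rplus \<Otimes>\<^sub>M Rplus) (case_prod h)"
  proof (rule Rplus2.Fubini_integrable[OF hm])
    have e: "(LINT s|Rplus. norm (h r s)) = norm (f r) * (exp (- \<delta> * r) / \<delta>)" if "r > 0" for r
      using exp_tail_integral(2)[OF \<delta> that] by (simp add: h_def ind)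
    have "AE r in Rplus. (LINT s|Rplus. norm (h r s)) = (1 / \<delta>) * norm (exp (- \<delta> * r) *\<^sub>R f r)"
      using AE_Rplus_pos by eventually_elim (use e in \<open>simp add: mult_ac\<close>)
    moreover have "integrable Rplus (\<lambda>r. (1 / \<delta>) * norm (exp (- \<delta> * r) *\<^sub>R f r))"
      by (intro integrable_mult_right integrable_norm int)
    ultimately show "integrable Rplus (\<lambda>r. LINT s|Rplus. norm (case (r, s) of (r, s) \<Rightarrow> h r s))"
      using hm by (subst integrable_cong_AE) (auto intro!: Rplus.borel_measurable_lebesgue_integral)
    have e': "integrable Rplus (\<lambda>s. (indicator {r..} s * exp (- \<delta> * s)) *\<^sub>R f r)" if "r > 0" for r
      by (intro integrable_scaleR_left exp_tail_integral \<delta> that)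
    show "AE r in Rplus. integrable Rplus (\<lambda>s. case (r, s) of (r, s) \<Rightarrow> h r s)"
      using AE_Rplus_pos by eventually_elim (use e' in \<open>simp add: h_def ind\<close>)
  qed
  have "(LINT s|Rplus. exp (- \<delta> * s) *\<^sub>R (LINT r|Rplus. indicator {..s} r *\<^sub>R f r)) = (LINT s|Rplus. LINT r|Rplus. h r s)"
    unfolding h_def by (simp add: mult.commute[of "indicator _ _"] flip: scaleR_scaleR)
  also have "\<dots> = (LINT r|Rplus. LINT s|Rplus. h r s)"
    by (rule Rplus2.Fubini_integral[OF Ih])
  also have "\<dots> = (LINT r|Rplus. (1 / \<delta>) *\<^sub>R exp (- \<delta> * r) *\<^sub>R f r)"
  proof (rule integral_cong_AE)
    show "(\<lambda>r. LINT s|Rplus. h r s) \<in> borel_measurable Rplus"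
      by (rule Rplus.borel_measurable_lebesgue_integral[OF hm])
    have e: "(LINT s|Rplus. h r s) = (1 / \<delta>) *\<^sub>R exp (- \<delta> * r) *\<^sub>R f r" if "r > 0" for r
    proof -
      have "(LINT s|Rplus. h r s) = (LINT s|Rplus. indicator {r..} s * exp (- \<delta> * s)) *\<^sub>R f r"
        unfolding h_def ind by (rule integral_scaleR_left) (rule exp_tail_integral[OF \<delta> that])
      then show ?thesis using exp_tail_integral(2)[OF \<delta> that] by simp
    qed
    show "AE r in Rplus. (LINT s|Rplus. h r s) = (1 / \<delta>) *\<^sub>R exp (- \<delta> * r) *\<^sub>R f r"
      using AE_Rplus_pos by eventually_elim (rule e)
  qed measurable
  finally show ?thesis by (simp only: integral_scaleR_right)
qed

text \<open>Symmetry: the square \<open>{..s} \<times> {..s}\<close> is cut along its diagonal, a null set.\<close>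

lemma norm_integral_square:
  fixes W :: "real \<Rightarrow> 'h::separable_chilbert_space" and s :: real
  defines "Y \<equiv> \<lambda>r. LINT r'|Rplus. indicator {..r} r' *\<^sub>R W r'"
  assumes W [measurable]: "W \<in> borel_measurable Rplus"
    and int: "integrable Rplus (\<lambda>r. indicator {..s} r *\<^sub>R W r)"
  shows "(norm (Y s))\<^sup>2 = (LINT r|Rplus. indicator {..s} r * (2 * Re (cinner (W r) (Y r))))"
    and "integrable Rplus (\<lambda>r. indicator {..s} r * (2 * Re (cinner (W r) (Y r))))"
proof -
  \<comment> \<open>Truncation at s makes W integrable on the half line, so that the product of the
    norms is integrable on the plane and dominates both integrands below.\<close>
  define V where "V = (\<lambda>r. indicator {..s} r *\<^sub>R W r)"
  define L where "L = (\<lambda>(r::real, r'). if r' \<le> r then 1 else 0 :: real)"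
  define G where "G = (\<lambda>r r'. Re (cinner (V r) (V r')))"
  have [measurable]: "V \<in> borel_measurable Rplus" unfolding V_def by measurable
  have Vi: "integrable Rplus V" using int by (simp add: V_def)
  have Lm [measurable]: "L \<in> borel_measurable (Rplus \<Otimes>\<^sub>M Rplus)"
    unfolding L_def by measurable
  have Gm [measurable]: "case_prod G \<in> borel_measurable (Rplus \<Otimes>\<^sub>M Rplus)"
    unfolding G_def by measurable
  have bl: "bounded_linear (\<lambda>y. Re (cinner x y))" for x :: 'h
    by (rule bounded_linear_compose[OF bounded_linear_Re bounded_linear_cinner_right])
  have bl': "bounded_linear (\<lambda>y. Re (cinner y x))" for x :: 'h
    by (rule bounded_linear_compose[OF bounded_linear_Re bounded_linear_cinner_left])
  have bound: "integrable (Rplus \<Otimes>\<^sub>M Rplus) (\<lambda>x. norm (V (fst x)) * norm (V (snd x)))"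
  proof (rule Rplus2.Fubini_integrable)
    show "integrable Rplus (\<lambda>x. LINT y|Rplus. norm (norm (V (fst (x, y))) * norm (V (snd (x, y)))))"
      using Vi by simp
    show "AE x in Rplus. integrable Rplus (\<lambda>y. norm (V (fst (x, y))) * norm (V (snd (x, y))))"
      using Vi by simp
  qed measurable
  have G_le: "\<bar>G r r'\<bar> \<le> norm (V r) * norm (V r')" for r r'
    unfolding G_def by (meson abs_Re_le_cmod cinner_Cauchy_Schwarz order_trans)
  have Gi: "integrable (Rplus \<Otimes>\<^sub>M Rplus) (\<lambda>(r, r'). G r r')"
    by (rule Bochner_Integration.integrable_bound[OF bound]) (auto simp: G_le)
  have Ki: "integrable (Rplus \<Otimes>\<^sub>M Rplus) (\<lambda>(r, r'). L (r, r') * G r r')"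
    by (rule Bochner_Integration.integrable_bound[OF bound]) (use G_le in \<open>auto simp: L_def\<close>)
  have Yr: "LINT r'|Rplus. L (r, r') * G r r' = indicator {..s} r * Re (cinner (W r) (Y r))" for r
  proof (cases "r \<le> s")
    case True
    have "indicator {..s} r' * (indicator {..r} r' :: real) = indicator {..r} r'" for r' :: real
      using True by (auto simp: indicator_def)
    then have e: "(indicator {..r} r' :: real) *\<^sub>R V r' = indicator {..r} r' *\<^sub>R W r'" for r'
      by (simp add: V_def mult.commute)
    have "integrable Rplus (\<lambda>r'. (indicator {..r} r' :: real) *\<^sub>R V r')"
      using Vi by (rule Bochner_Integration.integrable_bound) (auto simp: indicator_def)
    then have i: "integrable Rplus (\<lambda>r'. (indicator {..r} r' :: real) *\<^sub>R W r')" by (simp only: e)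
    have "L (r, r') * G r r' = Re (cinner (W r) (indicator {..r} r' *\<^sub>R W r'))" for r'
      using True by (auto simp: L_def G_def V_def indicator_def)
    then have "LINT r'|Rplus. L (r, r') * G r r' = LINT r'|Rplus. Re (cinner (W r) (indicator {..r} r' *\<^sub>R W r'))"
      by simp
    also have "\<dots> = Re (cinner (W r) (Y r))"
      unfolding Y_def by (rule integral_bounded_linear[OF bl i])
    finally show ?thesis using True by simp
  qed (simp add: G_def V_def)
  have "(norm (Y s))\<^sup>2 = Re (cinner (Y s) (Y s))" by (simp add: Re_cinner_self)
  also have "\<dots> = (LINT r|Rplus. Re (cinner (V r) (Y s)))"
    unfolding Y_def V_def[symmetric] by (rule integral_bounded_linear[OF bl' Vi, symmetric])
  also have "\<dots> = (LINT r|Rplus. LINT r'|Rplus. G r r')"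
    unfolding Y_def V_def[symmetric] G_def
    by (subst integral_bounded_linear[OF bl Vi]) simp
  also have "\<dots> = integral\<^sup>L (Rplus \<Otimes>\<^sub>M Rplus) (\<lambda>(r, r'). G r r')"
    by (rule Rplus2.integral_fst[OF Gi])
  also have "\<dots> = integral\<^sup>L (Rplus \<Otimes>\<^sub>M Rplus) (\<lambda>(r, r'). L (r, r') * G r r')
      + integral\<^sup>L (Rplus \<Otimes>\<^sub>M Rplus) (\<lambda>(r, r'). (1 - L (r, r')) * G r r')"
    using Gi Ki by (subst Bochner_Integration.integral_add[symmetric])
      (auto simp: case_prod_beta' left_diff_distrib)
  also have "integral\<^sup>L (Rplus \<Otimes>\<^sub>M Rplus) (\<lambda>(r, r'). (1 - L (r, r')) * G r r')
      = (LINT r'|Rplus. LINT r|Rplus. (1 - L (r, r')) * G r r')"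
    using Gi Ki by (intro Rplus2.integral_snd[symmetric]) (auto simp: case_prod_beta' left_diff_distrib)
  also have "\<dots> = (LINT r'|Rplus. LINT r|Rplus. L (r', r) * G r' r)"
  proof (rule Bochner_Integration.integral_cong[OF refl], rule integral_cong_AE)
    fix r' assume [measurable]: "r' \<in> space Rplus"
    have "negligible {r'}" by simp
    then have "AE r in lebesgue. r \<noteq> r'"
      by (intro AE_I'[of "{r'}"]) (auto simp: negligible_iff_null_sets)
    then have "AE r in Rplus. r \<noteq> r'" by (subst AE_restrict_space_iff) auto
    then show "AE r in Rplus. (1 - L (r, r')) * G r r' = L (r', r) * G r' r"
      by eventually_elim (auto simp: L_def G_def Re_cinner_commute)
  qed measurable
  also have "\<dots> = integral\<^sup>L (Rplus \<Otimes>\<^sub>M Rplus) (\<lambda>(r, r'). L (r, r') * G r r')"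
    by (rule Rplus2.integral_fst[OF Ki])
  also have "integral\<^sup>L (Rplus \<Otimes>\<^sub>M Rplus) (\<lambda>(r, r'). L (r, r') * G r r') = (LINT r|Rplus. indicator {..s} r * Re (cinner (W r) (Y r)))"
    using Rplus2.integral_fst[OF Ki] by (simp add: Yr)
  finally show "(norm (Y s))\<^sup>2 = (LINT r|Rplus. indicator {..s} r * (2 * Re (cinner (W r) (Y r))))"
    by (simp add: mult.left_commute)
  have "integrable Rplus (\<lambda>r. LINT r'|Rplus. L (r, r') * G r r')"
    using Rplus2.integrable_fst[OF Ki] by simp
  then show "integrable Rplus (\<lambda>r. indicator {..s} r * (2 * Re (cinner (W r) (Y r))))"
    by (simp add: Yr mult.left_commute)
qed

section \<open>Fractional powers\<close>

locale coercive_system =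
  fixes P :: "'h::separable_chilbert_space memory_system" and \<delta> \<kappa> :: real
  assumes adm: "admissible P" and \<delta>: "\<delta> > 0" and kern: "kern P = (\<lambda>s. exp (- \<delta> * s))"
    and \<kappa>: "\<kappa> > 0"
    and coercive: "u \<in> dom_pow P (1/2) \<Longrightarrow> u \<noteq> 0 \<Longrightarrow>
      alpha1 P * (norm (op_pow P (1/2) u))\<^sup>2 - zeta P * (norm (op_pow P (par_a P / 2) u))\<^sup>2
        > \<kappa> * (norm (op_pow P (1/2) u))\<^sup>2"
begin

abbreviation "\<xi> \<equiv> eigval P"
abbreviation "\<Psi> \<equiv> eigvec P"
abbreviation "a \<equiv> par_a P"
abbreviation "\<rho> \<equiv> par_rho P"
abbreviation "\<mu> \<equiv> par_mu P"
abbreviation "\<alpha> \<equiv> par_alpha P"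
abbreviation "\<beta> \<equiv> par_beta P"
abbreviation "\<gamma> \<equiv> par_gamma P"
abbreviation "\<alpha>\<^sub>1 \<equiv> alpha1 P"
abbreviation "Dp \<equiv> dom_pow P"
abbreviation "pw \<equiv> op_pow P"

sublocale hilbert_basis "eigvec P"
  using adm by unfold_locales (simp add: admissible_def)

lemma params: "0 \<le> a" "a < 1" "\<rho> > 0" "\<mu> > 0" "\<alpha> > 0" "\<beta> > 0" "\<gamma> > 0" "\<alpha>\<^sub>1 > 0"
  using adm by (auto simp: admissible_def)

lemma \<xi>0: "\<xi> 0 > 0" and \<xi>_mono: "\<xi> 0 \<le> \<xi> k" and \<xi>_pos: "\<xi> k > 0"
  and \<xi>_lim: "filterlim \<xi> at_top sequentially"
proof -
  show 1: "\<xi> 0 > 0" "filterlim \<xi> at_top sequentially" using adm by (auto simp: admissible_def)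
  have "strict_mono \<xi>" using adm by (auto simp: admissible_def)
  then show "\<xi> 0 \<le> \<xi> k" by (simp add: strict_mono_less_eq)
  then show "\<xi> k > 0" using 1 by linarith
qed

lemma zeta: "zeta P = 1 / \<delta>"
  unfolding zeta_def kern using exp_integral[OF \<delta>] by simp

lemma powr_square: "(cmod (complex_of_real (\<xi> k powr \<theta>) * c))\<^sup>2 = \<xi> k powr (2 * \<theta>) * (cmod c)\<^sup>2"
  by (simp add: norm_mult power_mult_distrib power2_eq_square[of "_ powr _"] flip: powr_add)

lemma dom_powD: "f \<in> Dp \<theta> \<Longrightarrow> summable (\<lambda>k. (cmod (complex_of_real (\<xi> k powr \<theta>) * cf k f))\<^sup>2)"
  by (simp add: dom_pow_def powr_square)

lemma cf_pw: "f \<in> Dp \<theta> \<Longrightarrow> cf k (pw \<theta> f) = complex_of_real (\<xi> k powr \<theta>) * cf k f"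
  unfolding op_pow_def by (rule riesz_fischer(2)[OF dom_powD])

lemma norm_pw: "f \<in> Dp \<theta> \<Longrightarrow> (\<lambda>k. \<xi> k powr (2 * \<theta>) * (cmod (cf k f))\<^sup>2) sums (norm (pw \<theta> f))\<^sup>2"
  using parseval_norm[of "pw \<theta> f"] by (simp add: cf_pw powr_square)

text \<open>A candidate y for A^\<theta> f is its own proof of membership: Parseval for y is the
  summability that the domain asks for. The algebraic rules below follow by naming the
  value.\<close>

lemma dom_powI:
  assumes "\<And>k. cf k y = complex_of_real (\<xi> k powr \<theta>) * cf k f"
  shows "f \<in> Dp \<theta>" and "pw \<theta> f = y"
proof -
  show D: "f \<in> Dp \<theta>"
    using sums_summable[OF parseval_norm[of y]] by (simp add: dom_pow_def assms powr_square)
  show "pw \<theta> f = y" by (rule eq_from_cf) (simp add: cf_pw[OF D] assms)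
qed

lemma dom_pow_add: assumes "f \<in> Dp \<theta>" "g \<in> Dp \<theta>"
  shows "f + g \<in> Dp \<theta>" "pw \<theta> (f + g) = pw \<theta> f + pw \<theta> g"
  by (rule dom_powI[where y = "pw \<theta> f + pw \<theta> g"]; simp add: cf_pw assms cinner_simps distrib_left)+

lemma dom_pow_diff: assumes "f \<in> Dp \<theta>" "g \<in> Dp \<theta>"
  shows "f - g \<in> Dp \<theta>" "pw \<theta> (f - g) = pw \<theta> f - pw \<theta> g"
  by (rule dom_powI[where y = "pw \<theta> f - pw \<theta> g"]; simp add: cf_pw assms cinner_simps right_diff_distrib)+

lemma dom_pow_scaleC: assumes "f \<in> Dp \<theta>"
  shows "c *\<^sub>C f \<in> Dp \<theta>" "pw \<theta> (c *\<^sub>C f) = c *\<^sub>C pw \<theta> f"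
  by (rule dom_powI[where y = "c *\<^sub>C pw \<theta> f"]; simp add: cf_pw assms cinner_simps)+

lemma dom_pow_zero: "0 \<in> Dp \<theta>" "pw \<theta> 0 = 0"
  by (rule dom_powI[where y = "0"]; simp)+

lemma dom_pow_basis: "\<Psi> k \<in> Dp \<theta>" "pw \<theta> (\<Psi> k) = (\<xi> k powr \<theta>) *\<^sub>R \<Psi> k"
  by (rule dom_powI[where y = "(\<xi> k powr \<theta>) *\<^sub>R \<Psi> k"]; simp add: cinner_simps orthonormal)+

text \<open>The quotient of the two weights is largest at the lowest eigenvalue, the exponent
  \<theta> - \<theta>' being nonpositive.\<close>

lemma dom_pow_mono: assumes f: "f \<in> Dp \<theta>'" and le: "\<theta> \<le> \<theta>'" shows "f \<in> Dp \<theta>"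
  and "(norm (pw \<theta> f))\<^sup>2 \<le> \<xi> 0 powr (2 * (\<theta> - \<theta>')) * (norm (pw \<theta>' f))\<^sup>2"
proof -
  have le': "\<xi> k powr (2 * \<theta>) * (cmod (cf k f))\<^sup>2 \<le> \<xi> 0 powr (2 * (\<theta> - \<theta>')) * (\<xi> k powr (2 * \<theta>') * (cmod (cf k f))\<^sup>2)" for k
  proof -
    have "\<xi> k powr (2 * \<theta>) = \<xi> k powr (2 * (\<theta> - \<theta>')) * \<xi> k powr (2 * \<theta>')"
      by (simp add: algebra_simps flip: powr_add)
    also have "\<xi> k powr (2 * (\<theta> - \<theta>')) \<le> \<xi> 0 powr (2 * (\<theta> - \<theta>'))"
      by (rule powr_mono2') (use \<xi>0 \<xi>_mono le in auto)
    finally have "\<xi> k powr (2 * \<theta>) \<le> \<xi> 0 powr (2 * (\<theta> - \<theta>')) * \<xi> k powr (2 * \<theta>')"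
      by (simp add: mult_right_mono)
    then show ?thesis by (simp add: mult_right_mono flip: mult.assoc)
  qed
  have S: "(\<lambda>k. \<xi> 0 powr (2 * (\<theta> - \<theta>')) * (\<xi> k powr (2 * \<theta>') * (cmod (cf k f))\<^sup>2)) sums
      (\<xi> 0 powr (2 * (\<theta> - \<theta>')) * (norm (pw \<theta>' f))\<^sup>2)"
    by (rule sums_mult[OF norm_pw[OF f]])
  show D: "f \<in> Dp \<theta>"
    unfolding dom_pow_def mem_Collect_eq
    by (rule summable_comparison_test'[OF sums_summable[OF S], of 0]) (use le' in simp)
  show "(norm (pw \<theta> f))\<^sup>2 \<le> \<xi> 0 powr (2 * (\<theta> - \<theta>')) * (norm (pw \<theta>' f))\<^sup>2"
    by (rule sums_le[OF le' norm_pw[OF D] S])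
qed

lemma dom_pow_0: "f \<in> Dp 0" "pw 0 f = f"
proof -
  have "\<xi> k powr 0 = 1" for k using \<xi>_pos[of k] by simp
  then show "f \<in> Dp 0" "pw 0 f = f" by (auto intro!: dom_powI[where y = f])
qed

text \<open>Powers of A act on coefficients as real factors, so only the total exponent on the two
  sides of the inner product matters.\<close>

lemma pw_inner_shift:
  assumes "f \<in> Dp s" "f \<in> Dp s'" "g \<in> Dp r" "g \<in> Dp r'" "s + r = s' + r'"
  shows "cinner (pw s f) (pw r g) = cinner (pw s' f) (pw r' g)"
proof -
  have "\<xi> k powr s * \<xi> k powr r = \<xi> k powr s' * \<xi> k powr r'" for k
    using assms(5) by (simp flip: powr_add)
  then have "cf k (pw s f) * cnj (cf k (pw r g)) = cf k (pw s' f) * cnj (cf k (pw r' g))" for k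
    using assms by (simp add: cf_pw mult_ac) (metis mult.assoc of_real_mult)
  then show ?thesis
    using parseval[of "pw s f" "pw r g"] parseval[of "pw s' f" "pw r' g"] by (simp add: sums_unique2)
qed

text \<open>Self-adjointness tested on the eigenvectors gives the coefficients of A f, and with them
  the agreement of A with its spectral first power on its domain.\<close>

lemma domA: assumes "f \<in> domA P" shows "f \<in> Dp 1" "pw 1 f = opA P f"
  and cf_opA: "cf k (opA P f) = \<xi> k * cf k f"
proof -
  have sa: "self_adjoint (domA P) (opA P)" and ev: "\<And>k. \<Psi> k \<in> domA P \<and> opA P (\<Psi> k) = \<xi> k *\<^sub>R \<Psi> k"
    using adm by (auto simp: admissible_def)
  have c: "cf k (opA P f) = \<xi> k * cf k f" for k
  proof -
    have "cinner (opA P (\<Psi> k)) f = cinner (\<Psi> k) (opA P f)"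
      using sa ev assms unfolding self_adjoint_def by blast
    then have "cinner (\<Psi> k) (opA P f) = \<xi> k * cinner (\<Psi> k) f"
      using ev by (simp add: cinner_simps)
    then show ?thesis
      by (metis cinner_commute complex_cnj_complex_of_real complex_cnj_mult)
  qed
  then show "cf k (opA P f) = \<xi> k * cf k f" .
  show "f \<in> Dp 1" "pw 1 f = opA P f"
    using \<xi>_pos by (auto intro!: dom_powI[where y = "opA P f"] simp: c powr_one less_imp_le)
qed

text \<open>A^\<theta> is in general unbounded, so continuity is of no help; but
  \<open>op_pow\<close> is a pointwise \<open>suminf\<close> of measurable terms, and such a sum is
  measurable also where the series diverges.\<close>

lemma pw_measurable [measurable (raw)]:
  "w \<in> borel_measurable M \<Longrightarrow> (\<lambda>s. pw \<theta> (w s)) \<in> borel_measurable M"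
proof -
  assume [measurable]: "w \<in> borel_measurable M"
  have [measurable]: "(\<lambda>c. c *\<^sub>C \<Psi> k) \<in> borel_measurable borel" for k
    by (intro borel_measurable_continuous_onI linear_continuous_on bounded_linear_scaleC_left)
  have "(\<lambda>s. (complex_of_real (\<xi> k powr \<theta>) * cf k (w s)) *\<^sub>C \<Psi> k) \<in> borel_measurable M" for k
    by (rule measurable_compose[of _ _ _ "\<lambda>c. c *\<^sub>C \<Psi> k"]) measurable
  then show ?thesis unfolding op_pow_def by (rule borel_measurable_suminf)
qed

lemma coercive_le:
  "v \<in> Dp (1/2) \<Longrightarrow> \<kappa> * (norm (pw (1/2) v))\<^sup>2 \<le> \<alpha>\<^sub>1 * (norm (pw (1/2) v))\<^sup>2 - 1 / \<delta> * (norm (pw (a/2) v))\<^sup>2"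
  using coercive[of v] zeta by (cases "v = 0") (auto simp: dom_pow_zero)

lemma coercive_mode: "\<kappa> * \<xi> k \<le> (\<alpha> - \<gamma>\<^sup>2 * \<beta>) * \<xi> k - \<xi> k powr a / \<delta>"
  using coercive_le[OF dom_pow_basis(1)[of k]] \<xi>_pos[of k] powr_half_sqrt
  by (simp add: dom_pow_basis(2) power2_eq_square alpha1_def flip: powr_add)

section \<open>The memory space\<close>

abbreviation "g \<equiv> (\<lambda>s::real. exp (- \<delta> * s))"
abbreviation "Ah \<equiv> pw (a / 2)"

lemma weighted_bilinear_integrable:
  fixes f h :: "real \<Rightarrow> 'h" and B :: "'h \<Rightarrow> 'h \<Rightarrow> 'c::{banach, second_countable_topology}"
  assumes [measurable]: "f \<in> borel_measurable Rplus" "h \<in> borel_measurable Rplus"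
    and m: "(\<lambda>s. B (f s) (h s)) \<in> borel_measurable Rplus"
    and f: "integrable Rplus (\<lambda>s. g s * (norm (f s))\<^sup>2)" and h: "integrable Rplus (\<lambda>s. g s * (norm (h s))\<^sup>2)"
    and B: "\<And>x y. norm (B x y) \<le> norm x * norm y"
  shows "integrable Rplus (\<lambda>s. g s *\<^sub>R B (f s) (h s))"
proof (rule Bochner_Integration.integrable_bound[OF Bochner_Integration.integrable_add[OF f h]])
  show "(\<lambda>s. g s *\<^sub>R B (f s) (h s)) \<in> borel_measurable Rplus"
    using m by measurable
  show "AE s in Rplus. norm (g s *\<^sub>R B (f s) (h s)) \<le> norm (g s * (norm (f s))\<^sup>2 + g s * (norm (h s))\<^sup>2)"
  proof (rule AE_I2)
    fix s
    have "norm (B (f s) (h s)) \<le> (norm (f s))\<^sup>2 + (norm (h s))\<^sup>2"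
    proof -
      have "norm (f s) * norm (h s) \<le> (norm (f s))\<^sup>2 + (norm (h s))\<^sup>2"
      proof -
        have "0 \<le> norm (f s) * norm (h s)" by simp
        then show ?thesis using sum_squares_bound[of "norm (f s)" "norm (h s)"] by linarith
      qed
      then show ?thesis using B[of "f s" "h s"] by linarith
    qed
    then have "g s * norm (B (f s) (h s)) \<le> g s * ((norm (f s))\<^sup>2 + (norm (h s))\<^sup>2)" by (intro mult_left_mono) auto
    then show "norm (g s *\<^sub>R B (f s) (h s)) \<le> norm (g s * (norm (f s))\<^sup>2 + g s * (norm (h s))\<^sup>2)"
      by (simp add: distrib_left)
  qed
qed

lemma mem_spaceD:
  assumes "w \<in> mem_space P"
  shows "w \<in> borel_measurable Rplus" "AE s in Rplus. w s \<in> Dp (a / 2)"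
    "integrable Rplus (\<lambda>s. g s * (norm (Ah (w s)))\<^sup>2)"
  using assms by (auto simp: mem_space_def kern)

lemma mem_spaceI:
  assumes "w \<in> borel_measurable Rplus" "AE s in Rplus. w s \<in> Dp (a / 2)"
    "integrable Rplus (\<lambda>s. g s * (norm (Ah (w s)))\<^sup>2)"
  shows "w \<in> mem_space P"
  using assms by (auto simp: mem_space_def kern)

lemma mem_Ah_measurable: "w \<in> mem_space P \<Longrightarrow> (\<lambda>s. Ah (w s)) \<in> borel_measurable Rplus"
  by (rule pw_measurable) (rule mem_spaceD)

text \<open>The real part suffices for the energy computations and makes the forms below real
  bilinear.\<close>

definition memory_inner :: "(real \<Rightarrow> 'h) \<Rightarrow> (real \<Rightarrow> 'h) \<Rightarrow> real" where
  "memory_inner \<eta> w = (LINT s|Rplus. g s * Re (cinner (Ah (\<eta> s)) (Ah (w s))))"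

lemma cinner_Ah_integrable:
  assumes "\<eta> \<in> mem_space P" "w \<in> mem_space P"
  shows "integrable Rplus (\<lambda>s. g s * cinner (Ah (\<eta> s)) (Ah (w s)))"
  using weighted_bilinear_integrable[of "\<lambda>s. Ah (\<eta> s)" "\<lambda>s. Ah (w s)" cinner]
    mem_spaceD[OF assms(1)] mem_spaceD[OF assms(2)] mem_Ah_measurable[OF assms(1)] mem_Ah_measurable[OF assms(2)]
  by (simp add: scaleR_conv_of_real cinner_Cauchy_Schwarz borel_measurable_cinner)

lemma memory_inner_integrable:
  assumes "\<eta> \<in> mem_space P" "w \<in> mem_space P"
  shows "integrable Rplus (\<lambda>s. g s * Re (cinner (Ah (\<eta> s)) (Ah (w s))))"
  using integrable_Re[OF cinner_Ah_integrable[OF assms]] by simp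

lemma mem_add:
  assumes "\<eta> \<in> mem_space P" "w \<in> mem_space P"
  shows "(\<lambda>s. \<eta> s + w s) \<in> mem_space P" and "AE s in Rplus. Ah (\<eta> s + w s) = Ah (\<eta> s) + Ah (w s)"
proof -
  note [measurable] = mem_spaceD(1)[OF assms(1)] mem_spaceD(1)[OF assms(2)]
  show eq: "AE s in Rplus. Ah (\<eta> s + w s) = Ah (\<eta> s) + Ah (w s)"
    using mem_spaceD(2)[OF assms(1)] mem_spaceD(2)[OF assms(2)] by eventually_elim (rule dom_pow_add)
  show "(\<lambda>s. \<eta> s + w s) \<in> mem_space P"
  proof (rule mem_spaceI)
    show "AE s in Rplus. \<eta> s + w s \<in> Dp (a / 2)"
      using mem_spaceD(2)[OF assms(1)] mem_spaceD(2)[OF assms(2)] by eventually_elim (rule dom_pow_add)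
    have i: "integrable Rplus (\<lambda>s. g s * (norm (Ah (\<eta> s)))\<^sup>2 + 2 * (g s * Re (cinner (Ah (\<eta> s)) (Ah (w s)))) + g s * (norm (Ah (w s)))\<^sup>2)"
      by (intro Bochner_Integration.integrable_add integrable_mult_right mem_spaceD memory_inner_integrable assms)
    have e: "AE s in Rplus. g s * (norm (Ah (\<eta> s)))\<^sup>2 + 2 * (g s * Re (cinner (Ah (\<eta> s)) (Ah (w s)))) + g s * (norm (Ah (w s)))\<^sup>2
        = g s * (norm (Ah (\<eta> s + w s)))\<^sup>2"
      using eq by eventually_elim (simp add: norm_add_cinner distrib_left)
    show "integrable Rplus (\<lambda>s. g s * (norm (Ah (\<eta> s + w s)))\<^sup>2)"
      by (rule integrable_cong_AE_imp[OF i _ e]) measurable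
  qed measurable
qed

lemma mem_scale:
  assumes "\<eta> \<in> mem_space P"
  shows "(\<lambda>s. c *\<^sub>C \<eta> s) \<in> mem_space P" and "AE s in Rplus. Ah (c *\<^sub>C \<eta> s) = c *\<^sub>C Ah (\<eta> s)"
proof -
  note [measurable] = mem_spaceD(1)[OF assms]
  have [measurable]: "(\<lambda>x::'h. c *\<^sub>C x) \<in> borel_measurable borel"
    by (intro borel_measurable_continuous_onI linear_continuous_on bounded_linear_scaleC_right)
  show eq: "AE s in Rplus. Ah (c *\<^sub>C \<eta> s) = c *\<^sub>C Ah (\<eta> s)"
    using mem_spaceD(2)[OF assms] by eventually_elim (rule dom_pow_scaleC)
  show "(\<lambda>s. c *\<^sub>C \<eta> s) \<in> mem_space P"
  proof (rule mem_spaceI)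
    show m: "(\<lambda>s. c *\<^sub>C \<eta> s) \<in> borel_measurable Rplus"
      by (rule measurable_compose[of _ _ _ "\<lambda>x. c *\<^sub>C x"]) measurable
    note [measurable] = m
    show "AE s in Rplus. c *\<^sub>C \<eta> s \<in> Dp (a / 2)"
      using mem_spaceD(2)[OF assms] by eventually_elim (rule dom_pow_scaleC)
    have i: "integrable Rplus (\<lambda>s. (cmod c)\<^sup>2 * (g s * (norm (Ah (\<eta> s)))\<^sup>2))"
      by (intro integrable_mult_right mem_spaceD assms)
    have e: "AE s in Rplus. (cmod c)\<^sup>2 * (g s * (norm (Ah (\<eta> s)))\<^sup>2) = g s * (norm (Ah (c *\<^sub>C \<eta> s)))\<^sup>2"
      using eq by eventually_elim (simp add: norm_scaleC power_mult_distrib mult_ac)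
    show "integrable Rplus (\<lambda>s. g s * (norm (Ah (c *\<^sub>C \<eta> s)))\<^sup>2)"
      by (rule integrable_cong_AE_imp[OF i _ e]) measurable
  qed
qed

lemma mem_const: "u \<in> Dp (a / 2) \<Longrightarrow> (\<lambda>s. u) \<in> mem_space P"
  by (rule mem_spaceI) (use exp_integral[OF \<delta>] in auto)

lemma mem_diff:
  assumes "\<eta> \<in> mem_space P" "w \<in> mem_space P"
  shows "(\<lambda>s. \<eta> s - w s) \<in> mem_space P" and "AE s in Rplus. Ah (\<eta> s - w s) = Ah (\<eta> s) - Ah (w s)"
proof -
  show "(\<lambda>s. \<eta> s - w s) \<in> mem_space P"
    using mem_add(1)[OF assms(1) mem_scale(1)[OF assms(2), of "-1"]] by (simp add: scaleC_minus1)
  show "AE s in Rplus. Ah (\<eta> s - w s) = Ah (\<eta> s) - Ah (w s)"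
    using mem_spaceD(2)[OF assms(1)] mem_spaceD(2)[OF assms(2)] by eventually_elim (rule dom_pow_diff)
qed

lemma memory_inner_cong:
  assumes [measurable]: "\<eta> \<in> borel_measurable Rplus" "\<eta>' \<in> borel_measurable Rplus" "w \<in> borel_measurable Rplus"
    and "AE s in Rplus. \<eta> s = \<eta>' s"
  shows "memory_inner \<eta> w = memory_inner \<eta>' w"
  unfolding memory_inner_def
proof (rule integral_cong_AE)
  show "AE s in Rplus. g s * Re (cinner (Ah (\<eta> s)) (Ah (w s))) = g s * Re (cinner (Ah (\<eta>' s)) (Ah (w s)))"
    using assms(4) by eventually_elim simp
qed measurable

lemma memory_inner_commute: "memory_inner \<eta> w = memory_inner w \<eta>"
  unfolding memory_inner_def by (simp add: Re_cinner_commute[of "Ah (\<eta> _)"])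

lemma memory_inner_nonneg: "memory_inner \<eta> \<eta> \<ge> 0"
  unfolding memory_inner_def by (rule Bochner_Integration.integral_nonneg) (simp add: Re_cinner_self)

lemma memory_inner_add_left:
  assumes "\<eta> \<in> mem_space P" "\<eta>' \<in> mem_space P" "w \<in> mem_space P"
  shows "memory_inner (\<lambda>s. \<eta> s + \<eta>' s) w = memory_inner \<eta> w + memory_inner \<eta>' w"
proof -
  note [measurable] = assms[THEN mem_spaceD(1)]
  have "memory_inner (\<lambda>s. \<eta> s + \<eta>' s) w
    = (LINT s|Rplus. g s * Re (cinner (Ah (\<eta> s)) (Ah (w s))) + g s * Re (cinner (Ah (\<eta>' s)) (Ah (w s))))"
    unfolding memory_inner_def
  proof (rule integral_cong_AE)
    show "AE s in Rplus. g s * Re (cinner (Ah (\<eta> s + \<eta>' s)) (Ah (w s)))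
        = g s * Re (cinner (Ah (\<eta> s)) (Ah (w s))) + g s * Re (cinner (Ah (\<eta>' s)) (Ah (w s)))"
      using mem_add(2)[OF assms(1,2)] by eventually_elim (simp add: cinner_simps distrib_left)
  qed measurable
  also have "\<dots> = memory_inner \<eta> w + memory_inner \<eta>' w"
    unfolding memory_inner_def by (intro Bochner_Integration.integral_add memory_inner_integrable assms)
  finally show ?thesis .
qed

lemma memory_inner_scale_left:
  assumes "\<eta> \<in> mem_space P" "w \<in> mem_space P"
  shows "memory_inner (\<lambda>s. complex_of_real r *\<^sub>C \<eta> s) w = r * memory_inner \<eta> w"
proof -
  note [measurable] = assms[THEN mem_spaceD(1)] mem_scale(1)[OF assms(1), of "complex_of_real r", THEN mem_spaceD(1)]
  have "memory_inner (\<lambda>s. complex_of_real r *\<^sub>C \<eta> s) w = (LINT s|Rplus. r * (g s * Re (cinner (Ah (\<eta> s)) (Ah (w s)))))"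
    unfolding memory_inner_def
  proof (rule integral_cong_AE)
    show "AE s in Rplus. g s * Re (cinner (Ah (complex_of_real r *\<^sub>C \<eta> s)) (Ah (w s))) = r * (g s * Re (cinner (Ah (\<eta> s)) (Ah (w s))))"
      using mem_scale(2)[OF assms(1), of "complex_of_real r"] by eventually_elim (simp add: cinner_simps)
  qed measurable
  then show ?thesis by (simp add: memory_inner_def)
qed

lemma memory_inner_diff_left:
  assumes "\<eta> \<in> mem_space P" "\<eta>' \<in> mem_space P" "w \<in> mem_space P"
  shows "memory_inner (\<lambda>s. \<eta> s - \<eta>' s) w = memory_inner \<eta> w - memory_inner \<eta>' w"
  using memory_inner_add_left[OF assms(1) mem_scale(1)[OF assms(2), of "complex_of_real (-1)"] assms(3)]
    memory_inner_scale_left[OF assms(2,3), of "-1"]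
  by (simp add: scaleC_minus1)

text \<open>The weight has finite mass, so square integrability gives integrability through |x|
  \<le> 1 + |x|^2; on \<open>{..s}\<close> the weight is at least e^(-\<delta> s) and can be removed
  at that price.\<close>

lemma weighted_integrable:
  fixes w :: "real \<Rightarrow> 'h"
  assumes [measurable]: "w \<in> borel_measurable Rplus"
    and i: "integrable Rplus (\<lambda>s. g s * (norm (w s))\<^sup>2)"
  shows "integrable Rplus (\<lambda>s. g s *\<^sub>R w s)" and "integrable Rplus (\<lambda>r. indicator {..s} r *\<^sub>R w r)"
proof -
  have n: "norm x \<le> 1 + (norm x)\<^sup>2" for x :: 'h
  proof -
    have "2 * norm x \<le> 1 + (norm x)\<^sup>2"
      using zero_le_power2[of "norm x - 1"] by (simp add: power2_eq_square algebra_simps)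
    then show ?thesis using norm_ge_zero[of x] by linarith
  qed
  have I: "integrable Rplus (\<lambda>s. g s + g s * (norm (w s))\<^sup>2)"
    by (intro Bochner_Integration.integrable_add exp_integral \<delta> i)
  show "integrable Rplus (\<lambda>s. g s *\<^sub>R w s)"
  proof (rule Bochner_Integration.integrable_bound[OF I])
    show "AE s in Rplus. norm (g s *\<^sub>R w s) \<le> norm (g s + g s * (norm (w s))\<^sup>2)"
      using mult_left_mono[OF n, of "g _" "w _"] by (auto simp: distrib_left)
  qed measurable
  show "integrable Rplus (\<lambda>r. indicator {..s} r *\<^sub>R w r)"
  proof (rule Bochner_Integration.integrable_bound[OF integrable_mult_right[OF I, of "exp (\<delta> * s)"]])
    show "AE r in Rplus. norm (indicator {..s} r *\<^sub>R w r) \<le> norm (exp (\<delta> * s) * (g r + g r * (norm (w r))\<^sup>2))"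
    proof (rule AE_I2)
      fix r :: real
      show "norm (indicator {..s} r *\<^sub>R w r) \<le> norm (exp (\<delta> * s) * (g r + g r * (norm (w r))\<^sup>2))"
      proof (cases "r \<le> s")
        case True
        then have "\<delta> * r \<le> \<delta> * s" using \<delta> by simp
        then have 1: "1 \<le> exp (\<delta> * s) * g r" by (simp flip: exp_add)
        have "norm (w r) \<le> 1 * (1 + (norm (w r))\<^sup>2)" using n by simp
        also have "\<dots> \<le> exp (\<delta> * s) * g r * (1 + (norm (w r))\<^sup>2)" by (intro mult_right_mono 1) auto
        finally show ?thesis using True by (simp add: algebra_simps)
      qed simp
    qed
  qed measurable
qed

text \<open>The spectrum stays away from 0, so the norm of D(A^(a/2)) controls that of H. This makes
  the mean of a memory an integral in H.\<close>

lemma mem_norm_integrable: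
  assumes "w \<in> mem_space P"
  shows "integrable Rplus (\<lambda>s. g s * (norm (w s))\<^sup>2)"
proof (rule Bochner_Integration.integrable_bound[OF integrable_mult_right[OF mem_spaceD(3)[OF assms], of "\<xi> 0 powr (- a)"]])
  note [measurable] = mem_spaceD(1)[OF assms]
  show "(\<lambda>s. g s * (norm (w s))\<^sup>2) \<in> borel_measurable Rplus" by measurable
  show "AE s in Rplus. norm (g s * (norm (w s))\<^sup>2) \<le> norm (\<xi> 0 powr (- a) * (g s * (norm (Ah (w s)))\<^sup>2))"
    using mem_spaceD(2)[OF assms]
  proof eventually_elim
    case (elim s)
    have "(norm (w s))\<^sup>2 \<le> \<xi> 0 powr (- a) * (norm (Ah (w s)))\<^sup>2"
      using dom_pow_mono(2)[OF elim, of 0] params by (simp add: dom_pow_0)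
    then have "g s * (norm (w s))\<^sup>2 \<le> g s * (\<xi> 0 powr (- a) * (norm (Ah (w s)))\<^sup>2)"
      by (intro mult_left_mono) auto
    then show ?case by (simp add: mult_ac)
  qed
qed

lemma mem_integrable:
  assumes "w \<in> mem_space P"
  shows "integrable Rplus (\<lambda>s. g s *\<^sub>R w s)"
  by (rule weighted_integrable[OF mem_spaceD(1)[OF assms] mem_norm_integrable[OF assms]])

section \<open>The weighted mean of a memory\<close>

lemma mem_mean_eq: "mem_mean P w = (LINT s|Rplus. g s *\<^sub>R w s)"
  by (simp add: mem_mean_def kern)

lemma mem_mean_add: "\<eta> \<in> mem_space P \<Longrightarrow> w \<in> mem_space P \<Longrightarrow>
   mem_mean P (\<lambda>s. \<eta> s + w s) = mem_mean P \<eta> + mem_mean P w"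
  unfolding mem_mean_eq scaleR_add_right by (intro Bochner_Integration.integral_add mem_integrable)

lemma mem_mean_diff: "\<eta> \<in> mem_space P \<Longrightarrow> w \<in> mem_space P \<Longrightarrow>
   mem_mean P (\<lambda>s. \<eta> s - w s) = mem_mean P \<eta> - mem_mean P w"
  unfolding mem_mean_eq scaleR_diff_right by (intro Bochner_Integration.integral_diff mem_integrable)

lemma mem_mean_scale: "\<eta> \<in> mem_space P \<Longrightarrow> mem_mean P (\<lambda>s. c *\<^sub>C \<eta> s) = c *\<^sub>C mem_mean P \<eta>"
proof -
  assume "\<eta> \<in> mem_space P"
  have "g s *\<^sub>R c *\<^sub>C \<eta> s = c *\<^sub>C (g s *\<^sub>R \<eta> s)" for s
    by (simp add: scaleR_eq_scaleC scaleC_scaleC mult.commute)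
  then show ?thesis
    unfolding mem_mean_eq
    using integral_bounded_linear[OF bounded_linear_scaleC_right mem_integrable[OF \<open>\<eta> \<in> mem_space P\<close>], of c] by simp
qed

lemma mem_mean_const: "mem_mean P (\<lambda>s. u) = (1 / \<delta>) *\<^sub>R u"
  unfolding mem_mean_eq using integral_scaleR_left[OF exp_integral(1)[OF \<delta>], of u] exp_integral(2)[OF \<delta>] by simp

lemma cf_mem_mean: "w \<in> mem_space P \<Longrightarrow> cf k (mem_mean P w) = (LINT s|Rplus. g s * cf k (w s))"
  unfolding mem_mean_eq
  by (subst integral_bounded_linear[OF bounded_linear_cinner_left mem_integrable, symmetric])
     (simp_all add: cinner_simps)

text \<open>The variance under the probability weight \<delta> g is nonnegative; c is the mean of h
  for that weight.\<close>

lemma jensen_weighted: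
  fixes h :: "real \<Rightarrow> real"
  assumes 1: "integrable Rplus (\<lambda>s. g s * h s)" and 2: "integrable Rplus (\<lambda>s. g s * (h s)\<^sup>2)"
  shows "(LINT s|Rplus. g s * h s)\<^sup>2 \<le> 1 / \<delta> * (LINT s|Rplus. g s * (h s)\<^sup>2)"
proof -
  define I where "I = (LINT s|Rplus. g s * h s)"
  define c where "c = \<delta> * I"
  have "0 \<le> (LINT s|Rplus. g s * (h s - c)\<^sup>2)"
    by (rule Bochner_Integration.integral_nonneg) auto
  also have "(\<lambda>s. g s * (h s - c)\<^sup>2) = (\<lambda>s. g s * (h s)\<^sup>2 - 2 * c * (g s * h s) + c\<^sup>2 * g s)"
    by (auto simp: power2_eq_square algebra_simps)
  also have "(LINT s|Rplus. g s * (h s)\<^sup>2 - 2 * c * (g s * h s) + c\<^sup>2 * g s)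
     = (LINT s|Rplus. g s * (h s)\<^sup>2) - 2 * c * I + c\<^sup>2 * (1 / \<delta>)"
    using 1 2 exp_integral[OF \<delta>] by (simp add: I_def)
  also have "\<dots> = (LINT s|Rplus. g s * (h s)\<^sup>2) - \<delta> * I\<^sup>2"
    using \<delta> by (simp add: c_def power2_eq_square)
  finally show ?thesis using \<delta> by (simp add: I_def field_simps)
qed

text \<open>Jensen in each coefficient, then Bessel for A^(a/2) w(s) under the integral sign. Finite
  sums avoid interchanging a series with the integral.\<close>

lemma mem_mean_bessel:
  assumes w: "w \<in> mem_space P"
  shows "(\<Sum>k<n. \<xi> k powr a * (cmod (cf k (mem_mean P w)))\<^sup>2) \<le> 1 / \<delta> * memory_inner w w"
proof -
  note [measurable] = mem_spaceD(1)[OF w]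
  have bnd: "\<xi> k powr a * (cmod (cf k x))\<^sup>2 \<le> (norm (Ah x))\<^sup>2" and
    bnds: "(\<Sum>k<n. \<xi> k powr a * (cmod (cf k x))\<^sup>2) \<le> (norm (Ah x))\<^sup>2" if "x \<in> Dp (a / 2)" for x k n
  proof -
    have S: "(\<lambda>k. \<xi> k powr a * (cmod (cf k x))\<^sup>2) sums (norm (Ah x))\<^sup>2"
      using norm_pw[OF that] by simp
    show "(\<Sum>k<n. \<xi> k powr a * (cmod (cf k x))\<^sup>2) \<le> (norm (Ah x))\<^sup>2" for n
      using sum_le_suminf[OF sums_summable[OF S], of "{..<n}"] sums_unique[OF S] by simp
    show "\<xi> k powr a * (cmod (cf k x))\<^sup>2 \<le> (norm (Ah x))\<^sup>2"
      using sum_le_suminf[OF sums_summable[OF S], of "{k}"] sums_unique[OF S] by simp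
  qed
  have i2: "integrable Rplus (\<lambda>s. \<xi> k powr a * (g s * (cmod (cf k (w s)))\<^sup>2))" for k
  proof (rule Bochner_Integration.integrable_bound[OF mem_spaceD(3)[OF w]])
    show "AE s in Rplus. norm (\<xi> k powr a * (g s * (cmod (cf k (w s)))\<^sup>2)) \<le> norm (g s * (norm (Ah (w s)))\<^sup>2)"
      using mem_spaceD(2)[OF w]
    proof eventually_elim
      case (elim s)
      then show ?case using mult_left_mono[OF bnd[OF elim, of k], of "g s"] by (simp add: mult_ac)
    qed
  qed measurable
  have i2': "integrable Rplus (\<lambda>s. g s * (cmod (cf k (w s)))\<^sup>2)" for k
    using integrable_mult_right[OF i2[of k], of "1 / \<xi> k powr a"] \<xi>_pos[of k] by simp
  have i1: "integrable Rplus (\<lambda>s. g s * cmod (cf k (w s)))" for k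
    using integrable_norm[OF integrable_bounded_linear[OF bounded_linear_cinner_left[of "\<Psi> k"] mem_integrable[OF w]]]
    by (simp add: cinner_simps norm_mult)
  have "\<xi> k powr a * (cmod (cf k (mem_mean P w)))\<^sup>2 \<le> 1 / \<delta> * (LINT s|Rplus. \<xi> k powr a * (g s * (cmod (cf k (w s)))\<^sup>2))" for k
  proof -
    have "cmod (cf k (mem_mean P w)) \<le> (LINT s|Rplus. norm (g s * cf k (w s)))"
      unfolding cf_mem_mean[OF w] by (rule integral_norm_bound)
    also have "\<dots> = (LINT s|Rplus. g s * cmod (cf k (w s)))" by (simp add: norm_mult)
    finally have "(cmod (cf k (mem_mean P w)))\<^sup>2 \<le> (LINT s|Rplus. g s * cmod (cf k (w s)))\<^sup>2"
      by (rule power_mono) simp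
    also have "\<dots> \<le> 1 / \<delta> * (LINT s|Rplus. g s * (cmod (cf k (w s)))\<^sup>2)"
      by (rule jensen_weighted[OF i1 i2'])
    finally have "\<xi> k powr a * (cmod (cf k (mem_mean P w)))\<^sup>2 \<le> \<xi> k powr a * (1 / \<delta> * (LINT s|Rplus. g s * (cmod (cf k (w s)))\<^sup>2))"
      by (rule mult_left_mono) simp
    then show ?thesis by (simp only: integral_mult_right_zero) (simp only: mult.left_commute)
  qed
  then have "(\<Sum>k<n. \<xi> k powr a * (cmod (cf k (mem_mean P w)))\<^sup>2)
     \<le> (\<Sum>k<n. 1 / \<delta> * (LINT s|Rplus. \<xi> k powr a * (g s * (cmod (cf k (w s)))\<^sup>2)))"
    by (rule sum_mono)
  also have "\<dots> = 1 / \<delta> * (LINT s|Rplus. (\<Sum>k<n. \<xi> k powr a * (g s * (cmod (cf k (w s)))\<^sup>2)))"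
    by (subst Bochner_Integration.integral_sum[OF i2]) (simp add: sum_distrib_left)
  also have "\<dots> \<le> 1 / \<delta> * memory_inner w w"
    unfolding memory_inner_def Re_cinner_self
  proof (intro mult_left_mono integral_mono_AE mem_spaceD w)
    show "AE s in Rplus. (\<Sum>k<n. \<xi> k powr a * (g s * (cmod (cf k (w s)))\<^sup>2)) \<le> g s * (norm (Ah (w s)))\<^sup>2"
      using mem_spaceD(2)[OF w]
    proof eventually_elim
      case (elim s)
      have "(\<Sum>k<n. \<xi> k powr a * (g s * (cmod (cf k (w s)))\<^sup>2)) = g s * (\<Sum>k<n. \<xi> k powr a * (cmod (cf k (w s)))\<^sup>2)"
        by (simp add: sum_distrib_left mult_ac)
      also have "\<dots> \<le> g s * (norm (Ah (w s)))\<^sup>2" by (intro mult_left_mono bnds elim) auto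
      finally show ?case .
    qed
  qed (use \<delta> i2 in auto)
  finally show ?thesis .
qed

section \<open>The derivative in the memory variable\<close>

lemma has_mem_derivD:
  assumes "has_mem_deriv P \<eta> w"
  shows "w \<in> mem_space P" "AE s in Rplus. \<eta> s = (LINT r|Rplus. indicator {..s} r *\<^sub>R w r)"
proof -
  show "w \<in> mem_space P" using assms by (simp add: has_mem_deriv_def)
  have side: "{0::real<..} \<inter> space lebesgue \<in> sets lebesgue" by simp
  have "(LINT r:{0<..s}|lebesgue. w r) = (LINT r|Rplus. indicator {..s} r *\<^sub>R w r)" for s
  proof -
    have "(\<lambda>r. indicator {0<..s} r *\<^sub>R w r) = (\<lambda>r. indicator {0<..} r *\<^sub>R indicator {..s} r *\<^sub>R w r)"
      by (auto simp: indicator_def fun_eq_iff)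
    then show ?thesis
      unfolding set_lebesgue_integral_def integral_restrict_space[OF side] by simp
  qed
  then show "AE s in Rplus. \<eta> s = (LINT r|Rplus. indicator {..s} r *\<^sub>R w r)"
    using assms by (simp add: has_mem_deriv_def)
qed

lemma integral_indicator_measurable [measurable]:
  assumes [measurable]: "(w :: real \<Rightarrow> 'h) \<in> borel_measurable Rplus"
  shows "(\<lambda>s. LINT r|Rplus. indicator {..s} r *\<^sub>R w r) \<in> borel_measurable Rplus"
proof -
  have "(\<lambda>(s::real, r). indicator {..s} r :: real) = (\<lambda>x. if snd x \<le> fst x then 1 else 0)"
    by (auto simp: indicator_def fun_eq_iff)
  then have [measurable]: "(\<lambda>(s, r). indicator {..s} r :: real) \<in> borel_measurable (Rplus \<Otimes>\<^sub>M Rplus)"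
    by simp
  show ?thesis by (rule Rplus.borel_measurable_lebesgue_integral) measurable
qed

text \<open>Here the exponential kernel closes the modal system: in the integration by parts with g'
  = - \<delta> g no boundary term arises at 0, since \<eta> is the primitive of w from 0.\<close>

lemma mem_mean_deriv:
  assumes "\<eta> \<in> mem_space P" "has_mem_deriv P \<eta> w"
  shows "mem_mean P w = \<delta> *\<^sub>R mem_mean P \<eta>"
proof -
  note w = has_mem_derivD[OF assms(2)]
  note [measurable] = mem_spaceD(1)[OF assms(1)] mem_spaceD(1)[OF w(1)]
  have "mem_mean P \<eta> = (LINT s|Rplus. g s *\<^sub>R (LINT r|Rplus. indicator {..s} r *\<^sub>R w r))"
    unfolding mem_mean_eq
  proof (rule integral_cong_AE)
    show "AE s in Rplus. g s *\<^sub>R \<eta> s = g s *\<^sub>R (LINT r|Rplus. indicator {..s} r *\<^sub>R w r)"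
      using w(2) by eventually_elim simp
  qed measurable
  also have "\<dots> = (1 / \<delta>) *\<^sub>R mem_mean P w"
    unfolding mem_mean_eq by (rule exp_weight_Fubini[OF \<delta> _ mem_integrable[OF w(1)]]) measurable
  finally show ?thesis using \<delta> by simp
qed

text \<open>The operator passes under the integral because it multiplies each coefficient by a
  number, and by \<open>dom_powI\<close> the coefficients decide.\<close>

lemma Ah_integral:
  assumes w: "w \<in> mem_space P"
  defines "Y \<equiv> \<lambda>s. LINT r|Rplus. indicator {..s} r *\<^sub>R Ah (w r)"
  shows "Ah (LINT r|Rplus. indicator {..s} r *\<^sub>R w r) = Y s"
proof (rule dom_powI(2))
  note [measurable] = mem_spaceD(1)[OF w]
  fix k
  have i: "integrable Rplus (\<lambda>r. indicator {..s} r *\<^sub>R w r)"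
    by (rule weighted_integrable[OF mem_spaceD(1)[OF w] mem_norm_integrable[OF w]])
  have I: "integrable Rplus (\<lambda>r. indicator {..s} r *\<^sub>R Ah (w r))"
    by (rule weighted_integrable[OF mem_Ah_measurable[OF w] mem_spaceD(3)[OF w]])
  have "cf k (Y s) = (LINT r|Rplus. cf k (indicator {..s} r *\<^sub>R Ah (w r)))"
    unfolding Y_def by (rule integral_bounded_linear[OF bounded_linear_cinner_left I, symmetric])
  also have "\<dots> = (LINT r|Rplus. complex_of_real (\<xi> k powr (a/2)) * cf k (indicator {..s} r *\<^sub>R w r))"
  proof (rule integral_cong_AE)
    show "AE r in Rplus. cf k (indicator {..s} r *\<^sub>R Ah (w r)) = complex_of_real (\<xi> k powr (a/2)) * cf k (indicator {..s} r *\<^sub>R w r)"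
      using mem_spaceD(2)[OF w] by eventually_elim (simp add: cinner_simps cf_pw)
  qed measurable
  also have "\<dots> = complex_of_real (\<xi> k powr (a/2)) * cf k (LINT r|Rplus. indicator {..s} r *\<^sub>R w r)"
    by (simp add: integral_bounded_linear[OF bounded_linear_cinner_left i])
  finally show "cf k (Y s) = complex_of_real (\<xi> k powr (a/2)) * cf k (LINT r|Rplus. indicator {..s} r *\<^sub>R w r)" .
qed

text \<open>Integration by parts of g against the derivative of |A^(a/2) \<eta>|^2: the fundamental
  theorem for the squared norm is \<open>norm_integral_square\<close>, and
  \<open>exp_weight_Fubini\<close> moves the derivative onto the weight.\<close>

lemma memory_inner_deriv:
  assumes \<eta>: "\<eta> \<in> mem_space P" and d: "has_mem_deriv P \<eta> w"
  shows "2 * memory_inner w \<eta> = \<delta> * memory_inner \<eta> \<eta>"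
proof -
  note w = has_mem_derivD[OF d]
  note [measurable] = mem_spaceD(1)[OF \<eta>] mem_spaceD(1)[OF w(1)]
  define W where "W = (\<lambda>r. Ah (w r))"
  define Y where "Y = (\<lambda>s. LINT r|Rplus. indicator {..s} r *\<^sub>R W r)"
  have [measurable]: "W \<in> borel_measurable Rplus" unfolding W_def by measurable
  have [measurable]: "Y \<in> borel_measurable Rplus" unfolding Y_def by measurable
  have eq: "AE s in Rplus. Ah (\<eta> s) = Y s"
    using w(2) by eventually_elim (simp only: Ah_integral[OF w(1)] Y_def W_def)
  define f where "f = (\<lambda>r. 2 * Re (cinner (W r) (Y r)))"
  have [measurable]: "f \<in> borel_measurable Rplus" unfolding f_def by measurable
  have gf: "AE s in Rplus. 2 * (g s * Re (cinner (Ah (w s)) (Ah (\<eta> s)))) = g s *\<^sub>R f s"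
    using eq by eventually_elim (simp add: f_def W_def)
  have if': "integrable Rplus (\<lambda>s. g s *\<^sub>R f s)"
    by (rule integrable_cong_AE_imp[OF integrable_mult_right[OF memory_inner_integrable[OF w(1) \<eta>], of 2] _ gf]) measurable
  have "memory_inner \<eta> \<eta> = (LINT s|Rplus. g s *\<^sub>R (LINT r|Rplus. indicator {..s} r *\<^sub>R f r))"
    unfolding memory_inner_def
  proof (rule integral_cong_AE)
    have nY: "(norm (Y s))\<^sup>2 = (LINT r|Rplus. indicator {..s} r *\<^sub>R f r)" for s
      unfolding Y_def f_def real_scaleR_def
      by (rule norm_integral_square[OF _ weighted_integrable(2)])
         (use mem_spaceD(3)[OF w(1)] in \<open>simp_all add: W_def\<close>)
    show "AE s in Rplus. g s * Re (cinner (Ah (\<eta> s)) (Ah (\<eta> s))) = g s *\<^sub>R (LINT r|Rplus. indicator {..s} r *\<^sub>R f r)"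
      using eq by eventually_elim (simp only: Re_cinner_self nY real_scaleR_def)
    have "(\<lambda>(s::real, r). indicator {..s} r :: real) = (\<lambda>x. if snd x \<le> fst x then 1 else 0)"
      by (auto simp: indicator_def fun_eq_iff)
    then have [measurable]: "(\<lambda>(s, r). indicator {..s} r :: real) \<in> borel_measurable (Rplus \<Otimes>\<^sub>M Rplus)"
      by simp
    have "(\<lambda>s. LINT r|Rplus. indicator {..s} r *\<^sub>R f r) \<in> borel_measurable Rplus"
      by (rule Rplus.borel_measurable_lebesgue_integral) measurable
    then show "(\<lambda>s. g s *\<^sub>R (LINT r|Rplus. indicator {..s} r *\<^sub>R f r)) \<in> borel_measurable Rplus" by measurable
  qed measurable
  also have "\<dots> = (1 / \<delta>) *\<^sub>R (LINT s|Rplus. g s *\<^sub>R f s)"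
    by (rule exp_weight_Fubini[OF \<delta> _ if']) measurable
  also have "(LINT s|Rplus. g s *\<^sub>R f s) = (LINT s|Rplus. 2 * (g s * Re (cinner (Ah (w s)) (Ah (\<eta> s)))))"
    by (rule integral_cong_AE[OF _ _ gf, symmetric]) measurable
  also have "\<dots> = 2 * memory_inner w \<eta>" by (simp add: memory_inner_def)
  finally show ?thesis using \<delta> by simp
qed

section \<open>States and energy forms\<close>

abbreviation "V \<equiv> state_space P"
abbreviation "N \<equiv> state_norm P"
abbreviation rscale :: "real \<Rightarrow> 'h state \<Rightarrow> 'h state" where
  "rscale r X \<equiv> state_scale (complex_of_real r) X"

lemma stateE:
  assumes "X \<in> V"
  obtains v u p q \<eta> where "X = (v, u, p, q, \<eta>)" "v \<in> Dp (1/2)" "p \<in> Dp (1/2)" "\<eta> \<in> mem_space P"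
  using assms by (auto simp: state_space_def)

lemma stateI: "v \<in> Dp (1/2) \<Longrightarrow> p \<in> Dp (1/2) \<Longrightarrow> \<eta> \<in> mem_space P \<Longrightarrow> (v, u, p, q, \<eta>) \<in> V"
  by (simp add: state_space_def)

lemma state_add_in: "X \<in> V \<Longrightarrow> Y \<in> V \<Longrightarrow> state_add X Y \<in> V"
  by (elim stateE) (simp add: stateI dom_pow_add mem_add)

lemma state_scale_in: "X \<in> V \<Longrightarrow> state_scale c X \<in> V"
  by (elim stateE) (simp add: stateI dom_pow_scaleC mem_scale)

lemma state_diff_in: "X \<in> V \<Longrightarrow> Y \<in> V \<Longrightarrow> state_diff X Y \<in> V"
  by (simp add: state_diff_def state_add_in state_scale_in)

text \<open>Only semidefinite, because functions equal almost everywhere are not identified and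
  because the parts of the energy are treated separately. Cauchy-Schwarz, the triangle inequality
  and continuity are thus proved once for all forms.\<close>

definition psd_form :: "('h state \<Rightarrow> 'h state \<Rightarrow> real) \<Rightarrow> bool" where
  "psd_form B \<longleftrightarrow> (\<forall>X\<in>V. \<forall>Y\<in>V. \<forall>Z\<in>V. B (state_add X Y) Z = B X Z + B Y Z) \<and>
     (\<forall>r. \<forall>X\<in>V. \<forall>Y\<in>V. B (rscale r X) Y = r * B X Y) \<and>
     (\<forall>X\<in>V. \<forall>Y\<in>V. B X Y = B Y X) \<and> (\<forall>X\<in>V. 0 \<le> B X X)"

lemma sformD:
  assumes "psd_form B" "X \<in> V" "Y \<in> V"
  shows "Z \<in> V \<Longrightarrow> B (state_add X Y) Z = B X Z + B Y Z" "B (rscale r X) Y = r * B X Y"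
    "B X Y = B Y X" "0 \<le> B X X"
  using assms by (auto simp: psd_form_def)

lemma psd_form_diff:
  assumes "psd_form B" "X \<in> V" "Y \<in> V" "Z \<in> V"
  shows "B (state_diff X Y) Z = B X Z - B Y Z" "B Z (state_diff X Y) = B Z X - B Z Y"
proof -
  show 1: "B (state_diff X Y) Z = B X Z - B Y Z"
    using sformD(1)[OF assms(1,2) state_scale_in[OF assms(3)] assms(4)] sformD(2)[OF assms(1,3,4), of "-1"]
    by (simp add: state_diff_def)
  show "B Z (state_diff X Y) = B Z X - B Z Y"
    using 1 sformD(3)[OF assms(1)] assms state_diff_in by metis
qed

lemma psd_form_square:
  assumes B: "psd_form B" and XY: "X \<in> V" "Y \<in> V"
  shows "B (state_add X (rscale r Y)) (state_add X (rscale r Y)) = B X X + 2 * r * B X Y + r\<^sup>2 * B Y Y"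
proof -
  have in': "rscale r Y \<in> V" "state_add X (rscale r Y) \<in> V" using XY by (auto intro: state_add_in state_scale_in)
  have "B (state_add X (rscale r Y)) Z = B X Z + r * B Y Z" if "Z \<in> V" for Z
    using sformD(1)[OF B XY(1) in'(1) that] sformD(2)[OF B XY(2) that] by simp
  then have "B (state_add X (rscale r Y)) (state_add X (rscale r Y))
      = B (state_add X (rscale r Y)) X + r * B (state_add X (rscale r Y)) Y"
    using in' XY sformD(3)[OF B] by metis
  also have "\<dots> = B X X + r * B Y X + r * (B X Y + r * B Y Y)"
    using \<open>\<And>Z. Z \<in> V \<Longrightarrow> B (state_add X (rscale r Y)) Z = B X Z + r * B Y Z\<close> XY by simp
  finally show ?thesis using sformD(3)[OF B XY] by (simp add: power2_eq_square algebra_simps)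
qed

lemma psd_form_Cauchy_Schwarz:
  assumes B: "psd_form B" and XY: "X \<in> V" "Y \<in> V"
  shows "\<bar>B X Y\<bar> \<le> sqrt (B X X) * sqrt (B Y Y)"
proof -
  have q: "0 \<le> B X X + 2 * r * B X Y + r\<^sup>2 * B Y Y" for r
    using psd_form_square[OF B XY, of r] sformD(4)[OF B _ XY(1), of "state_add X (rscale r Y)"]
      state_add_in[OF XY(1) state_scale_in[OF XY(2)]] by simp
  have nn: "0 \<le> B X X" "0 \<le> B Y Y" using sformD(4)[OF B] XY by auto
  have "(B X Y)\<^sup>2 \<le> B X X * B Y Y"
  proof (cases "B Y Y = 0")
    case True
    have "B X Y = 0"
    proof (rule ccontr)
      assume "B X Y \<noteq> 0"
      \<comment> \<open>At this r the quadratic takes the value -1.\<close>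
      then show False using q[of "- (B X X + 1) / (2 * B X Y)"] True by (simp add: field_simps)
    qed
    then show ?thesis using nn by simp
  next
    case False
    then have "B Y Y > 0" using nn by simp
    then show ?thesis using q[of "- B X Y / B Y Y"] by (simp add: power2_eq_square field_simps)
  qed
  then have "sqrt ((B X Y)\<^sup>2) \<le> sqrt (B X X * B Y Y)" by (rule real_sqrt_le_mono)
  then show ?thesis by (simp add: real_sqrt_mult)
qed

lemma psd_form_triangle:
  assumes B: "psd_form B" and XY: "X \<in> V" "Y \<in> V"
  shows "sqrt (B (state_add X Y) (state_add X Y)) \<le> sqrt (B X X) + sqrt (B Y Y)"
proof (rule real_le_lsqrt)
  have nn: "0 \<le> B X X" "0 \<le> B Y Y" using sformD(4)[OF B] XY by auto
  show "0 \<le> sqrt (B X X) + sqrt (B Y Y)" using nn by simp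
  have "rscale 1 Y = Y" by (cases Y) simp
  then have "B (state_add X Y) (state_add X Y) = B X X + 2 * B X Y + B Y Y"
    using psd_form_square[OF B XY, of 1] by simp
  also have "\<dots> \<le> B X X + 2 * (sqrt (B X X) * sqrt (B Y Y)) + B Y Y"
    using psd_form_Cauchy_Schwarz[OF B XY] by simp
  also have "\<dots> = (sqrt (B X X) + sqrt (B Y Y))\<^sup>2"
    using nn by (simp add: power2_sum)
  finally show "B (state_add X Y) (state_add X Y) \<le> (sqrt (B X X) + sqrt (B Y Y))\<^sup>2" .
qed

text \<open>Bilinearity splits B Z W - B X Y into three terms with a vanishing factor. Convergence
  is measured in the seminorm of the form itself, and the filter is arbitrary, to serve both
  sequences and difference quotients.\<close>

lemma psd_form_tendsto:
  assumes B: "psd_form B" and V: "\<And>n. Z n \<in> V" "\<And>n. W n \<in> V" "X \<in> V" "Y \<in> V"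
    and Z: "((\<lambda>n. sqrt (B (state_diff (Z n) X) (state_diff (Z n) X))) \<longlongrightarrow> 0) F"
    and W: "((\<lambda>n. sqrt (B (state_diff (W n) Y) (state_diff (W n) Y))) \<longlongrightarrow> 0) F"
  shows "((\<lambda>n. B (Z n) (W n)) \<longlongrightarrow> B X Y) F"
proof -
  define z where "z = (\<lambda>n. sqrt (B (state_diff (Z n) X) (state_diff (Z n) X)))"
  define w where "w = (\<lambda>n. sqrt (B (state_diff (W n) Y) (state_diff (W n) Y)))"
  have bnd: "norm (B (Z n) (W n) - B X Y) \<le> z n * w n + z n * sqrt (B Y Y) + sqrt (B X X) * w n" for n
  proof -
    have in': "state_diff (Z n) X \<in> V" "state_diff (W n) Y \<in> V" using V by (auto intro: state_diff_in)
    have "B (Z n) (W n) - B X Y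
       = B (state_diff (Z n) X) (state_diff (W n) Y) + B (state_diff (Z n) X) Y + B X (state_diff (W n) Y)"
      using V in' by (simp add: psd_form_diff[OF B])
    moreover note psd_form_Cauchy_Schwarz[OF B in'] psd_form_Cauchy_Schwarz[OF B in'(1) V(4)]
      psd_form_Cauchy_Schwarz[OF B V(3) in'(2)]
    ultimately show ?thesis unfolding z_def w_def real_norm_def by linarith
  qed
  have lim: "((\<lambda>n. z n * w n + z n * sqrt (B Y Y) + sqrt (B X X) * w n) \<longlongrightarrow> 0 * 0 + 0 * sqrt (B Y Y) + sqrt (B X X) * 0) F"
    using Z W unfolding z_def w_def by (intro tendsto_intros)
  have "((\<lambda>n. B (Z n) (W n) - B X Y) \<longlongrightarrow> 0) F"
    by (rule Lim_null_comparison[OF always_eventually[OF allI[OF bnd]]]) (use lim in simp)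
  then show ?thesis by (simp only: LIM_zero_iff) 
qed

section \<open>The energy and its mechanical and memory parts\<close>

definition energy_form :: "'h state \<Rightarrow> 'h state \<Rightarrow> real" where
  "energy_form X Y = Re (state_inner P X Y)"

fun memory_form :: "'h state \<Rightarrow> 'h state \<Rightarrow> real" where
  "memory_form (v, u, p, q, \<eta>) (v', u', p', q', \<eta>') = memory_inner \<eta> \<eta>'"

fun mech_form :: "'h state \<Rightarrow> 'h state \<Rightarrow> real" where
  "mech_form (v, u, p, q, \<eta>) (v', u', p', q', \<eta>') =
     \<alpha>\<^sub>1 * Re (cinner (pw (1/2) v) (pw (1/2) v')) - 1 / \<delta> * Re (cinner (Ah v) (Ah v'))
     + \<rho> * Re (cinner u u')
     + \<beta> * Re (cinner (\<gamma> *\<^sub>R pw (1/2) v - pw (1/2) p) (\<gamma> *\<^sub>R pw (1/2) v' - pw (1/2) p'))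
     + \<mu> * Re (cinner q q')"

lemma energy_form_eq: "X \<in> V \<Longrightarrow> Y \<in> V \<Longrightarrow> energy_form X Y = mech_form X Y + memory_form X Y"
proof (elim stateE)
  fix v u p q \<eta> v' u' p' q' \<eta>'
  assume *: "X = (v, u, p, q, \<eta>)" "Y = (v', u', p', q', \<eta>')" "\<eta> \<in> mem_space P" "\<eta>' \<in> mem_space P"
  have "Re (LINT s|Rplus. complex_of_real (g s) * cinner (Ah (\<eta> s)) (Ah (\<eta>' s))) = memory_inner \<eta> \<eta>'"
    unfolding memory_inner_def using integral_Re[OF cinner_Ah_integrable[OF *(3,4)]] by simp
  then show ?thesis by (simp add: energy_form_def * Let_def zeta kern)
qed

lemma N_eq: "N X = sqrt (energy_form X X)"
  by (simp add: state_norm_def energy_form_def)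

lemma dom_half: "v \<in> Dp (1/2) \<Longrightarrow> v \<in> Dp (a / 2)"
  by (erule dom_pow_mono(1)) (use params in auto)

lemma psd_form_memory_form: "psd_form memory_form"
  unfolding psd_form_def
proof (intro conjI ballI allI)
  fix X Y Z assume "X \<in> V" "Y \<in> V" "Z \<in> V"
  then show "memory_form (state_add X Y) Z = memory_form X Z + memory_form Y Z" by (elim stateE) (simp add: memory_inner_add_left)
next
  fix r X Y assume "X \<in> V" "Y \<in> V"
  then show "memory_form (rscale r X) Y = r * memory_form X Y" by (elim stateE) (simp add: memory_inner_scale_left)
next
  fix X Y assume "X \<in> V" "Y \<in> V"
  then show "memory_form X Y = memory_form Y X" by (elim stateE) (simp, rule memory_inner_commute)
next
  fix X assume "X \<in> V"
  then show "0 \<le> memory_form X X" by (elim stateE) (simp add: memory_inner_nonneg)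
qed

text \<open>Coercivity absorbs the negative term - \<zeta> |A^(a/2) v|^2, which makes the mechanical
  part positive semidefinite on its own.\<close>

lemma mech_form_lower:
  assumes "(v, u, p, q, \<eta>) \<in> V"
  shows "\<kappa> * (norm (pw (1/2) v))\<^sup>2 + \<rho> * (norm u)\<^sup>2 + \<beta> * (norm (\<gamma> *\<^sub>R pw (1/2) v - pw (1/2) p))\<^sup>2 + \<mu> * (norm q)\<^sup>2
     \<le> mech_form (v, u, p, q, \<eta>) (v, u, p, q, \<eta>)"
  using assms coercive_le[of v] by (auto elim!: stateE simp: Re_cinner_self)

lemma psd_form_mech_form: "psd_form mech_form"
  unfolding psd_form_def
proof (intro conjI ballI allI)
  fix X Y Z assume "X \<in> V" "Y \<in> V" "Z \<in> V"
  then show "mech_form (state_add X Y) Z = mech_form X Z + mech_form Y Z"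
    by (elim stateE) (simp add: dom_pow_add dom_half cinner_simps algebra_simps)
next
  fix r X Y assume "X \<in> V" "Y \<in> V"
  then show "mech_form (rscale r X) Y = r * mech_form X Y"
    by (elim stateE) (simp add: dom_pow_scaleC dom_half cinner_simps algebra_simps)
next
  fix X Y assume "X \<in> V" "Y \<in> V"
  then show "mech_form X Y = mech_form Y X"
    by (elim stateE) (simp add: Re_cinner_commute)
next
  fix X assume X: "X \<in> V"
  then obtain v u p q \<eta> where *: "X = (v, u, p, q, \<eta>)" by (rule stateE)
  have "0 \<le> \<kappa> * (norm (pw (1/2) v))\<^sup>2 + \<rho> * (norm u)\<^sup>2 + \<beta> * (norm (\<gamma> *\<^sub>R pw (1/2) v - pw (1/2) p))\<^sup>2 + \<mu> * (norm q)\<^sup>2"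
    using params \<kappa> by simp
  also have "\<dots> \<le> mech_form X X" unfolding * by (rule mech_form_lower) (use X * in simp)
  finally show "0 \<le> mech_form X X" .
qed

lemma psd_form_add: "psd_form B \<Longrightarrow> psd_form B' \<Longrightarrow> psd_form (\<lambda>X Y. B X Y + B' X Y)"
  by (simp add: psd_form_def algebra_simps)

lemma psd_form_cong:
  assumes B: "psd_form B" and eq: "\<And>X Y. X \<in> V \<Longrightarrow> Y \<in> V \<Longrightarrow> B' X Y = B X Y"
  shows "psd_form B'"
  unfolding psd_form_def
proof (intro conjI ballI allI)
  fix X Y Z assume "X \<in> V" "Y \<in> V" "Z \<in> V"
  then show "B' (state_add X Y) Z = B' X Z + B' Y Z"
    using sformD(1)[OF B] by (simp add: eq state_add_in)
next
  fix r X Y assume "X \<in> V" "Y \<in> V"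
  then show "B' (rscale r X) Y = r * B' X Y"
    using sformD(2)[OF B] by (simp add: eq state_scale_in)
next
  fix X Y assume "X \<in> V" "Y \<in> V"
  then show "B' X Y = B' Y X" using sformD(3)[OF B] by (simp add: eq)
next
  fix X assume "X \<in> V"
  then show "0 \<le> B' X X" using sformD(4)[OF B] by (simp add: eq)
qed

lemma psd_form_energy_form: "psd_form energy_form"
  by (rule psd_form_cong[OF psd_form_add[OF psd_form_mech_form psd_form_memory_form]]) (rule energy_form_eq)

lemma N_square: "X \<in> V \<Longrightarrow> (N X)\<^sup>2 = energy_form X X"
  using sformD(4)[OF psd_form_energy_form] by (simp add: N_eq)

lemma N_nonneg: "X \<in> V \<Longrightarrow> 0 \<le> N X"
  using sformD(4)[OF psd_form_energy_form] by (simp add: N_eq)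

lemma memory_form_le: "X \<in> V \<Longrightarrow> memory_form X X \<le> energy_form X X" and mech_form_le: "X \<in> V \<Longrightarrow> mech_form X X \<le> energy_form X X"
  using sformD(4)[OF psd_form_mech_form] sformD(4)[OF psd_form_memory_form] by (auto simp: energy_form_eq)

lemma N_triangle: "X \<in> V \<Longrightarrow> Y \<in> V \<Longrightarrow> N (state_add X Y) \<le> N X + N Y"
  unfolding N_eq by (rule psd_form_triangle[OF psd_form_energy_form])

lemma N_rscale: "X \<in> V \<Longrightarrow> N (rscale r X) = \<bar>r\<bar> * N X"
proof -
  assume X: "X \<in> V"
  have rX: "rscale r X \<in> V" using X by (rule state_scale_in)
  have "energy_form (rscale r X) (rscale r X) = r * (r * energy_form X X)"
    using sformD(2)[OF psd_form_energy_form X rX] sformD(3)[OF psd_form_energy_form X rX] sformD(2)[OF psd_form_energy_form X X] by simp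
  then have "energy_form (rscale r X) (rscale r X) = r\<^sup>2 * energy_form X X" by (simp add: power2_eq_square)
  then show ?thesis by (simp add: N_eq real_sqrt_mult)
qed

lemma state_eq_energy_form:
  assumes "X \<in> V" "X' \<in> V" "Y \<in> V" "state_eq X X'"
  shows "energy_form X Y = energy_form X' Y"
  using assms
proof (elim stateE)
  fix v u p q \<eta> v' u' p' q' \<eta>' v'' u'' p'' q'' \<eta>''
  assume *: "X = (v, u, p, q, \<eta>)" "\<eta> \<in> mem_space P" "X' = (v', u', p', q', \<eta>')" "\<eta>' \<in> mem_space P"
    "Y = (v'', u'', p'', q'', \<eta>'')" "\<eta>'' \<in> mem_space P"
  have "memory_inner \<eta> \<eta>'' = memory_inner \<eta>' \<eta>''"
    by (rule memory_inner_cong) (use assms(4) * mem_spaceD(1) in auto)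
  then show ?thesis using assms by (simp add: energy_form_eq *)
qed

lemma state_eq_N: "X \<in> V \<Longrightarrow> X' \<in> V \<Longrightarrow> state_eq X X' \<Longrightarrow> N X = N X'"
  using state_eq_energy_form[of X X' X] state_eq_energy_form[of X X' X'] sformD(3)[OF psd_form_energy_form, of X X'] by (simp add: N_eq)

section \<open>Modal coefficients of a state\<close>

fun cv :: "nat \<Rightarrow> 'h state \<Rightarrow> complex" where "cv k (v, u, p, q, \<eta>) = cf k v"
fun cu :: "nat \<Rightarrow> 'h state \<Rightarrow> complex" where "cu k (v, u, p, q, \<eta>) = cf k u"
fun cp :: "nat \<Rightarrow> 'h state \<Rightarrow> complex" where "cp k (v, u, p, q, \<eta>) = cf k p"
fun cq :: "nat \<Rightarrow> 'h state \<Rightarrow> complex" where "cq k (v, u, p, q, \<eta>) = cf k q"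
fun cm :: "nat \<Rightarrow> 'h state \<Rightarrow> complex" where "cm k (v, u, p, q, \<eta>) = cf k (mem_mean P \<eta>)"

definition mode_mech :: "nat \<Rightarrow> 'h state \<Rightarrow> real" where
  "mode_mech k X = \<xi> k * (cmod (cv k X))\<^sup>2 + (cmod (cu k X))\<^sup>2 + \<xi> k * (cmod (cp k X))\<^sup>2 + (cmod (cq k X))\<^sup>2"

definition mode_energy :: "nat \<Rightarrow> 'h state \<Rightarrow> real" where
  "mode_energy k X = mode_mech k X + \<xi> k powr a * (cmod (cm k X))\<^sup>2"

lemma mode_mech_nonneg: "0 \<le> mode_mech k X" and mode_mech_le_mode_energy: "mode_mech k X \<le> mode_energy k X"
  using \<xi>_pos[of k] by (auto simp: mode_mech_def mode_energy_def intro!: add_nonneg_nonneg)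

lemma mode_mech_sums:
  assumes "(v, u, p, q, \<eta>) \<in> V"
  shows "(\<lambda>k. mode_mech k (v, u, p, q, \<eta>)) sums ((norm (pw (1/2) v))\<^sup>2 + (norm u)\<^sup>2 + (norm (pw (1/2) p))\<^sup>2 + (norm q)\<^sup>2)"
proof -
  have "v \<in> Dp (1/2)" "p \<in> Dp (1/2)" using assms by (auto elim: stateE)
  from norm_pw[OF this(1)] norm_pw[OF this(2)] show ?thesis
    unfolding mode_mech_def cv.simps cu.simps cp.simps cq.simps using \<xi>_pos
    by (intro sums_add parseval_norm) (simp_all add: powr_one less_imp_le)
qed

text \<open>Parseval for v, u, p, q and \<open>mem_mean_bessel\<close> for the memory. There is no
  converse, as the mean does not determine \<eta>.\<close>

lemma mode_energy_sum_le:
  obtains C where "C > 0" "\<And>X n. X \<in> V \<Longrightarrow> (\<Sum>k<n. mode_energy k X) \<le> C * energy_form X X"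
proof -
  \<comment> \<open>The inequality |A^(1/2) p|^2 \<le> 2 \<gamma>^2 |A^(1/2) v|^2 + 2 |x|^2 accounts
    for 2 \<gamma>^2/\<kappa> and for the 2 in 2/\<beta>.\<close>
  define C where "C = (1 + 2 * \<gamma>\<^sup>2) / \<kappa> + 1 / \<rho> + 2 / \<beta> + 1 / \<mu> + 1 / \<delta>"
  have "1 + 2 * \<gamma>\<^sup>2 > 0" by (intro add_pos_nonneg) auto
  then have C: "C > 0" unfolding C_def using params \<kappa> \<delta> by (intro add_pos_pos) auto
  show thesis
  proof (rule that[OF C])
    fix X n assume X: "X \<in> V"
    then obtain v u p q \<eta> where *: "X = (v, u, p, q, \<eta>)" "\<eta> \<in> mem_space P" by (rule stateE)
    define x where "x = \<gamma> *\<^sub>R pw (1/2) v - pw (1/2) p"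
    have low: "\<kappa> * (norm (pw (1/2) v))\<^sup>2 + \<rho> * (norm u)\<^sup>2 + \<beta> * (norm x)\<^sup>2 + \<mu> * (norm q)\<^sup>2 \<le> mech_form X X"
      unfolding x_def * by (rule mech_form_lower) (use X * in simp)
    have "energy_form X X = mech_form X X + memory_inner \<eta> \<eta>" using energy_form_eq[OF X X] by (simp add: *)
    then have low': "\<kappa> * (norm (pw (1/2) v))\<^sup>2 + \<rho> * (norm u)\<^sup>2 + \<beta> * (norm x)\<^sup>2 + \<mu> * (norm q)\<^sup>2 + memory_inner \<eta> \<eta> \<le> energy_form X X"
      using low by simp
    have nn: "0 \<le> \<kappa> * (norm (pw (1/2) v))\<^sup>2" "0 \<le> \<rho> * (norm u)\<^sup>2" "0 \<le> \<beta> * (norm x)\<^sup>2" "0 \<le> \<mu> * (norm q)\<^sup>2" "0 \<le> memory_inner \<eta> \<eta>"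
      using params \<kappa> memory_inner_nonneg by auto
    have 1: "(norm (pw (1/2) v))\<^sup>2 \<le> 1 / \<kappa> * energy_form X X" "(norm u)\<^sup>2 \<le> 1 / \<rho> * energy_form X X" "(norm x)\<^sup>2 \<le> 1 / \<beta> * energy_form X X"
      "(norm q)\<^sup>2 \<le> 1 / \<mu> * energy_form X X" "1 / \<delta> * memory_inner \<eta> \<eta> \<le> 1 / \<delta> * energy_form X X"
    proof -
      have "\<kappa> * (norm (pw (1/2) v))\<^sup>2 \<le> energy_form X X" "\<rho> * (norm u)\<^sup>2 \<le> energy_form X X" "\<beta> * (norm x)\<^sup>2 \<le> energy_form X X"
        "\<mu> * (norm q)\<^sup>2 \<le> energy_form X X" "memory_inner \<eta> \<eta> \<le> energy_form X X"
        using low' nn by linarith+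
      then show "(norm (pw (1/2) v))\<^sup>2 \<le> 1 / \<kappa> * energy_form X X" "(norm u)\<^sup>2 \<le> 1 / \<rho> * energy_form X X" "(norm x)\<^sup>2 \<le> 1 / \<beta> * energy_form X X"
        "(norm q)\<^sup>2 \<le> 1 / \<mu> * energy_form X X" "1 / \<delta> * memory_inner \<eta> \<eta> \<le> 1 / \<delta> * energy_form X X"
        using params \<kappa> \<delta> by (simp_all add: pos_le_divide_eq mult.commute divide_right_mono)
    qed
    have 2: "(norm (pw (1/2) p))\<^sup>2 \<le> 2 * \<gamma>\<^sup>2 * (norm (pw (1/2) v))\<^sup>2 + 2 * (norm x)\<^sup>2"
    proof -
      have "norm (pw (1/2) p) \<le> \<gamma> * norm (pw (1/2) v) + norm x"
        using norm_triangle_ineq4[of "\<gamma> *\<^sub>R pw (1/2) v" x] params by (simp add: x_def)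
      then have "(norm (pw (1/2) p))\<^sup>2 \<le> (\<gamma> * norm (pw (1/2) v) + norm x)\<^sup>2" by (rule power_mono) simp
      also have "\<dots> \<le> 2 * (\<gamma> * norm (pw (1/2) v))\<^sup>2 + 2 * (norm x)\<^sup>2"
        using zero_le_power2[of "\<gamma> * norm (pw (1/2) v) - norm x"] by (simp add: power2_eq_square algebra_simps)
      finally show ?thesis by (simp add: power_mult_distrib)
    qed
    have S: "(\<lambda>k. mode_mech k X) sums ((norm (pw (1/2) v))\<^sup>2 + (norm u)\<^sup>2 + (norm (pw (1/2) p))\<^sup>2 + (norm q)\<^sup>2)"
      unfolding * by (rule mode_mech_sums) (use X * in simp)
    have "(\<Sum>k<n. mode_mech k X) \<le> (norm (pw (1/2) v))\<^sup>2 + (norm u)\<^sup>2 + (norm (pw (1/2) p))\<^sup>2 + (norm q)\<^sup>2"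
      using sum_le_suminf[OF sums_summable[OF S], of "{..<n}"] sums_unique[OF S] mode_mech_nonneg by simp
    also have "\<dots> \<le> ((1 + 2 * \<gamma>\<^sup>2) / \<kappa> + 1 / \<rho> + 2 / \<beta> + 1 / \<mu>) * energy_form X X"
    proof -
      have "(1 + 2 * \<gamma>\<^sup>2) * (norm (pw (1/2) v))\<^sup>2 \<le> (1 + 2 * \<gamma>\<^sup>2) * (1 / \<kappa> * energy_form X X)"
        by (intro mult_left_mono 1) auto
      with 1 2 show ?thesis by (simp add: algebra_simps add_divide_distrib)
    qed
    finally have 3: "(\<Sum>k<n. mode_mech k X) \<le> ((1 + 2 * \<gamma>\<^sup>2) / \<kappa> + 1 / \<rho> + 2 / \<beta> + 1 / \<mu>) * energy_form X X" .
    have "(\<Sum>k<n. \<xi> k powr a * (cmod (cm k X))\<^sup>2) \<le> 1 / \<delta> * memory_inner \<eta> \<eta>"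
      unfolding * cm.simps by (rule mem_mean_bessel[OF *(2)])
    then have "(\<Sum>k<n. mode_energy k X) \<le> ((1 + 2 * \<gamma>\<^sup>2) / \<kappa> + 1 / \<rho> + 2 / \<beta> + 1 / \<mu>) * energy_form X X + 1 / \<delta> * energy_form X X"
      unfolding mode_energy_def sum.distrib using 3 1(5) by linarith
    then show "(\<Sum>k<n. mode_energy k X) \<le> C * energy_form X X" by (simp add: C_def algebra_simps)
  qed
qed

text \<open>In contrast to the memory, the mechanical part is determined by its modes, so a bound on
  the partial sums uniform in n carries over to the state.\<close>

lemma mech_form_le_mode_mech:
  obtains C where "C > 0" "\<And>X D. X \<in> V \<Longrightarrow> (\<And>n. (\<Sum>k<n. mode_mech k X) \<le> D) \<Longrightarrow> mech_form X X \<le> C * D"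
proof -
  define C where "C = \<alpha>\<^sub>1 + \<rho> + 2 * \<beta> * (1 + \<gamma>\<^sup>2) + \<mu>"
  have C: "C > 0" unfolding C_def using params by (intro add_pos_pos mult_pos_pos) (auto intro: add_pos_nonneg)
  show thesis
  proof (rule that[OF C])
    fix X D assume X: "X \<in> V" and D: "\<And>n. (\<Sum>k<n. mode_mech k X) \<le> D"
    then obtain v u p q \<eta> where *: "X = (v, u, p, q, \<eta>)" by (auto elim: stateE)
    define D' where "D' = (norm (pw (1/2) v))\<^sup>2 + (norm u)\<^sup>2 + (norm (pw (1/2) p))\<^sup>2 + (norm q)\<^sup>2"
    have "(\<lambda>k. mode_mech k X) sums D'" unfolding * D'_def by (rule mode_mech_sums) (use X * in simp)
    then have DD: "D' \<le> D" using D by (intro LIMSEQ_le_const2[of "\<lambda>n. \<Sum>k<n. mode_mech k X"]) (auto simp: sums_def)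
    have 1: "(norm (pw (1/2) v))\<^sup>2 \<le> D'" "(norm u)\<^sup>2 \<le> D'" "(norm (pw (1/2) v))\<^sup>2 + (norm (pw (1/2) p))\<^sup>2 \<le> D'" "(norm q)\<^sup>2 \<le> D'"
      by (auto simp: D'_def)
    have 2: "(norm (\<gamma> *\<^sub>R pw (1/2) v - pw (1/2) p))\<^sup>2 \<le> 2 * (1 + \<gamma>\<^sup>2) * D'"
    proof -
      have "norm (\<gamma> *\<^sub>R pw (1/2) v - pw (1/2) p) \<le> \<gamma> * norm (pw (1/2) v) + norm (pw (1/2) p)"
        using norm_triangle_ineq4[of "\<gamma> *\<^sub>R pw (1/2) v" "pw (1/2) p"] params by simp
      then have "(norm (\<gamma> *\<^sub>R pw (1/2) v - pw (1/2) p))\<^sup>2 \<le> (\<gamma> * norm (pw (1/2) v) + norm (pw (1/2) p))\<^sup>2" by (rule power_mono) simp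
      also have "\<dots> \<le> 2 * (\<gamma> * norm (pw (1/2) v))\<^sup>2 + 2 * (norm (pw (1/2) p))\<^sup>2"
        using zero_le_power2[of "\<gamma> * norm (pw (1/2) v) - norm (pw (1/2) p)"] by (simp add: power2_eq_square algebra_simps)
      also have "\<dots> \<le> 2 * (1 + \<gamma>\<^sup>2) * ((norm (pw (1/2) v))\<^sup>2 + (norm (pw (1/2) p))\<^sup>2)"
        by (simp add: power_mult_distrib algebra_simps)
      also have "\<dots> \<le> 2 * (1 + \<gamma>\<^sup>2) * D'" using 1 by (intro mult_left_mono) auto
      finally show ?thesis .
    qed
    have "mech_form X X \<le> \<alpha>\<^sub>1 * (norm (pw (1/2) v))\<^sup>2 + \<rho> * (norm u)\<^sup>2 + \<beta> * (norm (\<gamma> *\<^sub>R pw (1/2) v - pw (1/2) p))\<^sup>2 + \<mu> * (norm q)\<^sup>2"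
      using \<delta> by (simp add: * Re_cinner_self)
    also have "\<dots> \<le> \<alpha>\<^sub>1 * D' + \<rho> * D' + \<beta> * (2 * (1 + \<gamma>\<^sup>2) * D') + \<mu> * D'"
      using params by (intro add_mono mult_left_mono 1 2) auto
    also have "\<dots> = C * D'" by (simp add: C_def algebra_simps)
    also have "\<dots> \<le> C * D" using C DD by simp
    finally show "mech_form X X \<le> C * D" .
  qed
qed

text \<open>The functionals for which an identity on \<open>evol_dom\<close> survives in the closure
  of \<open>evol_op\<close>, and whose values along orbits can be differentiated.\<close>

definition bounded_functional :: "('h state \<Rightarrow> real) \<Rightarrow> bool" where
  "bounded_functional l \<longleftrightarrow> (\<forall>X\<in>V. \<forall>Y\<in>V. l (state_add X Y) = l X + l Y) \<and> (\<forall>r. \<forall>X\<in>V. l (rscale r X) = r * l X) \<and>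
     (\<exists>C. \<forall>X\<in>V. \<bar>l X\<bar> \<le> C * N X)"

lemma bounded_functional_diff: "bounded_functional l \<Longrightarrow> X \<in> V \<Longrightarrow> Y \<in> V \<Longrightarrow> l (state_diff X Y) = l X - l Y"
proof -
  assume l: "bounded_functional l" "X \<in> V" "Y \<in> V"
  then have "l (state_diff X Y) = l X + l (rscale (-1) Y)"
    unfolding state_diff_def bounded_functional_def using state_scale_in[OF l(3)] by simp
  also have "l (rscale (-1) Y) = - l Y" using l by (simp add: bounded_functional_def del: of_real_minus)
  finally show ?thesis by simp
qed

lemma bounded_functional_tendsto:
  assumes l: "bounded_functional l" and V: "\<And>n. Z n \<in> V" "X \<in> V" and Z: "((\<lambda>n. N (state_diff (Z n) X)) \<longlongrightarrow> 0) F"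
  shows "((\<lambda>n. l (Z n)) \<longlongrightarrow> l X) F"
proof -
  obtain C where C: "\<And>X. X \<in> V \<Longrightarrow> \<bar>l X\<bar> \<le> C * N X" using l unfolding bounded_functional_def by blast
  have lim: "((\<lambda>n. C * N (state_diff (Z n) X)) \<longlongrightarrow> C * 0) F" by (intro tendsto_mult tendsto_const Z)
  have bnd: "norm (l (Z n) - l X) \<le> C * N (state_diff (Z n) X)" for n
    using C[OF state_diff_in[OF V(1) V(2)], of n] bounded_functional_diff[OF l V(1) V(2)] by simp
  have "((\<lambda>n. l (Z n) - l X) \<longlongrightarrow> 0) F"
    by (rule Lim_null_comparison[OF always_eventually[OF allI[OF bnd]]]) (use lim in simp)
  then show ?thesis by (simp only: LIM_zero_iff)
qed

lemma bounded_functional_comb: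
  assumes "bounded_functional l" "bounded_functional l'" shows "bounded_functional (\<lambda>X. c * l X + c' * l' X)"
proof -
  obtain C where C: "\<And>X. X \<in> V \<Longrightarrow> \<bar>l X\<bar> \<le> C * N X" using assms unfolding bounded_functional_def by blast
  obtain C' where C': "\<And>X. X \<in> V \<Longrightarrow> \<bar>l' X\<bar> \<le> C' * N X" using assms unfolding bounded_functional_def by blast
  have "\<bar>c * l X + c' * l' X\<bar> \<le> (\<bar>c\<bar> * C + \<bar>c'\<bar> * C') * N X" if "X \<in> V" for X
  proof -
    have "\<bar>c * l X + c' * l' X\<bar> \<le> \<bar>c\<bar> * \<bar>l X\<bar> + \<bar>c'\<bar> * \<bar>l' X\<bar>"
      using abs_triangle_ineq[of "c * l X" "c' * l' X"] by (simp add: abs_mult)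
    also have "\<dots> \<le> \<bar>c\<bar> * (C * N X) + \<bar>c'\<bar> * (C' * N X)"
      using C[OF that] C'[OF that] by (intro add_mono mult_left_mono) auto
    finally show ?thesis by (simp add: algebra_simps)
  qed
  then have b: "\<exists>C. \<forall>X\<in>V. \<bar>c * l X + c' * l' X\<bar> \<le> C * N X" by blast
  have "\<forall>X\<in>V. \<forall>Y\<in>V. l (state_add X Y) = l X + l Y \<and> l' (state_add X Y) = l' X + l' Y"
    "\<forall>r. \<forall>X\<in>V. l (rscale r X) = r * l X \<and> l' (rscale r X) = r * l' X"
    using assms unfolding bounded_functional_def by blast+
  with b show ?thesis unfolding bounded_functional_def by (simp add: distrib_left mult_ac)
qed

text \<open>The modal equations have real coefficients, so the real and imaginary parts of the modal
  coefficients solve them separately and the real mode analysis applies to both.\<close>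

definition part :: "(complex \<Rightarrow> real) \<Rightarrow> bool" where
  "part T \<longleftrightarrow> T = Re \<or> T = Im"

lemma partD: "part T \<Longrightarrow> T (x + y) = T x + T y" "part T \<Longrightarrow> T (of_real r * x) = r * T x" "part T \<Longrightarrow> \<bar>T x\<bar> \<le> cmod x"
  "part T \<Longrightarrow> T (x - y) = T x - T y" "part T \<Longrightarrow> T (- x) = - T x" "part T \<Longrightarrow> T (x / of_real r) = T x / r"
  by (auto simp: part_def abs_Re_le_cmod abs_Im_le_cmod)

text \<open>Each coefficient occurs in \<open>mode_energy\<close> with a positive weight, and
  \<open>mode_energy\<close> is bounded by the squared norm.\<close>

lemma bounded_functional_coeff:
  assumes T: "part T"
  shows "bounded_functional (\<lambda>X. T (cv k X))" "bounded_functional (\<lambda>X. T (cu k X))" "bounded_functional (\<lambda>X. T (cp k X))" "bounded_functional (\<lambda>X. T (cq k X))" "bounded_functional (\<lambda>X. T (cm k X))"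
proof -
  obtain C where C: "C > 0" "\<And>X n. X \<in> V \<Longrightarrow> (\<Sum>k<n. mode_energy k X) \<le> C * energy_form X X" using mode_energy_sum_le by blast
  have mode_energy: "mode_energy k X \<le> C * (N X)\<^sup>2" if "X \<in> V" for X
  proof -
    have "0 \<le> (\<Sum>j<k. mode_energy j X)" by (rule sum_nonneg) (use mode_mech_nonneg mode_mech_le_mode_energy order_trans in blast)
    \<comment> \<open>\<open>Suc k\<close>, so that the partial sum contains the term k.\<close>
    then show ?thesis using C(2)[OF that, of "Suc k"] by (simp add: N_square[OF that])
  qed
  have B: "\<exists>C. \<forall>X\<in>V. \<bar>T (c X)\<bar> \<le> C * N X" if "r > 0" "\<And>X. X \<in> V \<Longrightarrow> r * (cmod (c X))\<^sup>2 \<le> mode_energy k X" for c r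
  proof (intro exI[of _ "sqrt (C / r)"] ballI)
    fix X assume X: "X \<in> V"
    have "r * (cmod (c X))\<^sup>2 \<le> C * (N X)\<^sup>2" using that(2)[OF X] mode_energy[OF X] by linarith
    then have "(cmod (c X))\<^sup>2 \<le> (sqrt (C / r) * N X)\<^sup>2"
      using that(1) C(1) by (simp add: power_mult_distrib field_simps)
    then have "cmod (c X) \<le> sqrt (C / r) * N X"
      by (rule power2_le_imp_le) (use N_nonneg[OF X] C(1) that(1) in simp)
    then show "\<bar>T (c X)\<bar> \<le> sqrt (C / r) * N X" using partD(3)[OF T, of "c X"] by linarith
  qed
  have nn: "0 \<le> \<xi> k * (cmod z)\<^sup>2" "0 \<le> (cmod z)\<^sup>2" "0 \<le> \<xi> k powr a * (cmod z)\<^sup>2" for z using \<xi>_pos[of k] by auto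
  note s = mode_energy_def mode_mech_def
  have V1: "\<xi> k * (cmod (cv k X))\<^sup>2 \<le> mode_energy k X" "1 * (cmod (cu k X))\<^sup>2 \<le> mode_energy k X" "\<xi> k * (cmod (cp k X))\<^sup>2 \<le> mode_energy k X"
    "1 * (cmod (cq k X))\<^sup>2 \<le> mode_energy k X" "\<xi> k powr a * (cmod (cm k X))\<^sup>2 \<le> mode_energy k X" for X
    unfolding s using nn(1)[of "cv k X"] nn(2)[of "cu k X"] nn(1)[of "cp k X"] nn(2)[of "cq k X"] nn(3)[of "cm k X"] by linarith+
  have p: "\<xi> k powr a > 0" using \<xi>_pos[of k] by simp
  note pd = partD[OF T]
  show "bounded_functional (\<lambda>X. T (cv k X))"
    unfolding bounded_functional_def
  proof (intro conjI ballI allI)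
    show "T (cv k (state_add X Y)) = T (cv k X) + T (cv k Y)" if "X \<in> V" "Y \<in> V" for X Y
      using that by (elim stateE) (simp add: cinner_add_left pd mem_mean_add)
    show "T (cv k (rscale r X)) = r * T (cv k X)" if "X \<in> V" for r X
      using that by (elim stateE) (simp add: cinner_scaleC_left pd mem_mean_scale)
  qed (rule B[OF \<xi>_pos V1(1)])
  show "bounded_functional (\<lambda>X. T (cu k X))"
    unfolding bounded_functional_def
  proof (intro conjI ballI allI)
    show "T (cu k (state_add X Y)) = T (cu k X) + T (cu k Y)" if "X \<in> V" "Y \<in> V" for X Y
      using that by (elim stateE) (simp add: cinner_add_left pd mem_mean_add)
    show "T (cu k (rscale r X)) = r * T (cu k X)" if "X \<in> V" for r X
      using that by (elim stateE) (simp add: cinner_scaleC_left pd mem_mean_scale)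
  qed (rule B[OF zero_less_one V1(2)])
  show "bounded_functional (\<lambda>X. T (cp k X))"
    unfolding bounded_functional_def
  proof (intro conjI ballI allI)
    show "T (cp k (state_add X Y)) = T (cp k X) + T (cp k Y)" if "X \<in> V" "Y \<in> V" for X Y
      using that by (elim stateE) (simp add: cinner_add_left pd mem_mean_add)
    show "T (cp k (rscale r X)) = r * T (cp k X)" if "X \<in> V" for r X
      using that by (elim stateE) (simp add: cinner_scaleC_left pd mem_mean_scale)
  qed (rule B[OF \<xi>_pos V1(3)])
  show "bounded_functional (\<lambda>X. T (cq k X))"
    unfolding bounded_functional_def
  proof (intro conjI ballI allI)
    show "T (cq k (state_add X Y)) = T (cq k X) + T (cq k Y)" if "X \<in> V" "Y \<in> V" for X Y
      using that by (elim stateE) (simp add: cinner_add_left pd mem_mean_add)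
    show "T (cq k (rscale r X)) = r * T (cq k X)" if "X \<in> V" for r X
      using that by (elim stateE) (simp add: cinner_scaleC_left pd mem_mean_scale)
  qed (rule B[OF zero_less_one V1(4)])
  show "bounded_functional (\<lambda>X. T (cm k X))"
    unfolding bounded_functional_def
  proof (intro conjI ballI allI)
    show "T (cm k (state_add X Y)) = T (cm k X) + T (cm k Y)" if "X \<in> V" "Y \<in> V" for X Y
      using that by (elim stateE) (simp add: cinner_add_left pd mem_mean_add)
    show "T (cm k (rscale r X)) = r * T (cm k X)" if "X \<in> V" for r X
      using that by (elim stateE) (simp add: cinner_scaleC_left pd mem_mean_scale)
  qed (rule B[OF p V1(5)])
qed

section \<open>The evolution operator and its closure\<close>

text \<open>\<open>mem_deriv\<close> is a choice; existence of a derivative, part of the domain,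
  makes it a genuine one.\<close>

lemma evol_domE:
  assumes "Z \<in> evol_dom P"
  obtains v u p q \<eta> where "Z = (v, u, p, q, \<eta>)" "v \<in> domA P" "u \<in> Dp (1/2)" "p \<in> domA P" "q \<in> Dp (1/2)"
    "\<eta> \<in> mem_space P" "has_mem_deriv P \<eta> (mem_deriv P \<eta>)" "mem_mean P \<eta> \<in> Dp a"
proof -
  have "\<exists>w. has_mem_deriv P \<eta> w \<Longrightarrow> has_mem_deriv P \<eta> (mem_deriv P \<eta>)" for \<eta>
    unfolding mem_deriv_def by (rule someI_ex[of "has_mem_deriv P \<eta>"])
  with assms that show thesis unfolding evol_dom_def by blast
qed

lemma domA_half: "v \<in> domA P \<Longrightarrow> v \<in> Dp (1/2)"
  by (rule dom_pow_mono(1)[OF domA(1)]) auto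

lemma evol_dom_in: "Z \<in> evol_dom P \<Longrightarrow> Z \<in> V"
  by (elim evol_domE) (simp add: stateI domA_half)

lemma evol_op_in: "Z \<in> evol_dom P \<Longrightarrow> evol_op P Z \<in> V"
proof (elim evol_domE)
  fix v u p q \<eta>
  assume *: "Z = (v, u, p, q, \<eta>)" "u \<in> Dp (1/2)" "q \<in> Dp (1/2)" "has_mem_deriv P \<eta> (mem_deriv P \<eta>)"
  have "(\<lambda>s. u - mem_deriv P \<eta> s) \<in> mem_space P"
    by (rule mem_diff(1)[OF mem_const[OF dom_half[OF *(2)]] has_mem_derivD(1)[OF *(4)]])
  then show "evol_op P Z \<in> V" using * by (simp add: stateI)
qed

lemma evol_coeff:
  assumes "Z \<in> evol_dom P"
  shows "cv k (evol_op P Z) = cu k Z" "cp k (evol_op P Z) = cq k Z"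
    "cu k (evol_op P Z) = (- (\<alpha> * \<xi> k * cv k Z) + \<gamma> * \<beta> * \<xi> k * cp k Z + \<xi> k powr a / \<delta> * cv k Z - \<xi> k powr a * cm k Z) / \<rho>"
    "cq k (evol_op P Z) = (- (\<beta> * \<xi> k * cp k Z) + \<gamma> * \<beta> * \<xi> k * cv k Z) / \<mu>"
    "cm k (evol_op P Z) = cu k Z / \<delta> - \<delta> * cm k Z"
proof -
  obtain v u p q \<eta> where *: "Z = (v, u, p, q, \<eta>)" "v \<in> domA P" "u \<in> Dp (1/2)" "p \<in> domA P" "q \<in> Dp (1/2)"
    "\<eta> \<in> mem_space P" "has_mem_deriv P \<eta> (mem_deriv P \<eta>)" "mem_mean P \<eta> \<in> Dp a"
    using assms by (rule evol_domE)
  show "cv k (evol_op P Z) = cu k Z" "cp k (evol_op P Z) = cq k Z" by (simp_all add: *(1))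
  have va: "v \<in> Dp a" by (rule dom_pow_mono(1)[OF domA(1)[OF *(2)]]) (use params in auto)
  show "cu k (evol_op P Z) = (- (\<alpha> * \<xi> k * cv k Z) + \<gamma> * \<beta> * \<xi> k * cp k Z + \<xi> k powr a / \<delta> * cv k Z - \<xi> k powr a * cm k Z) / \<rho>"
    by (simp add: *(1) cinner_simps cf_opA *(2,4) cf_pw va *(8) zeta mult.assoc)
  show "cq k (evol_op P Z) = (- (\<beta> * \<xi> k * cp k Z) + \<gamma> * \<beta> * \<xi> k * cv k Z) / \<mu>"
    by (simp add: *(1) cinner_simps cf_opA *(2,4) mult.assoc)
  have "mem_mean P (\<lambda>s. u - mem_deriv P \<eta> s) = (1 / \<delta>) *\<^sub>R u - \<delta> *\<^sub>R mem_mean P \<eta>"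
    using mem_mean_diff[OF mem_const[OF dom_half[OF *(3)]] has_mem_derivD(1)[OF *(7)]]
      mem_mean_const mem_mean_deriv[OF *(6,7)] by simp
  then show "cm k (evol_op P Z) = cu k Z / \<delta> - \<delta> * cm k Z"
    by (simp add: *(1) cinner_simps)
qed

lemma Ah_mem_mean:
  assumes w: "w \<in> mem_space P"
  shows "integrable Rplus (\<lambda>s. g s *\<^sub>R Ah (w s))" and "Ah (mem_mean P w) = (LINT s|Rplus. g s *\<^sub>R Ah (w s))"
    and "mem_mean P w \<in> Dp (a / 2)"
proof -
  note [measurable] = mem_spaceD(1)[OF w]
  show I: "integrable Rplus (\<lambda>s. g s *\<^sub>R Ah (w s))"
    by (rule weighted_integrable[OF mem_Ah_measurable[OF w] mem_spaceD(3)[OF w]])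
  have c: "cf k (LINT s|Rplus. g s *\<^sub>R Ah (w s)) = complex_of_real (\<xi> k powr (a/2)) * cf k (mem_mean P w)" for k
  proof -
    have "cf k (LINT s|Rplus. g s *\<^sub>R Ah (w s)) = (LINT s|Rplus. cf k (g s *\<^sub>R Ah (w s)))"
      by (rule integral_bounded_linear[OF bounded_linear_cinner_left I, symmetric])
    also have "\<dots> = (LINT s|Rplus. complex_of_real (\<xi> k powr (a/2)) * (g s * cf k (w s)))"
    proof (rule integral_cong_AE)
      show "AE s in Rplus. cf k (g s *\<^sub>R Ah (w s)) = complex_of_real (\<xi> k powr (a/2)) * (g s * cf k (w s))"
        using mem_spaceD(2)[OF w] by eventually_elim (simp add: cinner_simps cf_pw)
    qed measurable
    finally show ?thesis by (simp add: cf_mem_mean[OF w])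
  qed
  show "Ah (mem_mean P w) = (LINT s|Rplus. g s *\<^sub>R Ah (w s))" "mem_mean P w \<in> Dp (a / 2)"
    using dom_powI[OF c] by auto
qed

text \<open>A constant memory meets \<eta> only through its mean, because A^(a/2) and the pairing
  with a fixed vector pass under the integral. It provides the term that cancels the memory force in
  the energy balance.\<close>

lemma memory_inner_const:
  assumes "u \<in> Dp (a / 2)" "\<eta> \<in> mem_space P"
  shows "memory_inner (\<lambda>s. u) \<eta> = Re (cinner (Ah u) (Ah (mem_mean P \<eta>)))"
proof -
  have bl: "bounded_linear (\<lambda>y. Re (cinner (Ah u) y))"
    by (rule bounded_linear_compose[OF bounded_linear_Re bounded_linear_cinner_right])
  show ?thesis
    unfolding memory_inner_def Ah_mem_mean(2)[OF assms(2)]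
    using integral_bounded_linear[OF bl Ah_mem_mean(1)[OF assms(2)]] by (simp add: cinner_simps)
qed

text \<open>The power of the memory force - A^a m against u is returned by the constant part u of u
  - \<eta>_s, and the elastic terms cancel. What is left is the pairing of - \<eta>_s with \<eta>,
  which \<open>memory_inner_deriv\<close> evaluates.\<close>

lemma dissipation:
  assumes "Z \<in> evol_dom P"
  shows "energy_form (evol_op P Z) Z = - (\<delta> / 2) * memory_form Z Z"
proof -
  obtain v u p q \<eta> where *: "Z = (v, u, p, q, \<eta>)" "v \<in> domA P" "u \<in> Dp (1/2)" "p \<in> domA P" "q \<in> Dp (1/2)"
    "\<eta> \<in> mem_space P" "has_mem_deriv P \<eta> (mem_deriv P \<eta>)" "mem_mean P \<eta> \<in> Dp a"
    using assms by (rule evol_domE)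
  define w where "w = mem_deriv P \<eta>"
  define m where "m = mem_mean P \<eta>"
  define W where "W = - (\<alpha> *\<^sub>R opA P v) + (\<gamma> * \<beta>) *\<^sub>R opA P p + zeta P *\<^sub>R pw a v - pw a m"
  define Q where "Q = - (\<beta> *\<^sub>R opA P p) + (\<gamma> * \<beta>) *\<^sub>R opA P v"
  have w: "has_mem_deriv P \<eta> w" "w \<in> mem_space P" using *(7) has_mem_derivD(1) by (auto simp: w_def)
  have va: "v \<in> Dp a" by (rule dom_pow_mono(1)[OF domA(1)[OF *(2)]]) (use params in auto)
  have ua: "u \<in> Dp (a / 2)" by (rule dom_half[OF *(3)])
  have half: "cinner (opA P x) y = cinner (pw (1/2) x) (pw (1/2) y)" if "x \<in> domA P" "y \<in> Dp (1/2)" for x y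
    using pw_inner_shift[OF domA(1)[OF that(1)] domA_half[OF that(1)] dom_pow_0(1) that(2)]
    by (simp add: domA(2)[OF that(1)] dom_pow_0)
  have ahalf: "cinner (pw a x) u = cinner (Ah x) (Ah u)" if "x \<in> Dp a" for x
    using pw_inner_shift[OF that dom_pow_mono(1)[OF that, of "a/2"] dom_pow_0(1) ua] params
    by (simp add: dom_pow_0)
  define X where "X = pw (1/2) v" define Y where "Y = pw (1/2) p"
  define U where "U = pw (1/2) u" define T where "T = pw (1/2) q"
  have 1: "Re (cinner W u) = - \<alpha> * Re (cinner X U) + \<gamma> * \<beta> * Re (cinner Y U)
      + 1 / \<delta> * Re (cinner (Ah v) (Ah u)) - Re (cinner (Ah m) (Ah u))"
    unfolding W_def X_def Y_def U_def
    by (simp add: cinner_simps half *(2-5) ahalf va *(8)[folded m_def] zeta)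
  have 2: "Re (cinner Q q) = - \<beta> * Re (cinner Y T) + \<gamma> * \<beta> * Re (cinner X T)"
    unfolding Q_def X_def Y_def T_def by (simp add: cinner_simps half *(2-5))
  have 3: "memory_form (evol_op P Z) Z = Re (cinner (Ah u) (Ah m)) - \<delta> / 2 * memory_inner \<eta> \<eta>"
    using memory_inner_diff_left[OF mem_const[OF ua] w(2) *(6)] memory_inner_const[OF ua *(6)] memory_inner_deriv[OF *(6) w(1)]
    by (simp add: *(1) w_def m_def)
  have 4: "mech_form (evol_op P Z) Z = \<alpha>\<^sub>1 * Re (cinner U X) - 1 / \<delta> * Re (cinner (Ah u) (Ah v))
     + Re (cinner W u) + \<beta> * Re (cinner (\<gamma> *\<^sub>R U - T) (\<gamma> *\<^sub>R X - Y)) + Re (cinner Q q)"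
    using params by (simp add: *(1) X_def Y_def U_def T_def W_def[unfolded m_def] Q_def cinner_scaleR_left)
  have "mech_form (evol_op P Z) Z = - Re (cinner (Ah u) (Ah m))"
    unfolding 4 1 2
    by (simp add: cinner_simps Re_cinner_commute[of U] Re_cinner_commute[of T] Re_cinner_commute[of "Ah u"]
        alpha1_def power2_eq_square algebra_simps)
  then show ?thesis
    using energy_form_eq[OF evol_op_in[OF assms] evol_dom_in[OF assms]] 3 by (simp add: *(1))
qed

section \<open>Passage to the closure of the evolution operator\<close>

lemma evol_opclosure:
  assumes "Z \<in> evol_dom P"
  shows "evol_op_closure P Z (evol_op P Z)"
proof -
  have "N (state_diff X X) = 0" if "X \<in> V" for X
    using that psd_form_diff(1)[OF psd_form_energy_form that that state_diff_in[OF that that]] by (simp add: N_eq)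
  then show ?thesis
    unfolding evol_op_closure_def using evol_dom_in[OF assms] evol_op_in[OF assms] assms
    by (intro conjI exI[of _ "\<lambda>_. Z"]) simp_all
qed

text \<open>Both sides are limits along the sequence that defines the closure, so the closure can be
  used without a description of its domain.\<close>

lemma closure_bounded_functional:
  assumes "bounded_functional l" "bounded_functional l'" and eq: "\<And>Z. Z \<in> evol_dom P \<Longrightarrow> l (evol_op P Z) = l' Z"
    and XY: "evol_op_closure P X Y"
  shows "l Y = l' X"
proof -
  obtain Z where V: "X \<in> V" "Y \<in> V" and Z: "\<And>n. Z n \<in> evol_dom P"
    "(\<lambda>n. N (state_diff (Z n) X)) \<longlonglongrightarrow> 0" "(\<lambda>n. N (state_diff (evol_op P (Z n)) Y)) \<longlonglongrightarrow> 0"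
    using XY by (auto simp: evol_op_closure_def)
  have "(\<lambda>n. l (evol_op P (Z n))) \<longlonglongrightarrow> l Y"
    by (rule bounded_functional_tendsto[OF assms(1) evol_op_in[OF Z(1)] V(2) Z(3)])
  moreover have "(\<lambda>n. l' (Z n)) \<longlonglongrightarrow> l' X"
    by (rule bounded_functional_tendsto[OF assms(2) evol_dom_in[OF Z(1)] V(1) Z(2)])
  ultimately show ?thesis using eq[OF Z(1)] by (simp add: LIMSEQ_unique)
qed

text \<open>The energy form converges by \<open>psd_form_tendsto\<close>; the memory form does so
  along the same sequence because the energy dominates it.\<close>

lemma closure_dissipation:
  assumes XY: "evol_op_closure P X Y"
  shows "energy_form Y X = - (\<delta> / 2) * memory_form X X"
proof -
  obtain Z where V: "X \<in> V" "Y \<in> V" and Z: "\<And>n. Z n \<in> evol_dom P"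
    "(\<lambda>n. N (state_diff (Z n) X)) \<longlonglongrightarrow> 0" "(\<lambda>n. N (state_diff (evol_op P (Z n)) Y)) \<longlonglongrightarrow> 0"
    using XY by (auto simp: evol_op_closure_def)
  have in': "\<And>n. Z n \<in> V" "\<And>n. evol_op P (Z n) \<in> V" using evol_dom_in evol_op_in Z(1) by auto
  have 1: "(\<lambda>n. energy_form (evol_op P (Z n)) (Z n)) \<longlonglongrightarrow> energy_form Y X"
    by (rule psd_form_tendsto[OF psd_form_energy_form in'(2,1) V(2,1)]) (use Z in \<open>simp_all add: N_eq\<close>)
  have m0: "(\<lambda>n. sqrt (memory_form (state_diff (Z n) X) (state_diff (Z n) X))) \<longlonglongrightarrow> 0"
  proof (rule Lim_null_comparison[OF always_eventually[OF allI] Z(2)])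
    fix n
    show "norm (sqrt (memory_form (state_diff (Z n) X) (state_diff (Z n) X))) \<le> N (state_diff (Z n) X)"
      using memory_form_le[OF state_diff_in[OF in'(1) V(1)]]
        sformD(4)[OF psd_form_memory_form state_diff_in[OF in'(1) V(1)] state_diff_in[OF in'(1) V(1)]]
      by (simp add: N_eq)
  qed
  have 2: "(\<lambda>n. memory_form (Z n) (Z n)) \<longlonglongrightarrow> memory_form X X"
    by (rule psd_form_tendsto[OF psd_form_memory_form in'(1,1) V(1,1) m0 m0])
  have "(\<lambda>n. energy_form (evol_op P (Z n)) (Z n)) \<longlonglongrightarrow> - (\<delta> / 2) * memory_form X X"
    unfolding dissipation[OF Z(1)] by (intro tendsto_mult tendsto_const 2)
  with 1 show ?thesis by (rule LIMSEQ_unique)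
qed

text \<open>Orbits are known to stay in the graph of the closure, not in \<open>evol_dom\<close>, so
  the modal equations are needed there; each is an identity between bounded functionals.\<close>

lemma closure_coeff:
  assumes XY: "evol_op_closure P X Y" and T: "part T"
  shows "T (cv k Y) = T (cu k X)" "T (cp k Y) = T (cq k X)"
    "T (cu k Y) = (- (\<alpha> * \<xi> k * T (cv k X)) + \<gamma> * \<beta> * \<xi> k * T (cp k X) + \<xi> k powr a / \<delta> * T (cv k X) - \<xi> k powr a * T (cm k X)) / \<rho>"
    "T (cq k Y) = (- (\<beta> * \<xi> k * T (cp k X)) + \<gamma> * \<beta> * \<xi> k * T (cv k X)) / \<mu>"
    "T (cm k Y) = T (cu k X) / \<delta> - \<delta> * T (cm k X)"
proof -
  note L = bounded_functional_coeff[OF T, of k]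
  note pd = partD[OF T]
  show "T (cv k Y) = T (cu k X)"
    by (rule closure_bounded_functional[OF L(1) L(2) _ XY]) (simp add: evol_coeff)
  show "T (cp k Y) = T (cq k X)"
    by (rule closure_bounded_functional[OF L(3) L(4) _ XY]) (simp add: evol_coeff)
  have m: "T (of_real c * z) = c * T z" "T (of_real c * of_real d * z) = c * d * T z"
    "T (of_real c * of_real d * of_real e * z) = c * d * e * T z" "T (of_real c / of_real d * z) = c / d * T z" for c d e z
    using pd(2)[of c z] pd(2)[of "c * d" z] pd(2)[of "c * d * e" z] pd(2)[of "c / d" z] by auto
  define lu where "lu = (\<lambda>X. ((- \<alpha> * \<xi> k + \<xi> k powr a / \<delta>) / \<rho>) * T (cv k X) + 1 * (((\<gamma> * \<beta> * \<xi> k) / \<rho>) * T (cp k X) + (- (\<xi> k powr a) / \<rho>) * T (cm k X)))"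
  have "T (cu k Y) = lu X"
  proof (rule closure_bounded_functional[OF L(2) _ _ XY])
    show "bounded_functional lu" unfolding lu_def by (intro bounded_functional_comb L)
    show "T (cu k (evol_op P Z)) = lu Z" if "Z \<in> evol_dom P" for Z
      unfolding evol_coeff(3)[OF that] lu_def pd(1,4,5,6) m using params \<delta> by (simp add: field_simps)
  qed
  then show "T (cu k Y) = (- (\<alpha> * \<xi> k * T (cv k X)) + \<gamma> * \<beta> * \<xi> k * T (cp k X) + \<xi> k powr a / \<delta> * T (cv k X) - \<xi> k powr a * T (cm k X)) / \<rho>"
    by (simp add: lu_def add_divide_distrib diff_divide_distrib algebra_simps)
  define lq where "lq = (\<lambda>X. (- \<beta> * \<xi> k / \<mu>) * T (cp k X) + (\<gamma> * \<beta> * \<xi> k / \<mu>) * T (cv k X))"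
  have "T (cq k Y) = lq X"
  proof (rule closure_bounded_functional[OF L(4) _ _ XY])
    show "bounded_functional lq" unfolding lq_def by (intro bounded_functional_comb L)
    show "T (cq k (evol_op P Z)) = lq Z" if "Z \<in> evol_dom P" for Z
      unfolding evol_coeff(4)[OF that] lq_def pd(1,4,5,6) m using params \<delta> by (simp add: field_simps)
  qed
  then show "T (cq k Y) = (- (\<beta> * \<xi> k * T (cp k X)) + \<gamma> * \<beta> * \<xi> k * T (cv k X)) / \<mu>"
    by (simp add: lq_def add_divide_distrib diff_divide_distrib algebra_simps)
  define lm where "lm = (\<lambda>X. (1 / \<delta>) * T (cu k X) + (- \<delta>) * T (cm k X))"
  have "T (cm k Y) = lm X"
  proof (rule closure_bounded_functional[OF L(5) _ _ XY])
    show "bounded_functional lm" unfolding lm_def by (intro bounded_functional_comb L)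
    show "T (cm k (evol_op P Z)) = lm Z" if "Z \<in> evol_dom P" for Z
      unfolding evol_coeff(5)[OF that] lm_def pd(1,4,5,6) m by simp
  qed
  then show "T (cm k Y) = T (cu k X) / \<delta> - \<delta> * T (cm k X)" by (simp add: lm_def)
qed

end

section \<open>Orbits of the semigroup\<close>

lemma state_eq_refl: "state_eq X X"
  by (cases X) simp

lemma state_eq_sym: "state_eq X Y \<Longrightarrow> state_eq Y X"
  by (cases X; cases Y) (auto elim: eventually_mono)

lemma state_eq_trans: "state_eq X Y \<Longrightarrow> state_eq Y Z \<Longrightarrow> state_eq X Z"
  by (cases X; cases Y; cases Z) (auto elim: eventually_elim2)

lemma state_eq_add: "state_eq X X' \<Longrightarrow> state_eq Y Y' \<Longrightarrow> state_eq (state_add X Y) (state_add X' Y')"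
  by (cases X; cases Y; cases X'; cases Y') (auto elim: eventually_elim2)

lemma state_eq_scale: "state_eq X X' \<Longrightarrow> state_eq (state_scale c X) (state_scale c X')"
  by (cases X; cases X') (auto elim: eventually_mono)

lemma state_eq_diff: "state_eq X X' \<Longrightarrow> state_eq Y Y' \<Longrightarrow> state_eq (state_diff X Y) (state_diff X' Y')"
  by (simp add: state_diff_def state_eq_add state_eq_scale)

lemma state_diff_swap:
  "state_scale (complex_of_real r) (state_diff X Y) = state_scale (complex_of_real (- r)) (state_diff Y X)"
  by (cases X; cases Y) (simp add: state_diff_def scaleC_minus1 scaleC_of_real algebra_simps del: of_real_minus)

lemma state_diff_split: "state_diff X Z = state_add (state_diff X Y) (state_diff Y Z)"
  by (cases X; cases Y; cases Z) (simp add: state_diff_def scaleC_minus1)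

text \<open>An equality of representatives, not merely almost everywhere; with X and Y two points of
  an orbit it supports the expansion in \<open>energy_orbit_deriv\<close>.\<close>

lemma state_add_recover:
  "r \<noteq> 0 \<Longrightarrow> X = state_add Y (state_scale (complex_of_real r) (state_scale (complex_of_real (1 / r)) (state_diff X Y)))"
  by (cases X; cases Y) (simp add: state_diff_def scaleC_minus1 scaleC_of_real del: of_real_divide)

context coercive_system
begin

lemma N_dist_commute: "X \<in> V \<Longrightarrow> Y \<in> V \<Longrightarrow> N (state_diff X Y) = N (state_diff Y X)"
proof -
  assume XY: "X \<in> V" "Y \<in> V"
  have "rscale 1 (state_diff X Y) = state_diff X Y" by (cases "state_diff X Y") simp
  then have "state_diff X Y = rscale (- 1) (state_diff Y X)" using state_diff_swap[of 1 X Y] by simp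
  then show ?thesis using N_rscale[OF state_diff_in[OF XY(2,1)], of "- 1"] by simp
qed

lemma N_dist_triangle: "X \<in> V \<Longrightarrow> Y \<in> V \<Longrightarrow> Z \<in> V \<Longrightarrow> N (state_diff X Z) \<le> N (state_diff X Y) + N (state_diff Y Z)"
  unfolding state_diff_split[of X Z Y] by (rule N_triangle) (simp_all add: state_diff_in)

lemma N_diff_self: "X \<in> V \<Longrightarrow> N (state_diff X X) = 0"
  using psd_form_diff(1)[OF psd_form_energy_form, of X X "state_diff X X"] by (simp add: N_eq state_diff_in)

text \<open>Boundedness makes a functional vanish on states of norm zero, so it does not see null
  sets of the memory variable.\<close>

lemma bounded_functional_state_eq:
  assumes "bounded_functional l" "X \<in> V" "Y \<in> V" "state_eq X Y"
  shows "l X = l Y"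
proof -
  obtain C where C: "\<And>X. X \<in> V \<Longrightarrow> \<bar>l X\<bar> \<le> C * N X" using assms(1) unfolding bounded_functional_def by blast
  have "N (state_diff X Y) = N (state_diff Y Y)"
    using assms by (intro state_eq_N state_diff_in state_eq_diff state_eq_refl)
  then have "\<bar>l X - l Y\<bar> \<le> 0"
    using C[OF state_diff_in[OF assms(2,3)]] bounded_functional_diff[OF assms(1-3)] N_diff_self[OF assms(3)] by simp
  then show ?thesis by simp
qed

abbreviation zero_state :: "'h state" where "zero_state \<equiv> (0, 0, 0, 0, \<lambda>_. 0)"

lemma zero_state_in: "zero_state \<in> V"
  by (rule stateI) (auto intro: dom_pow_zero mem_const)

end

locale coercive_semigroup = coercive_system P \<delta> \<kappa> for P :: "'h::separable_chilbert_space memory_system" and \<delta> \<kappa> :: real +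
  fixes S :: "real \<Rightarrow> 'h state \<Rightarrow> 'h state"
  assumes gen: "generates_contraction_semigroup P S"
begin

lemma sg: "contraction_semigroup P S"
  using gen by (simp add: generates_contraction_semigroup_def)

lemma gen_iff: "generator_graph P S X Y \<longleftrightarrow> evol_op_closure P X Y"
  using gen unfolding generates_contraction_semigroup_def by blast

lemma S_in: "t \<ge> 0 \<Longrightarrow> X \<in> V \<Longrightarrow> S t X \<in> V"
  and S_lin: "t \<ge> 0 \<Longrightarrow> X \<in> V \<Longrightarrow> Y \<in> V \<Longrightarrow>
     state_eq (S t (state_add (state_scale c X) Y)) (state_add (state_scale c (S t X)) (S t Y))"
  and S_0: "X \<in> V \<Longrightarrow> state_eq (S 0 X) X"
  and S_add: "r \<ge> 0 \<Longrightarrow> t \<ge> 0 \<Longrightarrow> X \<in> V \<Longrightarrow> state_eq (S (r + t) X) (S r (S t X))"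
  and S_cont: "X \<in> V \<Longrightarrow> ((\<lambda>t. N (state_diff (S t X) X)) \<longlongrightarrow> 0) (at_right 0)"
  and S_contr: "t \<ge> 0 \<Longrightarrow> X \<in> V \<Longrightarrow> N (S t X) \<le> N X"
  using sg unfolding contraction_semigroup_def by blast+

lemma S_zero: "t \<ge> 0 \<Longrightarrow> state_eq (S t zero_state) zero_state"
proof -
  assume t: "t \<ge> 0"
  have "state_add (state_scale 1 zero_state) zero_state = zero_state" by simp
  then have "state_eq (S t zero_state) (state_add (state_scale 1 (S t zero_state)) (S t zero_state))"
    using S_lin[OF t zero_state_in zero_state_in, of 1] by simp
  then show ?thesis by (cases "S t zero_state") simp
qed

lemma S_diff: "t \<ge> 0 \<Longrightarrow> X \<in> V \<Longrightarrow> Y \<in> V \<Longrightarrow> state_eq (S t (state_diff X Y)) (state_diff (S t X) (S t Y))"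
proof -
  assume t: "t \<ge> 0" "X \<in> V" "Y \<in> V"
  have comm: "state_diff X Y = state_add (state_scale (-1) Y) X" for X Y :: "'h state"
    by (cases X; cases Y) (simp add: state_diff_def fun_eq_iff add.commute)
  show ?thesis unfolding comm using t by (intro S_lin)
qed

lemma S_scale: "t \<ge> 0 \<Longrightarrow> X \<in> V \<Longrightarrow> state_eq (S t (state_scale c X)) (state_scale c (S t X))"
proof -
  assume t: "t \<ge> 0" "X \<in> V"
  have z: "state_add X zero_state = X" for X :: "'h state" by (cases X) simp
  have "state_eq (S t (state_add (state_scale c X) zero_state)) (state_add (state_scale c (S t X)) (S t zero_state))"
    using t zero_state_in by (intro S_lin)
  moreover have "state_eq (state_add (state_scale c (S t X)) (S t zero_state)) (state_add (state_scale c (S t X)) zero_state)"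
    using S_zero[OF t(1)] by (intro state_eq_add state_eq_refl)
  ultimately show ?thesis unfolding z by (rule state_eq_trans)
qed

abbreviation diff_quot :: "'h state \<Rightarrow> real \<Rightarrow> real \<Rightarrow> 'h state" where
  "diff_quot X t s \<equiv> rscale (1 / (s - t)) (state_diff (S s X) (S t X))"

lemma diff_quot_in: "t \<ge> 0 \<Longrightarrow> s \<ge> 0 \<Longrightarrow> X \<in> V \<Longrightarrow> diff_quot X t s \<in> V"
  by (intro state_scale_in state_diff_in S_in)

text \<open>The quotient between s and t is the semigroup at the earlier time applied to the
  quotient at 0, and the semigroup contracts. To the left of t the earlier time is s, and S t Y = S
  s (S h Y) leaves the additional error S h Y - Y.\<close>

lemma diff_quot_bound:
  assumes XY: "X \<in> V" "Y \<in> V" and st: "s \<ge> 0" "t \<ge> 0" "s \<noteq> t"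
  defines "h \<equiv> \<bar>s - t\<bar>"
  shows "N (state_diff (diff_quot X t s) (S t Y))
     \<le> N (state_diff (rscale (1 / h) (state_diff (S h X) X)) Y) + N (state_diff (S h Y) Y)"
proof -
  have h: "h > 0" using st by (simp add: h_def)
  define Q where "Q = rscale (1 / h) (state_diff (S h X) X)"
  have Sh: "S h X \<in> V" "S h Y \<in> V" using h XY by (auto intro: S_in)
  have Q: "Q \<in> V" unfolding Q_def by (intro state_scale_in state_diff_in Sh XY)
  have SQ: "state_eq (S r Q) (rscale (1 / h) (state_diff (S r (S h X)) (S r X)))" if "r \<ge> 0" for r
    unfolding Q_def
    by (rule state_eq_trans[OF S_scale[OF that state_diff_in[OF Sh(1) XY(1)]] state_eq_scale[OF S_diff[OF that Sh(1) XY(1)]]])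
  have nn: "N (state_diff (S h Y) Y) \<ge> 0" using N_nonneg state_diff_in Sh XY by blast
  show ?thesis unfolding Q_def[symmetric]
  proof (cases "s > t")
    case True
    then have hs: "h = s - t" "s = t + h" by (auto simp: h_def)
    have "state_eq (S s X) (S t (S h X))" unfolding hs(2) using st h XY by (intro S_add) auto
    then have "state_eq (diff_quot X t s) (rscale (1 / h) (state_diff (S t (S h X)) (S t X)))"
      unfolding hs(1)[symmetric] by (intro state_eq_scale state_eq_diff state_eq_refl)
    then have "state_eq (diff_quot X t s) (S t Q)" using SQ[OF st(2)] state_eq_trans state_eq_sym by blast
    then have "state_eq (state_diff (diff_quot X t s) (S t Y)) (S t (state_diff Q Y))"
      using S_diff[OF st(2) Q XY(2)] state_eq_diff[OF _ state_eq_refl] state_eq_trans state_eq_sym by blast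
    then have "N (state_diff (diff_quot X t s) (S t Y)) = N (S t (state_diff Q Y))"
      using st XY Q by (intro state_eq_N state_diff_in diff_quot_in S_in) assumption+
    also have "\<dots> \<le> N (state_diff Q Y)" using st XY Q by (intro S_contr state_diff_in)
    finally show "N (state_diff (diff_quot X t s) (S t Y)) \<le> N (state_diff Q Y) + N (state_diff (S h Y) Y)" using nn by simp
  next
    case False
    then have hs: "h = t - s" "t = s + h" using st by (auto simp: h_def)
    have e: "state_eq (S t Z) (S s (S h Z))" if "Z \<in> V" for Z
      unfolding hs(2) using st h that by (intro S_add) auto
    have "diff_quot X t s = rscale (1 / h) (state_diff (S t X) (S s X))"
      using state_diff_swap[of "1 / (s - t)"] by (simp add: hs(1) minus_divide_right)
    then have "state_eq (diff_quot X t s) (rscale (1 / h) (state_diff (S s (S h X)) (S s X)))"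
      using e[OF XY(1)] by (simp only:) (intro state_eq_scale state_eq_diff state_eq_refl)
    then have "state_eq (diff_quot X t s) (S s Q)" using SQ[OF st(1)] state_eq_trans state_eq_sym by blast
    then have "state_eq (state_diff (diff_quot X t s) (S t Y)) (state_diff (S s Q) (S s (S h Y)))"
      using e[OF XY(2)] by (intro state_eq_diff)
    then have "state_eq (state_diff (diff_quot X t s) (S t Y)) (S s (state_diff Q (S h Y)))"
      using S_diff[OF st(1) Q Sh(2)] state_eq_trans state_eq_sym by blast
    then have "N (state_diff (diff_quot X t s) (S t Y)) = N (S s (state_diff Q (S h Y)))"
      using st XY Q Sh by (intro state_eq_N state_diff_in diff_quot_in S_in[of s] S_in[of t]) assumption+
    also have "\<dots> \<le> N (state_diff Q (S h Y))" using st Sh Q by (intro S_contr state_diff_in)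
    also have "\<dots> \<le> N (state_diff Q Y) + N (state_diff Y (S h Y))"
      using Q XY Sh by (intro N_dist_triangle)
    also have "N (state_diff Y (S h Y)) = N (state_diff (S h Y) Y)" using XY Sh by (intro N_dist_commute)
    finally show "N (state_diff (diff_quot X t s) (S t Y)) \<le> N (state_diff Q Y) + N (state_diff (S h Y) Y)" .
  qed
qed

text \<open>Both errors of \<open>diff_quot_bound\<close> vanish as h = |s - t| tends to 0 from the
  right: one by the definition of the generator, the other by strong continuity.\<close>

lemma diff_quot_tendsto:
  assumes XY: "generator_graph P S X Y" and t: "t \<ge> 0"
  shows "((\<lambda>s. N (state_diff (diff_quot X t s) (S t Y))) \<longlongrightarrow> 0) (at t within {0..})"
proof -
  have V: "X \<in> V" "Y \<in> V" and
    G: "((\<lambda>h. N (state_diff (rscale (1 / h) (state_diff (S h X) X)) Y)) \<longlongrightarrow> 0) (at_right 0)"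
    using XY by (auto simp: generator_graph_def)
  have lim: "((\<lambda>h. N (state_diff (rscale (1 / h) (state_diff (S h X) X)) Y) + N (state_diff (S h Y) Y)) \<longlongrightarrow> 0) (at_right 0)"
    using tendsto_add[OF G S_cont[OF V(2)]] by simp
  have "filterlim (\<lambda>s. \<bar>s - t\<bar>) (at_right 0) (at t within {0..})"
    unfolding filterlim_at
    by (auto simp: eventually_at_filter intro!: tendsto_eq_intros)
  from filterlim_compose[OF lim this]
  have lim': "((\<lambda>s. N (state_diff (rscale (1 / \<bar>s - t\<bar>) (state_diff (S \<bar>s - t\<bar> X) X)) Y) + N (state_diff (S \<bar>s - t\<bar> Y) Y)) \<longlongrightarrow> 0) (at t within {0..})" .
  show ?thesis
  proof (rule Lim_null_comparison[OF _ lim'])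
    show "\<forall>\<^sub>F s in at t within {0..}. norm (N (state_diff (diff_quot X t s) (S t Y)))
        \<le> N (state_diff (rscale (1 / \<bar>s - t\<bar>) (state_diff (S \<bar>s - t\<bar> X) X)) Y) + N (state_diff (S \<bar>s - t\<bar> Y) Y)"
      unfolding eventually_at_filter
    proof (rule always_eventually, intro allI impI)
      fix s assume s: "s \<noteq> t" "s \<in> {0..}"
      have "N (state_diff (diff_quot X t s) (S t Y)) \<ge> 0"
        using s t V by (intro N_nonneg state_diff_in diff_quot_in S_in) auto
      then show "norm (N (state_diff (diff_quot X t s) (S t Y)))
        \<le> N (state_diff (rscale (1 / \<bar>s - t\<bar>) (state_diff (S \<bar>s - t\<bar> X) X)) Y) + N (state_diff (S \<bar>s - t\<bar> Y) Y)"
        using diff_quot_bound[OF V, of s t] s t by simp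
    qed
  qed
qed

text \<open>The quotient that defines the generator at S t X is the right difference quotient of the
  orbit at time t. This is the invariance of the domain of a generator, which
  \<open>evol_dom\<close> need not share.\<close>

lemma orbit_closure:
  assumes XY: "generator_graph P S X Y" and t: "t \<ge> 0"
  shows "evol_op_closure P (S t X) (S t Y)"
  unfolding gen_iff[symmetric] generator_graph_def
proof (intro conjI)
  have V: "X \<in> V" "Y \<in> V" using XY by (auto simp: generator_graph_def)
  show "S t X \<in> V" "S t Y \<in> V" using V t by (auto intro: S_in)
  have "filterlim (\<lambda>h. t + h) (at t within {0..}) (at_right 0)"
    unfolding filterlim_at
    using t by (auto simp: eventually_at_filter intro!: tendsto_eq_intros)
  from filterlim_compose[OF diff_quot_tendsto[OF XY t] this]
  have lim: "((\<lambda>h. N (state_diff (diff_quot X t (t + h)) (S t Y))) \<longlongrightarrow> 0) (at_right 0)" .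
  show "((\<lambda>h. N (state_diff (rscale (1 / h) (state_diff (S h (S t X)) (S t X))) (S t Y))) \<longlongrightarrow> 0) (at_right 0)"
  proof (rule Lim_transform_eventually[OF lim])
    show "\<forall>\<^sub>F h in at_right 0. N (state_diff (diff_quot X t (t + h)) (S t Y))
        = N (state_diff (rscale (1 / h) (state_diff (S h (S t X)) (S t X))) (S t Y))"
      unfolding eventually_at_filter
    proof (rule always_eventually, intro allI impI)
      fix h :: real assume "h \<noteq> 0" "h \<in> {0<..}"
      then have h: "h > 0" by simp
      have "state_eq (S (t + h) X) (S h (S t X))"
        using S_add[of h t X] h t V by (simp add: add.commute)
      then show "N (state_diff (diff_quot X t (t + h)) (S t Y))
        = N (state_diff (rscale (1 / h) (state_diff (S h (S t X)) (S t X))) (S t Y))"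
        using h t V
        by (intro state_eq_N state_diff_in state_scale_in S_in)
           (auto intro!: state_eq_diff state_eq_scale state_eq_refl)
    qed
  qed
qed

text \<open>For negative times, where \<open>S\<close> is unspecified, the difference quotient is replaced by \<open>X\<close>.\<close>

lemma diff_quot'_tendsto:
  assumes XY: "generator_graph P S X Y" and t: "t \<ge> 0"
  defines "Z \<equiv> \<lambda>s. if s \<ge> 0 then diff_quot X t s else X"
  shows "Z s \<in> V" "((\<lambda>s. N (state_diff (Z s) (S t Y))) \<longlongrightarrow> 0) (at t within {0..})"
proof -
  have V: "X \<in> V" "Y \<in> V" using XY by (auto simp: generator_graph_def)
  show "Z s \<in> V" unfolding Z_def using V diff_quot_in[OF t _ V(1), of s] by (cases "s \<ge> 0") simp_all
  show "((\<lambda>s. N (state_diff (Z s) (S t Y))) \<longlongrightarrow> 0) (at t within {0..})"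
    by (rule Lim_transform_eventually[OF diff_quot_tendsto[OF XY t]])
       (auto simp: eventually_at_filter Z_def)
qed

text \<open>The difference quotients converge in norm from both sides, and l is linear and
  continuous.\<close>

lemma bounded_functional_orbit_deriv:
  assumes l: "bounded_functional l" and XY: "generator_graph P S X Y" and t: "t \<ge> 0"
  shows "((\<lambda>s. l (S s X)) has_real_derivative l (S t Y)) (at t within {0..})"
proof -
  have V: "X \<in> V" "Y \<in> V" using XY by (auto simp: generator_graph_def)
  have lim: "((\<lambda>s. l (if s \<ge> 0 then diff_quot X t s else X)) \<longlongrightarrow> l (S t Y)) (at t within {0..})"
    by (rule bounded_functional_tendsto[OF l diff_quot'_tendsto(1)[OF XY t] S_in[OF t V(2)] diff_quot'_tendsto(2)[OF XY t]])
  show ?thesis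
    unfolding has_field_derivative_iff
  proof (rule Lim_transform_eventually[OF lim])
    have e: "l (diff_quot X t s) = (l (S s X) - l (S t X)) / (s - t)" if "s \<ge> 0" for s
    proof -
      have "l (diff_quot X t s) = 1 / (s - t) * l (state_diff (S s X) (S t X))"
        using l that t V unfolding bounded_functional_def by (meson S_in state_diff_in)
      then show ?thesis using bounded_functional_diff[OF l, of "S s X" "S t X"] that t V by (simp add: S_in)
    qed
    show "\<forall>\<^sub>F s in at t within {0..}. l (if s \<ge> 0 then diff_quot X t s else X) = (l (S s X) - l (S t X)) / (s - t)"
      unfolding eventually_at_filter by (rule always_eventually) (use e in auto)
  qed
qed

text \<open>With Q the difference quotient, S s X = S t X + (s - t) Q, so the quotient of the
  energies is twice the form at (Q, S t X) plus (s - t) times the form at (Q, Q).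
  \<open>closure_dissipation\<close> evaluates the limit of the first term.\<close>

lemma energy_orbit_deriv:
  assumes XY: "generator_graph P S X Y" and t: "t \<ge> 0"
  shows "((\<lambda>s. energy_form (S s X) (S s X)) has_real_derivative - \<delta> * memory_form (S t X) (S t X)) (at t within {0..})"
proof -
  have V: "X \<in> V" "Y \<in> V" using XY by (auto simp: generator_graph_def)
  define Z where "Z = (\<lambda>s. if s \<ge> 0 then diff_quot X t s else X)"
  have Z: "\<And>s. Z s \<in> V" "((\<lambda>s. N (state_diff (Z s) (S t Y))) \<longlongrightarrow> 0) (at t within {0..})"
    using diff_quot'_tendsto[OF XY t] by (auto simp: Z_def)
  note Z2 = Z(2)[unfolded N_eq]
  have St: "S t X \<in> V" "S t Y \<in> V" using t V by (auto intro: S_in)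
  have c: "((\<lambda>s. sqrt (energy_form (state_diff (S t X) (S t X)) (state_diff (S t X) (S t X)))) \<longlongrightarrow> 0) (at t within {0..})"
    using N_diff_self[OF St(1)] by (simp add: N_eq)
  have 1: "((\<lambda>s. energy_form (Z s) (S t X)) \<longlongrightarrow> energy_form (S t Y) (S t X)) (at t within {0..})"
    by (rule psd_form_tendsto[OF psd_form_energy_form Z(1) St(1) St(2,1) Z2 c])
  have 2: "((\<lambda>s. energy_form (Z s) (Z s)) \<longlongrightarrow> energy_form (S t Y) (S t Y)) (at t within {0..})"
    by (rule psd_form_tendsto[OF psd_form_energy_form Z(1) Z(1) St(2,2) Z2 Z2])
  have lim: "((\<lambda>s. 2 * energy_form (Z s) (S t X) + (s - t) * energy_form (Z s) (Z s)) \<longlongrightarrow> 2 * energy_form (S t Y) (S t X) + (t - t) * energy_form (S t Y) (S t Y)) (at t within {0..})"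
    by (intro tendsto_intros 1 2)
  have val: "2 * energy_form (S t Y) (S t X) + (t - t) * energy_form (S t Y) (S t Y) = - \<delta> * memory_form (S t X) (S t X)"
    using closure_dissipation[OF orbit_closure[OF XY t]] by simp
  show ?thesis
    unfolding has_field_derivative_iff
  proof (rule Lim_transform_eventually[OF lim[unfolded val]])
    have e: "2 * energy_form (diff_quot X t s) (S t X) + (s - t) * energy_form (diff_quot X t s) (diff_quot X t s) = (energy_form (S s X) (S s X) - energy_form (S t X) (S t X)) / (s - t)"
      if "s \<ge> 0" "s \<noteq> t" for s
    proof -
      have Q: "diff_quot X t s \<in> V" using that t V by (intro diff_quot_in)
      have "S s X = state_add (S t X) (rscale (s - t) (diff_quot X t s))"
        by (rule state_add_recover) (use that in simp)
      then have "energy_form (S s X) (S s X) = energy_form (S t X) (S t X) + 2 * (s - t) * energy_form (S t X) (diff_quot X t s) + (s - t)\<^sup>2 * energy_form (diff_quot X t s) (diff_quot X t s)"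
        using psd_form_square[OF psd_form_energy_form St(1) Q, of "s - t"] by simp
      moreover have "energy_form (S t X) (diff_quot X t s) = energy_form (diff_quot X t s) (S t X)" by (rule sformD(3)[OF psd_form_energy_form St(1) Q])
      ultimately show ?thesis using that by (simp add: field_simps power2_eq_square)
    qed
    show "\<forall>\<^sub>F s in at t within {0..}. 2 * energy_form (Z s) (S t X) + (s - t) * energy_form (Z s) (Z s) = (energy_form (S s X) (S s X) - energy_form (S t X) (S t X)) / (s - t)"
      unfolding eventually_at_filter by (rule always_eventually) (use e in \<open>auto simp: Z_def\<close>)
  qed
qed

lemma evol_generator: "X \<in> evol_dom P \<Longrightarrow> generator_graph P S X (evol_op P X)"
  unfolding gen_iff by (rule evol_opclosure)

section \<open>Modes of an orbit\<close>

sublocale mp: mode_params \<rho> \<mu> \<alpha> \<beta> \<gamma> \<delta> \<kappa> "\<xi> 0" "\<xi> 0 powr (a - 1)"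
  using params \<delta> \<kappa> \<xi>0 by unfold_locales auto

lemma ratio: "\<xi> k powr a / \<xi> k = \<xi> k powr (a - 1)"
  using \<xi>_pos[of k] by (simp add: powr_diff powr_one)

text \<open>The ratio \<xi>^(a-1) decreases in \<xi>, so its value at the lowest eigenvalue serves
  as the bound S; the last condition is \<open>coercive_mode\<close>.\<close>

lemma mode_ok: "mp.mode_ok (\<xi> k) (\<xi> k powr a)"
  unfolding mp.mode_ok_def
proof (intro conjI)
  have "\<xi> k powr a / \<xi> k \<le> \<xi> 0 powr (a - 1)"
    unfolding ratio by (rule powr_mono2') (use \<xi>0 \<xi>_mono params in auto)
  then show "\<xi> k powr a \<le> \<xi> 0 powr (a - 1) * \<xi> k" using \<xi>_pos[of k] by (simp add: field_simps)
qed (use \<xi>_mono \<xi>_pos[of k] coercive_mode in auto)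

text \<open>The derivative of a coefficient of S t X is that coefficient of S t Y, with Y the image
  of X, and \<open>closure_coeff\<close> expresses it through the coefficients of S t X.\<close>

lemma mode_sol:
  assumes X: "X \<in> evol_dom P" and T: "part T"
  shows "mp.mode_sol (\<xi> k) (\<xi> k powr a) (\<lambda>t. T (cv k (S t X))) (\<lambda>t. T (cu k (S t X)))
     (\<lambda>t. T (cp k (S t X))) (\<lambda>t. T (cq k (S t X))) (\<lambda>t. T (cm k (S t X)))"
  unfolding mp.mode_sol_def
proof (intro allI impI)
  fix t :: real assume t: "t \<ge> 0"
  note G = evol_generator[OF X]
  note d = bounded_functional_coeff[OF T, of k, THEN bounded_functional_orbit_deriv, OF G t]
  note c = closure_coeff[OF orbit_closure[OF G t] T, of k]
  show "((\<lambda>t. T (cv k (S t X))) has_real_derivative T (cu k (S t X))) (at t within {0..}) \<and>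
     ((\<lambda>t. T (cu k (S t X))) has_real_derivative mp.fu (\<xi> k) (\<xi> k powr a) (T (cv k (S t X))) (T (cp k (S t X))) (T (cm k (S t X)))) (at t within {0..}) \<and>
     ((\<lambda>t. T (cp k (S t X))) has_real_derivative T (cq k (S t X))) (at t within {0..}) \<and>
     ((\<lambda>t. T (cq k (S t X))) has_real_derivative mp.fq (\<xi> k) (T (cv k (S t X))) (T (cp k (S t X)))) (at t within {0..}) \<and>
     ((\<lambda>t. T (cm k (S t X))) has_real_derivative mp.fm (T (cu k (S t X))) (T (cm k (S t X)))) (at t within {0..})"
    using d unfolding c mp.fu_def mp.fq_def mp.fm_def by blast
qed

lemma coeff_0:
  assumes X: "X \<in> V" and T: "part T"
  shows "T (cv k (S 0 X)) = T (cv k X)" "T (cu k (S 0 X)) = T (cu k X)" "T (cp k (S 0 X)) = T (cp k X)"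
    "T (cq k (S 0 X)) = T (cq k X)" "T (cm k (S 0 X)) = T (cm k X)"
  using bounded_functional_coeff[OF T, of k, THEN bounded_functional_state_eq, OF S_in[OF order_refl X] X S_0[OF X]] by auto

end

section \<open>The decay rate\<close>
text \<open>From ln y \<le> y - 1 at y = c x/r; the constant is the maximum of x^r e^(-c x) up to
  the factor e^(-r).\<close>

lemma exp_le_powr_neg:
  fixes c r x :: real
  assumes "c > 0" "r > 0" "x > 0"
  shows "exp (- c * x) \<le> (r / c) powr r * x powr (- r)"
proof -
  have "ln (c * x / r) \<le> c * x / r - 1" using assms by (intro ln_le_minus_one) auto
  then have "r * ln (c * x / r) \<le> r * (c * x / r - 1)" using assms by (intro mult_left_mono) auto
  also have "\<dots> \<le> c * x" using assms by (simp add: field_simps)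
  finally have "exp (- c * x) \<le> exp (- (r * ln (c * x / r)))" by simp
  also have "\<dots> = exp (r * ln (r / c)) * exp (- r * ln x)"
    using assms by (simp add: ln_mult ln_div algebra_simps flip: exp_add)
  finally show ?thesis using assms by (simp add: powr_def)
qed

context coercive_semigroup
begin

section \<open>The upper bound\<close>

abbreviation "r \<equiv> 1 / (1 - a)"

lemma r_pos: "r > 0" using params by simp

lemma cmod_parts: "(cmod z)\<^sup>2 = (Re z)\<^sup>2 + (Im z)\<^sup>2"
  by (simp add: cmod_power2)

lemma mode_energy_mode_norm:
  "mode_energy k X = mp.mode_norm (\<xi> k) (\<xi> k powr a) (Re (cv k X)) (Re (cu k X)) (Re (cp k X)) (Re (cq k X)) (Re (cm k X))
    + mp.mode_norm (\<xi> k) (\<xi> k powr a) (Im (cv k X)) (Im (cu k X)) (Im (cp k X)) (Im (cq k X)) (Im (cm k X))"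
  by (simp add: mode_energy_def mode_mech_def mp.mode_norm_def cmod_parts algebra_simps)

text \<open>The factor e^(-c s t) with s = \<xi>^(a-1) is slow in high modes, but it comes with
  1/\<xi> = s^r: bounding it by a multiple of (s t)^(-r) cancels \<xi> and leaves a rate common to
  all modes.\<close>

lemma mode_bound:
  obtains C where "C > 0" "\<And>X k t. X \<in> evol_dom P \<Longrightarrow> t > 0 \<Longrightarrow>
     mode_mech k (S t X) \<le> C * t powr (- r) * (mode_energy k X + mode_energy k (evol_op P X))"
proof -
  obtain c C where c: "c > 0" and C: "C > 0" and md:
    "\<And>\<xi> b v u p q m t. mp.mode_ok \<xi> b \<Longrightarrow> mp.mode_sol \<xi> b v u p q m \<Longrightarrow> t \<ge> 0 \<Longrightarrow>
     \<xi> * (v t)\<^sup>2 + (u t)\<^sup>2 + \<xi> * (p t)\<^sup>2 + (q t)\<^sup>2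
       \<le> C * (exp (- c * t) * mp.mode_norm \<xi> b (v 0) (u 0) (p 0) (q 0) (m 0)
          + exp (- c * (b / \<xi>) * t) / \<xi> *
            mp.mode_norm \<xi> b (u 0) (mp.fu \<xi> b (v 0) (p 0) (m 0)) (q 0) (mp.fq \<xi> (v 0) (p 0)) (mp.fm (u 0) (m 0)))"
    using mp.mode_decay by blast
  define K where "K = (r / c) powr r"
  have K: "K > 0" using c r_pos by (simp add: K_def)
  show thesis
  proof (rule that[of "C * K"])
    show "C * K > 0" using C K by simp
    fix X k and t :: real assume X: "X \<in> evol_dom P" and t: "t > 0"
    define Y where "Y = evol_op P X"
    have XV: "X \<in> V" by (rule evol_dom_in[OF X])
    have cl: "evol_op_closure P X Y" unfolding Y_def by (rule evol_opclosure[OF X])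
    define b where "b = \<xi> k powr a"
    have part: "\<xi> k * (T (cv k (S t X)))\<^sup>2 + (T (cu k (S t X)))\<^sup>2 + \<xi> k * (T (cp k (S t X)))\<^sup>2 + (T (cq k (S t X)))\<^sup>2
      \<le> C * (exp (- c * t) * mp.mode_norm (\<xi> k) b (T (cv k X)) (T (cu k X)) (T (cp k X)) (T (cq k X)) (T (cm k X))
         + exp (- c * (b / \<xi> k) * t) / \<xi> k * mp.mode_norm (\<xi> k) b (T (cv k Y)) (T (cu k Y)) (T (cp k Y)) (T (cq k Y)) (T (cm k Y)))"
      if T: "part T" for T
      using md[OF mode_ok mode_sol[OF X T], of t k] t
      unfolding coeff_0[OF XV T] closure_coeff[OF cl T] mp.fu_def mp.fq_def mp.fm_def b_def by simp
    have pr: "part Re" "part Im" by (auto simp: part_def)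
    have "mode_mech k (S t X) \<le> C * (exp (- c * t) * mode_energy k X + exp (- c * (b / \<xi> k) * t) / \<xi> k * mode_energy k Y)"
      using add_mono[OF part[OF pr(1)] part[OF pr(2)]]
      unfolding mode_energy_mode_norm mode_mech_def cmod_parts b_def[symmetric] by (simp add: algebra_simps)
    also have "\<dots> \<le> C * (K * t powr (- r) * mode_energy k X + K * t powr (- r) * mode_energy k Y)"
    proof (intro mult_left_mono add_mono mult_right_mono)
      show "exp (- c * t) \<le> K * t powr (- r)"
        unfolding K_def by (rule exp_le_powr_neg) (use c t r_pos in auto)
      define s where "s = b / \<xi> k"
      have s: "s > 0" using \<xi>_pos[of k] by (simp add: s_def b_def)
      have sr: "s powr r = 1 / \<xi> k"
      proof -
        have "s powr r = \<xi> k powr ((a - 1) * r)" by (simp add: s_def b_def ratio powr_powr)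
        also have "(a - 1) * r = - 1" using params by (simp add: field_simps)
        finally show ?thesis using \<xi>_pos[of k] by (simp add: powr_minus_divide powr_one)
      qed
      have "exp (- c * (s * t)) \<le> K * (s * t) powr (- r)"
        unfolding K_def by (rule exp_le_powr_neg) (use c t s r_pos in auto)
      also have "\<dots> = K * t powr (- r) * \<xi> k"
        using s t sr \<xi>_pos[of k] by (simp add: powr_mult powr_minus_divide)
      finally show "exp (- c * (b / \<xi> k) * t) / \<xi> k \<le> K * t powr (- r)"
        using \<xi>_pos[of k] by (simp add: s_def field_simps)
    qed (use C mode_mech_nonneg[of k X] mode_mech_le_mode_energy[of k X] mode_mech_nonneg[of k Y] mode_mech_le_mode_energy[of k Y] in auto)
    finally show "mode_mech k (S t X) \<le> C * K * t powr (- r) * (mode_energy k X + mode_energy k (evol_op P X))"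
      by (simp add: Y_def algebra_simps)
  qed
qed

text \<open>The full energy is recovered from its balance on [t/2, t] only, where the bound on the
  mechanical part is at most 2^r times its value at t. On [0, t/2], where that bound is singular at
  0, contractivity is enough.\<close>

lemma upper_rate:
  "\<exists>C>0. \<forall>X\<in>evol_dom P. \<forall>t\<ge>1. N (S t X) \<le> C * t powr (- (1 / (2 - 2 * a))) * graph_norm P X"
proof -
  obtain C1 where C1: "C1 > 0" and mode_mech: "\<And>X k t. X \<in> evol_dom P \<Longrightarrow> t > 0 \<Longrightarrow>
     mode_mech k (S t X) \<le> C1 * t powr (- r) * (mode_energy k X + mode_energy k (evol_op P X))" using mode_bound by blast
  obtain C2 where C2: "C2 > 0" and mode_energy: "\<And>X n. X \<in> V \<Longrightarrow> (\<Sum>k<n. mode_energy k X) \<le> C2 * energy_form X X" using mode_energy_sum_le by blast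
  obtain C3 where C3: "C3 > 0" and sBh: "\<And>X D. X \<in> V \<Longrightarrow> (\<And>n. (\<Sum>k<n. mode_mech k X) \<le> D) \<Longrightarrow> mech_form X X \<le> C3 * D"
    using mech_form_le_mode_mech by blast
  define C4 where "C4 = C3 * (C1 * C2)"
  define K where "K = (r / (\<delta> / 2)) powr r"
  define C5 where "C5 = C4 * 2 powr r + K"
  have C45: "C4 > 0" "K > 0" "C5 > 0"
    using C1 C2 C3 \<delta> r_pos by (auto simp: C4_def C5_def K_def intro!: add_pos_pos)
  have main: "energy_form (S t X) (S t X) \<le> C5 * t powr (- r) * (graph_norm P X)\<^sup>2"
    if X: "X \<in> evol_dom P" and t: "t \<ge> 1" for X t
  proof -
    define Y where "Y = evol_op P X"
    have V: "X \<in> V" "Y \<in> V" using evol_dom_in evol_op_in X by (auto simp: Y_def)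
    have G: "generator_graph P S X Y" unfolding Y_def by (rule evol_generator[OF X])
    define D where "D = energy_form X X + energy_form Y Y"
    have nn: "energy_form X X \<ge> 0" "energy_form Y Y \<ge> 0" using sformD(4)[OF psd_form_energy_form] V by auto
    have "D = (N X)\<^sup>2 + (N Y)\<^sup>2" using V by (simp add: D_def N_square)
    also have "\<dots> \<le> (N X + N Y)\<^sup>2" using N_nonneg V by (simp add: power2_sum)
    finally have D: "D \<le> (graph_norm P X)\<^sup>2" by (simp add: graph_norm_def Y_def)
    have D0: "D \<ge> 0" "energy_form X X \<le> D" using nn by (auto simp: D_def)
    have mech_form: "mech_form (S s X) (S s X) \<le> C4 * s powr (- r) * D" if s: "s > 0" for s
    proof -
      have "mech_form (S s X) (S s X) \<le> C3 * (C1 * s powr (- r) * (C2 * D))"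
      proof (rule sBh)
        show "S s X \<in> V" using s V by (auto intro: S_in)
        fix n
        have "(\<Sum>k<n. mode_mech k (S s X)) \<le> (\<Sum>k<n. C1 * s powr (- r) * (mode_energy k X + mode_energy k Y))"
          unfolding Y_def by (intro sum_mono mode_mech X s)
        also have "\<dots> = C1 * s powr (- r) * ((\<Sum>k<n. mode_energy k X) + (\<Sum>k<n. mode_energy k Y))"
          unfolding sum.distrib[symmetric] sum_distrib_left ..
        also have "\<dots> \<le> C1 * s powr (- r) * (C2 * D)"
          using mode_energy[OF V(1), of n] mode_energy[OF V(2), of n] C1 by (intro mult_left_mono) (auto simp: D_def distrib_left)
        finally show "(\<Sum>k<n. mode_mech k (S s X)) \<le> C1 * s powr (- r) * (C2 * D)" .
      qed
      then show ?thesis by (simp add: C4_def mult_ac)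
    qed
    define E where "E = (\<lambda>s. energy_form (S s X) (S s X))"
    define M where "M = C4 * (t / 2) powr (- r) * D"
    \<comment> \<open>M bounds the mechanical part on [t/2, t], so E - M times the integrating
      factor does not increase there.\<close>
    define H where "H = (\<lambda>s. exp (\<delta> * s) * (E s - M))"
    define H' where "H' = (\<lambda>s. exp (\<delta> * s) * (\<delta> * (mech_form (S s X) (S s X) - M)))"
    have "H t \<le> H (t / 2)"
    proof (rule nonincreasing_from_deriv[where f = H and f' = H'])
      fix s :: real assume s: "s \<ge> 0"
      have SV: "S s X \<in> V" using s V by (auto intro: S_in)
      have dE: "(E has_real_derivative - \<delta> * memory_form (S s X) (S s X)) (at s within {0..})"
        unfolding E_def by (rule energy_orbit_deriv[OF G s])
      have "(H has_real_derivative exp (\<delta> * s) * \<delta> * (E s - M) + exp (\<delta> * s) * (- \<delta> * memory_form (S s X) (S s X))) (at s within {0..})"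
        unfolding H_def using dE by (auto intro!: derivative_eq_intros)
      also have "exp (\<delta> * s) * \<delta> * (E s - M) + exp (\<delta> * s) * (- \<delta> * memory_form (S s X) (S s X)) = H' s"
        using energy_form_eq[OF SV SV] by (simp add: H'_def E_def algebra_simps)
      finally show "(H has_real_derivative H' s) (at s within {0..})" .
    next
      fix s assume s: "t / 2 < s" "s < t"
      have "mech_form (S s X) (S s X) \<le> C4 * s powr (- r) * D" using s t by (intro mech_form) auto
      also have "\<dots> \<le> M"
        unfolding M_def using s t C45 D0 r_pos by (intro mult_right_mono mult_left_mono powr_mono2') auto
      finally have "\<delta> * (mech_form (S s X) (S s X) - M) \<le> 0" using \<delta> by (simp add: mult_le_0_iff)
      then show "H' s \<le> 0" by (simp add: H'_def mult_le_0_iff)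
    qed (use t in auto)
    then have "exp (- \<delta> * t) * H t \<le> exp (- \<delta> * t) * H (t / 2)" by (intro mult_left_mono) auto
    moreover have "exp (- \<delta> * t) * H t = E t - M"
      by (simp add: H_def mult.assoc[symmetric] flip: exp_add)
    moreover have "exp (- \<delta> * t) * H (t / 2) = exp (- (\<delta> / 2) * t) * (E (t / 2) - M)"
      by (simp add: H_def mult.assoc[symmetric] flip: exp_add)
    \<comment> \<open>The value at t/2 is forgotten exponentially, hence faster than t^(-r), with K
      as the constant.\<close>
    moreover have "exp (- (\<delta> / 2) * t) * (E (t / 2) - M) \<le> K * t powr (- r) * D"
    proof (rule order_trans[OF mult_left_mono mult_right_mono])
      show "exp (- (\<delta> / 2) * t) \<le> K * t powr (- r)"
        unfolding K_def by (rule exp_le_powr_neg) (use \<delta> t r_pos in auto)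
      have tV: "S (t / 2) X \<in> V" using t V by (auto intro: S_in)
      have "N (S (t / 2) X) \<le> N X" using t V by (intro S_contr) auto
      then have "(N (S (t / 2) X))\<^sup>2 \<le> (N X)\<^sup>2" using N_nonneg[OF tV] by (rule power_mono)
      then have 1: "E (t / 2) \<le> D" using N_square V tV D0 by (simp add: E_def)
      have "M \<ge> 0" unfolding M_def using C45 D0 by (intro mult_nonneg_nonneg) auto
      then show "E (t / 2) - M \<le> D" using 1 by simp
    qed (use D0 in auto)
    ultimately have "E t \<le> M + K * t powr (- r) * D" by linarith
    also have "\<dots> = C5 * t powr (- r) * D"
      using t by (simp add: M_def C5_def powr_divide powr_minus_divide field_simps)
    also have "\<dots> \<le> C5 * t powr (- r) * (graph_norm P X)\<^sup>2"
      using C45 D by (intro mult_left_mono) auto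
    finally show ?thesis by (simp add: E_def)
  qed
  show ?thesis
  proof (intro exI[of _ "sqrt C5"] conjI ballI allI impI)
    show "sqrt C5 > 0" using C45 by simp
    fix X and t :: real assume X: "X \<in> evol_dom P" and t: "t \<ge> 1"
    have gn: "graph_norm P X \<ge> 0"
      unfolding graph_norm_def using N_nonneg[OF evol_dom_in[OF X]] N_nonneg[OF evol_op_in[OF X]] by simp
    define e where "e = - (1 / (2 - 2 * a))"
    \<comment> \<open>The squared norm decays with exponent r = 1/(1-a), the norm with half of
      it.\<close>
    have "- r = e + e" using params by (simp add: e_def field_simps)
    then have rr: "t powr (- r) = (t powr e)\<^sup>2" by (simp only: powr_add power2_eq_square)
    have "N (S t X) \<le> sqrt (C5 * t powr (- r) * (graph_norm P X)\<^sup>2)"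
      unfolding N_eq by (rule real_sqrt_le_mono[OF main[OF X t]])
    also have "\<dots> = sqrt C5 * t powr (- (1 / (2 - 2 * a))) * graph_norm P X"
      using gn unfolding rr e_def[symmetric] by (simp add: real_sqrt_mult)
    finally show "N (S t X) \<le> sqrt C5 * t powr (- (1 / (2 - 2 * a))) * graph_norm P X" .
  qed
qed

section \<open>Optimality of the rate\<close>

lemma zero_state_dom: "zero_state \<in> evol_dom P"
proof -
  have "has_mem_deriv P (\<lambda>_. 0) (\<lambda>_. 0)"
    by (simp add: has_mem_deriv_def mem_const dom_pow_zero set_lebesgue_integral_def)
  moreover have "0 \<in> domA P"
    using adm by (simp add: admissible_def self_adjoint_def linear_operator_def)
  ultimately show ?thesis
    by (auto simp: evol_dom_def mem_const dom_pow_zero mem_mean_def)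
qed

text \<open>Single-valuedness of the generator at \<open>0\<close> shows that the chosen derivative of the zero
  memory is negligible.\<close>

lemma N_evol_zero_state: "N (evol_op P zero_state) = 0"
proof -
  define Y where "Y = evol_op P zero_state"
  have YV: "Y \<in> V" unfolding Y_def by (rule evol_op_in[OF zero_state_dom])
  have lim: "((\<lambda>h. N (state_diff (rscale (1 / h) (state_diff (S h zero_state) zero_state)) Y)) \<longlongrightarrow> 0) (at_right 0)"
    using evol_generator[OF zero_state_dom] by (simp only: generator_graph_def Y_def)
  have "N (state_diff (rscale (1 / h) (state_diff (S h zero_state) zero_state)) Y) = N (state_diff zero_state Y)" if "h > 0" for h
  proof (rule state_eq_N)
    have "state_eq (state_diff (S h zero_state) zero_state) (state_diff zero_state zero_state)"
      using that by (intro state_eq_diff S_zero state_eq_refl) auto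
    then have "state_eq (rscale (1 / h) (state_diff (S h zero_state) zero_state)) (rscale (1 / h) (state_diff zero_state zero_state))"
      by (rule state_eq_scale)
    also have "rscale (1 / h) (state_diff zero_state zero_state) = zero_state" by (simp add: state_diff_def)
    finally show "state_eq (state_diff (rscale (1 / h) (state_diff (S h zero_state) zero_state)) Y) (state_diff zero_state Y)"
      by (intro state_eq_diff state_eq_refl)
  qed (use that YV zero_state_in in \<open>intro state_diff_in state_scale_in S_in; simp\<close>)+
  then have "((\<lambda>h. N (state_diff (rscale (1 / h) (state_diff (S h zero_state) zero_state)) Y)) \<longlongrightarrow> N (state_diff zero_state Y)) (at_right 0)"
    by (intro tendsto_eventually) (auto simp: eventually_at_filter)
  from tendsto_unique[OF _ this lim] have "N (state_diff zero_state Y) = 0" by simp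
  moreover have "state_diff Y zero_state = Y" by (cases Y) (simp add: state_diff_def)
  ultimately show ?thesis using N_dist_commute[OF YV zero_state_in] by (simp add: Y_def)
qed

definition slow :: "nat \<Rightarrow> 'h state" where
  "slow k = (0, \<Psi> k, 0, 0, \<lambda>_. 0)"

lemma slow_dom: "slow k \<in> evol_dom P"
  using zero_state_dom dom_pow_basis by (auto simp: evol_dom_def slow_def)

text \<open>The derivative of the zero memory is a choice and may differ from 0 on a negligible set,
  so the image of \<open>slow k\<close> is W plus the image of \<open>zero_state\<close>, whose norm
  vanishes.\<close>

lemma slow_graph_norm: "graph_norm P (slow k) \<le> sqrt \<rho> + sqrt (\<alpha> * \<xi> k)"
proof -
  define W where "W = (\<Psi> k, 0::'h, 0::'h, 0::'h, \<lambda>_::real. \<Psi> k)"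
  have WV: "W \<in> V" unfolding W_def by (intro stateI dom_pow_basis dom_pow_zero mem_const)
  have A0: "opA P 0 = 0" using domA(2)[of 0] zero_state_dom by (auto simp: evol_dom_def dom_pow_zero)
  have m0: "mem_mean P (\<lambda>_. 0) = 0" by (simp add: mem_mean_def)
  have "evol_op P (slow k) = state_add W (evol_op P zero_state)"
    by (simp add: slow_def W_def A0 m0 dom_pow_zero)
  then have "N (evol_op P (slow k)) \<le> N W"
    using N_triangle[OF WV evol_op_in[OF zero_state_dom]] N_evol_zero_state by simp
  also have "N W = sqrt (energy_form W W)" by (rule N_eq)
  also have "energy_form W W \<le> \<alpha> * \<xi> k"
  proof -
    have n: "(norm (pw \<theta> (\<Psi> k)))\<^sup>2 = \<xi> k powr (2 * \<theta>)" for \<theta>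
      by (simp add: dom_pow_basis power2_eq_square flip: powr_add)
    have "memory_inner (\<lambda>_. \<Psi> k) (\<lambda>_. \<Psi> k) = 1 / \<delta> * (norm (Ah (\<Psi> k)))\<^sup>2"
      unfolding memory_inner_def Re_cinner_self using exp_integral(2)[OF \<delta>] by simp
    \<comment> \<open>The constant memory contributes exactly the term \<zeta> |A^(a/2) \<Psi>_k|^2
      that the energy subtracts from the elastic part, and the two cancel.\<close>
    then have "energy_form W W = \<alpha>\<^sub>1 * (norm (pw (1/2) (\<Psi> k)))\<^sup>2 + \<beta> * (norm (\<gamma> *\<^sub>R pw (1/2) (\<Psi> k)))\<^sup>2"
      unfolding energy_form_eq[OF WV WV] by (simp add: W_def Re_cinner_self dom_pow_zero)
    also have "\<dots> = \<alpha>\<^sub>1 * \<xi> k + \<beta> * \<gamma>\<^sup>2 * \<xi> k"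
      using n[of "1/2"] \<xi>_pos[of k] by (simp add: power_mult_distrib powr_one)
    also have "\<dots> = \<alpha> * \<xi> k" by (simp add: alpha1_def algebra_simps)
    finally show ?thesis by simp
  qed
  finally have 1: "N (evol_op P (slow k)) \<le> sqrt (\<alpha> * \<xi> k)" by simp
  have sV: "slow k \<in> V" by (rule evol_dom_in[OF slow_dom])
  have "energy_form (slow k) (slow k) = \<rho>"
    unfolding energy_form_eq[OF sV sV] by (simp add: slow_def dom_pow_zero Re_cinner_self memory_inner_def)
  then have "N (slow k) = sqrt \<rho>" by (simp add: N_eq)
  then show ?thesis using 1 by (simp add: graph_norm_def)
qed

text \<open>The full norm dominates the energy of the single mode k, whose decrease
  \<open>mode_lower\<close> bounds; imaginary parts are dropped as a nonnegative
  contribution.\<close>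

lemma slow_lower:
  obtains c C where "c > 0" "C > 0"
    "\<And>k t. t \<ge> 0 \<Longrightarrow> c * (\<rho> - C * \<xi> k powr (a - 1) * t) \<le> (N (S t (slow k)))\<^sup>2"
proof -
  obtain C where C: "C > 0" and low:
    "\<And>\<xi> b v u p q m t. mp.mode_ok \<xi> b \<Longrightarrow> mp.mode_sol \<xi> b v u p q m \<Longrightarrow> t \<ge> 0 \<Longrightarrow>
     v 0 = 0 \<Longrightarrow> u 0 = 1 \<Longrightarrow> p 0 = 0 \<Longrightarrow> q 0 = 0 \<Longrightarrow> m 0 = 0 \<Longrightarrow>
     \<rho> - C * (b / \<xi>) * t \<le> mp.energy \<xi> b (v t) (u t) (p t) (q t) (m t)"
    using mp.mode_lower by blast
  obtain C2 where C2: "C2 > 0" and mode_energy: "\<And>X n. X \<in> V \<Longrightarrow> (\<Sum>k<n. mode_energy k X) \<le> C2 * energy_form X X" using mode_energy_sum_le by blast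
  obtain C4 where C4: "C4 > 0" and EB: "\<And>\<xi> b v u p q m. mp.mode_ok \<xi> b \<Longrightarrow>
     mp.energy \<xi> b v u p q m \<le> C4 * mp.base \<xi> b v u p q m" using mp.energy_le_base by blast
  define G where "G = 2 + 2 * \<gamma>\<^sup>2"
  have G: "G > 0" unfolding G_def by (intro add_pos_nonneg) auto
  show thesis
  proof (rule that[of "1 / (C4 * G * C2)" C])
    show "1 / (C4 * G * C2) > 0" "C > 0" using C C2 C4 G by auto
    fix k and t :: real assume t: "t \<ge> 0"
    define X where "X = S t (slow k)"
    have sV: "slow k \<in> V" by (rule evol_dom_in[OF slow_dom])
    have XV: "X \<in> V" unfolding X_def using t sV by (rule S_in)
    have pr: "part Re" by (simp add: part_def)
    have m0: "mem_mean P (\<lambda>_. 0) = 0" by (simp add: mem_mean_def)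
    define e where "e = mp.energy (\<xi> k) (\<xi> k powr a) (Re (cv k X)) (Re (cu k X)) (Re (cp k X)) (Re (cq k X)) (Re (cm k X))"
    have "\<rho> - C * (\<xi> k powr a / \<xi> k) * t \<le> e"
      unfolding e_def X_def
      by (rule low[OF mode_ok mode_sol[OF slow_dom pr] t])
         (simp_all add: coeff_0[OF sV pr], simp_all add: slow_def orthonormal m0)
    also have "e \<le> C4 * mp.base (\<xi> k) (\<xi> k powr a) (Re (cv k X)) (Re (cu k X)) (Re (cp k X)) (Re (cq k X)) (Re (cm k X))"
      unfolding e_def by (rule EB[OF mode_ok])
    also have "\<dots> \<le> C4 * (G * mp.mode_norm (\<xi> k) (\<xi> k powr a) (Re (cv k X)) (Re (cu k X)) (Re (cp k X)) (Re (cq k X)) (Re (cm k X)))"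
      unfolding G_def using C4 \<xi>_pos[of k] by (intro mult_left_mono mp.base_le_mode_norm) auto
    also have "\<dots> \<le> C4 * (G * mode_energy k X)"
    proof -
      have "0 \<le> mp.mode_norm (\<xi> k) (\<xi> k powr a) (Im (cv k X)) (Im (cu k X)) (Im (cp k X)) (Im (cq k X)) (Im (cm k X))"
        using \<xi>_pos[of k] by (simp add: mp.mode_norm_def)
      then show ?thesis using C4 G by (intro mult_left_mono) (auto simp: mode_energy_mode_norm)
    qed
    also have "\<dots> \<le> C4 * (G * (C2 * energy_form X X))"
    proof -
      have "0 \<le> (\<Sum>j<k. mode_energy j X)" by (rule sum_nonneg) (use mode_mech_nonneg mode_mech_le_mode_energy order_trans in blast)
      then have "mode_energy k X \<le> C2 * energy_form X X" using mode_energy[OF XV, of "Suc k"] by simp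
      then show ?thesis using C4 G by (intro mult_left_mono) auto
    qed
    finally have "\<rho> - C * \<xi> k powr (a - 1) * t \<le> (C4 * G * C2) * energy_form X X"
      by (simp add: ratio mult_ac)
    then show "1 / (C4 * G * C2) * (\<rho> - C * \<xi> k powr (a - 1) * t) \<le> (N (S t (slow k)))\<^sup>2"
      using C2 C4 G N_square[OF XV] by (simp add: X_def field_simps)
  qed
qed

text \<open>At the time t_k, of order \<xi>_k^(1-a), a fixed share of the energy of
  \<open>slow k\<close> is still present, while the graph norm is at most of order \<xi>_k^(1/2),
  that is t_k^(1/(2-2a)). A better rate would put a fixed positive number below a multiple of
  \<xi>_k^(-(1-a) \<epsilon>), which tends to 0.\<close>

lemma lower_rate:
  assumes \<epsilon>: "\<epsilon> > 0" and C: "C > 0"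
    and bound: "\<And>X t. X \<in> evol_dom P \<Longrightarrow> t \<ge> 1 \<Longrightarrow>
      N (S t X) \<le> C * t powr (- (1 / (2 - 2 * a)) - \<epsilon>) * graph_norm P X"
  shows False
proof -
  obtain c C1 where c: "c > 0" and C1: "C1 > 0" and
    low: "\<And>k t. t \<ge> 0 \<Longrightarrow> c * (\<rho> - C1 * \<xi> k powr (a - 1) * t) \<le> (N (S t (slow k)))\<^sup>2"
    using slow_lower by blast
  \<comment> \<open>Chosen so that the lower bound \<rho> - C1 \<xi>^(a-1) t has dropped to \<rho>/2
    at the time t_k.\<close>
  define \<tau> where "\<tau> = \<rho> / (2 * C1)"
  have \<tau>: "\<tau> > 0" using params C1 by (simp add: \<tau>_def)
  define t where "t = (\<lambda>k. \<tau> * \<xi> k powr (1 - a))"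
  define e where "e = - (1 / (2 - 2 * a)) - \<epsilon>"
  define K where "K = C * \<tau> powr e * (sqrt (\<rho> / \<xi> 0) + sqrt \<alpha>)"
  have up: "sqrt (c * (\<rho> / 2)) \<le> K * \<xi> k powr (- ((1 - a) * \<epsilon>))" if "t k \<ge> 1" for k
  proof -
    have x: "\<xi> k > 0" by (rule \<xi>_pos)
    have "\<xi> k powr (a - 1) * \<xi> k powr (1 - a) = 1" using x by (simp flip: powr_add)
    then have eq: "C1 * \<xi> k powr (a - 1) * t k = \<rho> / 2"
      using C1 by (simp add: t_def \<tau>_def)
    have "c * (\<rho> - \<rho> / 2) \<le> (N (S (t k) (slow k)))\<^sup>2"
      unfolding eq[symmetric] by (rule low) (use that in simp)
    then have "c * (\<rho> / 2) \<le> (N (S (t k) (slow k)))\<^sup>2" by simp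
    then have "sqrt (c * (\<rho> / 2)) \<le> N (S (t k) (slow k))"
      using that N_nonneg[OF S_in[OF _ evol_dom_in[OF slow_dom]], of "t k" k] by (intro real_le_lsqrt) auto
    also have "\<dots> \<le> C * t k powr e * graph_norm P (slow k)"
      unfolding e_def by (rule bound[OF slow_dom that])
    also have "\<dots> \<le> C * t k powr e * (sqrt \<rho> + sqrt (\<alpha> * \<xi> k))"
      using C by (intro mult_left_mono slow_graph_norm) auto
    also have "\<dots> \<le> C * t k powr e * (\<xi> k powr (1/2) * (sqrt (\<rho> / \<xi> 0) + sqrt \<alpha>))"
    proof (intro mult_left_mono)
      \<comment> \<open>As the eigenvalues stay above \<xi> 0, the constant \<rho> is absorbed into
        a multiple of \<xi> k.\<close>
      have "\<rho> \<le> \<xi> k * (\<rho> / \<xi> 0)" using params \<xi>0 \<xi>_mono[of k] by (simp add: field_simps)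
      then have "sqrt \<rho> \<le> sqrt (\<xi> k * (\<rho> / \<xi> 0))" by (rule real_sqrt_le_mono)
      then have "sqrt \<rho> \<le> sqrt (\<xi> k) * sqrt (\<rho> / \<xi> 0)" unfolding real_sqrt_mult .
      then show "sqrt \<rho> + sqrt (\<alpha> * \<xi> k) \<le> \<xi> k powr (1/2) * (sqrt (\<rho> / \<xi> 0) + sqrt \<alpha>)"
        using x by (simp add: powr_half_sqrt real_sqrt_mult distrib_left mult.commute)
    qed (use C in auto)
    also have "t k powr e = \<tau> powr e * \<xi> k powr ((1 - a) * e)"
      using \<tau> x by (simp add: t_def powr_mult powr_powr)
    also have "C * (\<tau> powr e * \<xi> k powr ((1 - a) * e)) * (\<xi> k powr (1/2) * (sqrt (\<rho> / \<xi> 0) + sqrt \<alpha>))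
        = K * (\<xi> k powr ((1 - a) * e) * \<xi> k powr (1/2))"
      by (simp add: K_def mult_ac)
    also have "\<xi> k powr ((1 - a) * e) * \<xi> k powr (1/2) = \<xi> k powr (- ((1 - a) * \<epsilon>))"
    proof -
      have "(1 - a) * e + 1/2 = - ((1 - a) * \<epsilon>)" using params by (simp add: e_def field_simps)
      then show ?thesis by (simp flip: powr_add)
    qed
    finally show ?thesis .
  qed
  have lim: "(\<lambda>k. K * \<xi> k powr (- ((1 - a) * \<epsilon>))) \<longlonglongrightarrow> K * 0"
    by (intro tendsto_mult tendsto_const tendsto_neg_powr \<xi>_lim) (use params \<epsilon> in auto)
  \<comment> \<open>The assumed bound speaks of times t \<ge> 1 only, so t_k has to be eventually
    large.\<close>
  have "filterlim (\<lambda>k. \<tau> * \<xi> k powr (1 - a)) at_top sequentially"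
  proof (rule filterlim_tendsto_pos_mult_at_top[OF tendsto_const \<tau>])
    have "filterlim (\<lambda>k. exp ((1 - a) * ln (\<xi> k))) at_top sequentially"
      by (intro filterlim_compose[OF exp_at_top] filterlim_tendsto_pos_mult_at_top[OF tendsto_const]
          filterlim_compose[OF ln_at_top] \<xi>_lim) (use params in auto)
    moreover have "\<xi> k powr (1 - a) = exp ((1 - a) * ln (\<xi> k))" for k
      using \<xi>_pos[of k] by (simp add: powr_def)
    ultimately show "filterlim (\<lambda>k. \<xi> k powr (1 - a)) at_top sequentially" by simp
  qed
  then have "\<forall>\<^sub>F k in sequentially. t k \<ge> 1" unfolding t_def by (simp add: filterlim_at_top)
  then have "\<forall>\<^sub>F k in sequentially. sqrt (c * (\<rho> / 2)) \<le> K * \<xi> k powr (- ((1 - a) * \<epsilon>))"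
    by eventually_elim (rule up)
  from tendsto_lowerbound[OF lim this] have "sqrt (c * (\<rho> / 2)) \<le> 0" by simp
  moreover have "sqrt (c * (\<rho> / 2)) > 0" using c params by simp
  ultimately show False by simp
qed

end

theorem theorem4p3:
  fixes P :: "'h::separable_chilbert_space memory_system"
    and \<delta> :: real
    and S :: "real \<Rightarrow> 'h state \<Rightarrow> 'h state"
  assumes "admissible P"
    and "\<delta> > 0" and "kern P = (\<lambda>s. exp (- \<delta> * s))"
    and coercive: "\<exists>\<kappa>. 0 < \<kappa> \<and> \<kappa> < alpha1 P \<and>
      (\<forall>u \<in> dom_pow P (1/2). u \<noteq> 0 \<longrightarrow>
         alpha1 P * (norm (op_pow P (1/2) u))\<^sup>2 - zeta P * (norm (op_pow P (par_a P / 2) u))\<^sup>2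
           > \<kappa> * (norm (op_pow P (1/2) u))\<^sup>2)"
    and "generates_contraction_semigroup P S"
  shows "(\<exists>C>0. \<forall>X\<^sub>0 \<in> evol_dom P. \<forall>t\<ge>1.
            state_norm P (S t X\<^sub>0) \<le> C * t powr (- (1 / (2 - 2 * par_a P))) * graph_norm P X\<^sub>0) \<and>
         \<not> (\<exists>\<epsilon>>0. \<exists>C>0. \<forall>X\<^sub>0 \<in> evol_dom P. \<forall>t\<ge>1.
            state_norm P (S t X\<^sub>0) \<le> C * t powr (- (1 / (2 - 2 * par_a P)) - \<epsilon>) * graph_norm P X\<^sub>0)"
proof -
  obtain \<kappa> where \<kappa>: "0 < \<kappa>" and co: "\<forall>u \<in> dom_pow P (1/2). u \<noteq> 0 \<longrightarrow>
         alpha1 P * (norm (op_pow P (1/2) u))\<^sup>2 - zeta P * (norm (op_pow P (par_a P / 2) u))\<^sup>2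
           > \<kappa> * (norm (op_pow P (1/2) u))\<^sup>2"
    using coercive by blast
  interpret coercive_semigroup P \<delta> \<kappa> S
    using assms(1-3,5) \<kappa> co by unfold_locales auto
  show ?thesis using upper_rate lower_rate by blast
qed

end
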